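(* Let $A$ be the infinitesimal generator of a $C_0$-semigroup $\{U(t)\}_{t\ge 0}$ on $H$ which is exponentially stable: $\|U(t)\|\le \mathcal N e^{-\nu t}$ for all $t\ge 0$, with constants $\mathcal N,\nu>0$. Suppose that - $F,G\in C(\mathbb R\times H,H)$ are locally Lipschitz in $x\in H$; - there exist positive constants $A_0,M$ such that $|F(t,x)|,|G(t,x)|\le A_0+M|x|$ for all $x\in H$ and $t\in\mathbb R$; - $M<\dfrac{\nu}{\mathcal N\sqrt{6(\nu+1)}}$. For $t_0\in\mathbb R$ let $x(t;t_0,x_0)$, $t\ge t_0$, denote the mild solution of $$dx(t)=(Ax(t)+F(t,x(t)))\,dt+G(t,x(t))\,dW(t)$$ with initial value $x(t_0)=x_0$. Then for any initial value $x_0$ with $\mathbb E|x_0|^2<\infty$ and any $t\ge t_0$, $$\mathbb E|x(t;t_0,x_0)|^2\le 3\mathcal N^2\left[\mathbb E|x_0|^2-\frac{2A_0^2(\nu+1)}{\nu^2-6\mathcal N^2M^2(\nu+1)}\right]\exp\bigl\{-[\nu-6\mathcal N^2M^2(1+1/\nu)](t-t_0)\bigr\}+\frac{6\mathcal N^2A_0^2(\nu+1)}{\nu^2-6\mathcal N^2M^2(\nu+1)}.$$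
   Context: $(H,|\cdot|)$ is a real separable Hilbert space, $(\Omega,\mathcal F,\mathbb P)$ a probability space, $W$ a two-sided standard one-dimensional Brownian motion on it, and $\mathcal F_t:=\sigma\{W(u):u\le t\}$. A mild solution with initial value $x(t_0)=x_0$ is an $\mathcal F_t$-adapted process $\{x(t)\}_{t\ge t_0}$ (so that $x_0$ is $\mathcal F_{t_0}$-measurable) satisfying $x(t)=U(t-t_0)x_0+\int_{t_0}^tU(t-s)F(s,x(s))\,ds+\int_{t_0}^tU(t-s)G(s,x(s))\,dW(s)$ for $t\ge t_0$.
   Formalization: For t<0 the filtration F_t is generated by the increments W(u)-W(v), u,v<=t, instead of by W(u), u<=t: with W(0)=0 the latter contains future increments, W is not a Brownian motion for it, and the bound fails. For t>=0 the two coincide. *)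

theory Defs
  imports "HOL-Probability.Probability"
begin

subsection \<open>Semigroups\<close>

text \<open>Only the values \<open>U t\<close> with \<open>t \<ge> 0\<close> matter.\<close>

definition C0_semigroup :: "(real \<Rightarrow> 'h::real_normed_vector \<Rightarrow>\<^sub>L 'h) \<Rightarrow> bool" where
  "C0_semigroup U \<longleftrightarrow>
     U 0 = id_blinfun \<and>
     (\<forall>s\<ge>0. \<forall>t\<ge>0. U (s + t) = U s o\<^sub>L U t) \<and>
     (\<forall>x. ((\<lambda>t. U t x) \<longlongrightarrow> x) (at_right 0))"

text \<open>The (in general unbounded) generator is the pair of its domain \<open>D\<close> and a map \<open>A\<close>, whose
  values outside \<open>D\<close> are irrelevant.\<close>

definition infinitesimal_generator ::
  "(real \<Rightarrow> 'h::real_normed_vector \<Rightarrow>\<^sub>L 'h) \<Rightarrow> 'h set \<Rightarrow> ('h \<Rightarrow> 'h) \<Rightarrow> bool" where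
  "infinitesimal_generator U D A \<longleftrightarrow>
     D = {x. \<exists>y. ((\<lambda>h. (U h x - x) /\<^sub>R h) \<longlongrightarrow> y) (at_right 0)} \<and>
     (\<forall>x\<in>D. ((\<lambda>h. (U h x - x) /\<^sub>R h) \<longlongrightarrow> A x) (at_right 0))"


subsection \<open>Two-sided Brownian motion and its filtration\<close>

definition two_sided_BM :: "'w measure \<Rightarrow> (real \<Rightarrow> 'w \<Rightarrow> real) \<Rightarrow> bool" where
  "two_sided_BM P W \<longleftrightarrow>
     prob_space P \<and>
     (\<forall>t. W t \<in> borel_measurable P) \<and>
     (\<forall>\<omega>\<in>space P. W 0 \<omega> = 0) \<and>
     (\<forall>s t. s < t \<longrightarrow>
        distributed P lborel (\<lambda>\<omega>. W t \<omega> - W s \<omega>) (normal_density 0 (sqrt (t - s)))) \<and>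
     (\<forall>(n::nat) (\<tau> :: nat \<Rightarrow> real). (\<forall>i<n. \<tau> i < \<tau> (Suc i)) \<longrightarrow>
        prob_space.indep_vars P (\<lambda>_. borel) (\<lambda>i \<omega>. W (\<tau> (Suc i)) \<omega> - W (\<tau> i) \<omega>) {..<n}) \<and>
     (AE \<omega> in P. continuous_on UNIV (\<lambda>t. W t \<omega>))"

text \<open>The information up to time \<open>t\<close> is generated by the increments of \<open>W\<close> before \<open>t\<close>. For \<open>t \<ge> 0\<close>
  this is \<open>\<sigma>(W u : u \<le> t)\<close>, see the lemma below. For \<open>t < 0\<close> the latter is too large: because of the
  normalisation \<open>W 0 = 0\<close> it contains \<open>W t = -(W 0 - W t)\<close>, an increment after time \<open>t\<close>, so that
  \<open>W\<close> has no independent increments relative to it and is not a Brownian motion for it.\<close>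

definition BM_filtration :: "'w measure \<Rightarrow> (real \<Rightarrow> 'w \<Rightarrow> real) \<Rightarrow> real \<Rightarrow> 'w measure" where
  "BM_filtration P W t =
     sigma (space P) {(\<lambda>\<omega>. W u \<omega> - W v \<omega>) -` B \<inter> space P | u v B. u \<le> t \<and> v \<le> t \<and> B \<in> sets borel}"

lemma sets_BM_filtration_nonneg:
  assumes W0: "\<forall>\<omega>\<in>space P. W 0 \<omega> = 0" and t: "0 \<le> t"
  shows "sets (BM_filtration P W t) =
           sets (sigma (space P) {W u -` B \<inter> space P | u B. u \<le> t \<and> B \<in> sets borel})"
    (is "_ = sets ?N")
proof -
  let ?G = "{(\<lambda>\<omega>. W u \<omega> - W v \<omega>) -` B \<inter> space P | u v B. u \<le> t \<and> v \<le> t \<and> B \<in> sets borel}"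
  let ?H = "{W u -` B \<inter> space P | u B. u \<le> t \<and> B \<in> sets borel}"
  have spN: "space ?N = space P" by (rule space_measure_of) auto
  have G: "?G \<subseteq> Pow (space P)" and H: "?H \<subseteq> Pow (space P)" by auto
  have setsN: "sets ?N = sigma_sets (space P) ?H" by (rule sets_measure_of) (rule H)
  have setsF: "sets (BM_filtration P W t) = sigma_sets (space P) ?G"
    unfolding BM_filtration_def by (rule sets_measure_of) (rule G)
  have W: "W u \<in> borel_measurable ?N" if "u \<le> t" for u
  proof (rule measurableI)
    fix B :: "real set" assume "B \<in> sets borel"
    then have "W u -` B \<inter> space P \<in> ?H" using that by blast
    then show "W u -` B \<inter> space ?N \<in> sets ?N" unfolding spN setsN by (rule sigma_sets.Basic)
  qed simp
  have "?G \<subseteq> sets ?N"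
  proof
    fix X assume "X \<in> ?G"
    then obtain u v B where X: "X = (\<lambda>\<omega>. W u \<omega> - W v \<omega>) -` B \<inter> space P"
      and uv: "u \<le> t" "v \<le> t" and B: "B \<in> sets borel" by blast
    have "(\<lambda>\<omega>. W u \<omega> - W v \<omega>) \<in> borel_measurable ?N"
      using W[OF uv(1)] W[OF uv(2)] by (rule borel_measurable_diff)
    from measurable_sets[OF this B] show "X \<in> sets ?N" unfolding X spN .
  qed
  then have 1: "sigma_sets (space P) ?G \<subseteq> sets ?N"
    using sets.sigma_sets_subset[of ?G ?N] spN by simp
  have "?H \<subseteq> ?G"
  proof
    fix X assume "X \<in> ?H"
    then obtain u B where X: "X = W u -` B \<inter> space P" and u: "u \<le> t" and B: "B \<in> sets borel"
      by blast
    have "X = (\<lambda>\<omega>. W u \<omega> - W 0 \<omega>) -` B \<inter> space P" using W0 X by auto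
    then show "X \<in> ?G" using u t B by blast
  qed
  then have 2: "sets ?N \<subseteq> sigma_sets (space P) ?G"
    unfolding setsN by (rule sigma_sets_mono')
  show ?thesis using 1 2 setsF by simp
qed


subsection \<open>The Ito integral of Hilbert space valued processes\<close>

text \<open>Elementary integrands on \<open>[a,b]\<close>: bounded \<open>\<F> (\<tau> i)\<close>-measurable values \<open>\<xi> i\<close> on
  the intervals \<open>(\<tau> i, \<tau> (i+1)]\<close>, \<open>i < n\<close>.\<close>

definition elementary ::
  "(real \<Rightarrow> 'w measure) \<Rightarrow> real \<Rightarrow> real \<Rightarrow> nat \<Rightarrow> (nat \<Rightarrow> real) \<Rightarrow>
     (nat \<Rightarrow> 'w \<Rightarrow> 'h::{real_normed_vector, second_countable_topology}) \<Rightarrow> bool" where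
  "elementary \<F> a b n \<tau> \<xi> \<longleftrightarrow>
     a \<le> \<tau> 0 \<and> \<tau> n \<le> b \<and>
     (\<forall>i<n. \<tau> i \<le> \<tau> (Suc i) \<and> \<xi> i \<in> borel_measurable (\<F> (\<tau> i)) \<and>
        (\<exists>C. \<forall>\<omega>\<in>space (\<F> (\<tau> i)). norm (\<xi> i \<omega>) \<le> C))"

definition elementary_process ::
  "nat \<Rightarrow> (nat \<Rightarrow> real) \<Rightarrow> (nat \<Rightarrow> 'w \<Rightarrow> 'h::real_normed_vector) \<Rightarrow> real \<Rightarrow> 'w \<Rightarrow> 'h" where
  "elementary_process n \<tau> \<xi> s \<omega> = (\<Sum>i<n. indicat_real {\<tau> i<..\<tau> (Suc i)} s *\<^sub>R \<xi> i \<omega>)"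

definition elementary_integral ::
  "(real \<Rightarrow> 'w \<Rightarrow> real) \<Rightarrow> nat \<Rightarrow> (nat \<Rightarrow> real) \<Rightarrow> (nat \<Rightarrow> 'w \<Rightarrow> 'h::real_normed_vector) \<Rightarrow> 'w \<Rightarrow> 'h" where
  "elementary_integral W n \<tau> \<xi> \<omega> = (\<Sum>i<n. (W (\<tau> (Suc i)) \<omega> - W (\<tau> i) \<omega>) *\<^sub>R \<xi> i \<omega>)"

text \<open>\<open>Y\<close> is (a version of) the integral of \<open>\<phi>\<close> against \<open>W\<close> over \<open>[a,b]\<close>. The integrand is measurable,
  adapted and almost surely square integrable in time; the integral is the limit in probability of
  the integrals of elementary processes which approximate \<open>\<phi>\<close> in \<open>L\<^sup>2([a,b])\<close> in probability.
  It is a relation since \<open>Y\<close> is determined only almost surely.\<close>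

definition has_Ito_integral ::
  "'w measure \<Rightarrow> (real \<Rightarrow> 'w measure) \<Rightarrow> (real \<Rightarrow> 'w \<Rightarrow> real) \<Rightarrow>
     (real \<Rightarrow> 'w \<Rightarrow> 'h::{real_normed_vector, second_countable_topology}) \<Rightarrow> real \<Rightarrow> real \<Rightarrow>
     ('w \<Rightarrow> 'h) \<Rightarrow> bool" where
  "has_Ito_integral P \<F> W \<phi> a b Y \<longleftrightarrow>
     case_prod \<phi> \<in> borel_measurable (restrict_space lborel {a..b} \<Otimes>\<^sub>M P) \<and>
     (\<forall>s\<in>{a..b}. \<phi> s \<in> borel_measurable (\<F> s)) \<and>
     (AE \<omega> in P. (\<integral>\<^sup>+s\<in>{a..b}. ennreal ((norm (\<phi> s \<omega>))\<^sup>2) \<partial>lborel) < \<infinity>) \<and>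
     Y \<in> borel_measurable P \<and>
     (\<exists>(n :: nat \<Rightarrow> nat) (\<tau> :: nat \<Rightarrow> nat \<Rightarrow> real) (\<xi> :: nat \<Rightarrow> nat \<Rightarrow> 'w \<Rightarrow> 'h).
        (\<forall>k. elementary \<F> a b (n k) (\<tau> k) (\<xi> k)) \<and>
        (\<forall>\<epsilon>>0. (\<lambda>k. measure P {\<omega>\<in>space P.
            (\<integral>\<^sup>+s\<in>{a..b}. ennreal ((norm (elementary_process (n k) (\<tau> k) (\<xi> k) s \<omega> - \<phi> s \<omega>))\<^sup>2) \<partial>lborel)
              > ennreal \<epsilon>}) \<longlonglongrightarrow> 0) \<and>
        (\<forall>\<epsilon>>0. (\<lambda>k. measure P {\<omega>\<in>space P.
            norm (elementary_integral W (n k) (\<tau> k) (\<xi> k) \<omega> - Y \<omega>) > \<epsilon>}) \<longlonglongrightarrow> 0))"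


subsection \<open>Mild solutions\<close>

text \<open>\<open>x\<close> is a mild solution on \<open>[t0,\<infinity>)\<close> of \<open>dx = (Ax + F(t,x)) dt + G(t,x) dW\<close> with \<open>x(t0) = x0\<close>, where
  \<open>A\<close> generates \<open>U\<close>. Besides the integral equation only measurability and the almost sure
  integrability of \<open>F(s,x(s))\<close> and \<open>|G(s,x(s))|\<^sup>2\<close> over bounded intervals are required, which give
  the two integrals a meaning; in particular, no moment of \<open>x\<close> is assumed to be finite.\<close>

definition mild_solution ::
  "'w measure \<Rightarrow> (real \<Rightarrow> 'w \<Rightarrow> real) \<Rightarrow> (real \<Rightarrow> 'h \<Rightarrow>\<^sub>L 'h) \<Rightarrow>
     (real \<Rightarrow> 'h \<Rightarrow> 'h) \<Rightarrow> (real \<Rightarrow> 'h \<Rightarrow> 'h) \<Rightarrow> real \<Rightarrow>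
     ('w \<Rightarrow> 'h::{real_inner, banach, second_countable_topology}) \<Rightarrow> (real \<Rightarrow> 'w \<Rightarrow> 'h) \<Rightarrow> bool" where
  "mild_solution P W U F G t0 x0 x \<longleftrightarrow>
     x0 \<in> borel_measurable (BM_filtration P W t0) \<and>
     (AE \<omega> in P. x t0 \<omega> = x0 \<omega>) \<and>
     case_prod x \<in> borel_measurable (restrict_space lborel {t0..} \<Otimes>\<^sub>M P) \<and>
     (\<forall>t\<ge>t0. x t \<in> borel_measurable (BM_filtration P W t)) \<and>
     (\<forall>t\<ge>t0. AE \<omega> in P. set_integrable lborel {t0..t} (\<lambda>s. F s (x s \<omega>))) \<and>
     (\<forall>t\<ge>t0. AE \<omega> in P. (\<integral>\<^sup>+s\<in>{t0..t}. ennreal ((norm (G s (x s \<omega>)))\<^sup>2) \<partial>lborel) < \<infinity>) \<and>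
     (\<forall>t\<ge>t0. \<exists>Y. has_Ito_integral P (BM_filtration P W) W (\<lambda>s \<omega>. U (t - s) (G s (x s \<omega>))) t0 t Y \<and>
        (AE \<omega> in P. x t \<omega> =
           U (t - t0) (x0 \<omega>) + (LINT s:{t0..t}|lborel. U (t - s) (F s (x s \<omega>))) + Y \<omega>))"

end

theory Submission
  imports Defs
begin

text \<open>Let \<open>m t = \<E> |x t|\<^sup>2\<close>. Since \<open>|u + v + w|\<^sup>2 \<le> 3 (|u|\<^sup>2 + |v|\<^sup>2 + |w|\<^sup>2)\<close>, the Cauchy-Schwarz inequality for
  the drift and the Ito isometry for the noise bound \<open>m t\<close> by
  \<open>3 N\<^sup>2 exp (-\<nu> (t - t0)) \<E> |x0|\<^sup>2 + 3 N\<^sup>2 (1 + 1/\<nu>) \<integral> exp (-\<nu> (t - s)) (2 A\<^sub>0\<^sup>2 + 2 M\<^sup>2 m s) ds\<close>,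
  and the asserted bound solves the corresponding equation. As \<open>m\<close> may a priori be infinite, this is
  done for \<open>x t\<close> restricted to the event that \<open>\<integral> |F| + |G|\<^sup>2\<close> over \<open>[t0, t]\<close> is at most \<open>c\<close>. On these
  events, which decrease in \<open>t\<close>, the moments are bounded uniformly in \<open>t\<close>, and the integral operator
  is a contraction because \<open>6 N\<^sup>2 M\<^sup>2 (1 + 1/\<nu>) < \<nu>\<close>, so that no Gronwall lemma is needed. Finally
  \<open>c\<close> tends to infinity.\<close>

subsection \<open>Independence of Brownian increments from the past\<close>

text \<open>The integrand of the stochastic convolution depends on the terminal time
  \<open>t\<close>, so the convolution is in general no martingale in \<open>t\<close> that could be
  stopped as a process. Localization is therefore done for each fixed \<open>t\<close> on the level
  of elementary approximations and takes the form \<E> |Y|^2 1{clock t \<le> c} \<le> \<E>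
  \<integral> |\<phi> s|^2 1{clock s \<le> c} ds. The clock \<integral> |F| + |G|^2 replaces them:
  the definition of a mild solution makes it almost surely finite, it is increasing, and whenever it
  exceeds a level it has done so strictly earlier, which partitions of vanishing mesh can detect.
  The price is that the clock is shown to be adapted only up to null sets. In the rate, 6 is 3 from
  the three terms times 2 from \<open>(A\<^sub>0 + M * |y|)^2 \<le> 2 * A\<^sub>0^2 + 2 * M^2 *
  |y|^2\<close>; in 1 + 1/\<nu>, the 1 comes from the noise, and 1/\<nu>, a bound for the mass of
  the kernel, from the drift.\<close>

lemma (in prob_space) indep_set_mono:
  assumes "indep_set \<A> \<B>" "\<A>' \<subseteq> \<A>" "\<B>' \<subseteq> \<B>"
  shows "indep_set \<A>' \<B>'"
proof (rule indep_setI)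
  show "\<A>' \<subseteq> events" "\<B>' \<subseteq> events"
    using assms indep_setD_ev1[OF assms(1)] indep_setD_ev2[OF assms(1)] by blast+
qed (use assms in \<open>auto intro: indep_setD[OF assms(1)]\<close>)

context
  fixes P :: "'w measure" and W :: "real \<Rightarrow> 'w \<Rightarrow> real"
  assumes BM: "two_sided_BM P W"
begin

interpretation prob_space P
  by (rule BM[unfolded two_sided_BM_def, THEN conjunct1])

lemma BM_measurable: "W t \<in> borel_measurable P"
  using BM by (auto simp: two_sided_BM_def)

lemma BM_increment_distributed:
  "s < t \<Longrightarrow> distributed P lborel (\<lambda>\<omega>. W t \<omega> - W s \<omega>) (normal_density 0 (sqrt (t - s)))"
  using BM by (auto simp: two_sided_BM_def)

lemma BM_increments_indep:
  "(\<And>i. i < n \<Longrightarrow> \<tau> i < \<tau> (Suc i)) \<Longrightarrow>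
    indep_vars (\<lambda>_. borel) (\<lambda>i \<omega>. W (\<tau> (Suc i)) \<omega> - W (\<tau> i) \<omega>) {..<n}"
  using BM by (auto simp: two_sided_BM_def)

lemma space_BM_filtration [simp]: "space (BM_filtration P W t) = space P"
  unfolding BM_filtration_def by (rule space_measure_of) auto

lemma sets_BM_filtration:
  "sets (BM_filtration P W t) = sigma_sets (space P)
     {(\<lambda>\<omega>. W u \<omega> - W v \<omega>) -` B \<inter> space P | u v B. u \<le> t \<and> v \<le> t \<and> B \<in> sets borel}"
  unfolding BM_filtration_def by (rule sets_measure_of) auto

lemma subalgebra_BM_filtration: "subalgebra P (BM_filtration P W t)"
proof -
  note [measurable] = BM_measurable
  show ?thesis
    unfolding subalgebra_def sets_BM_filtration by (auto intro!: sets.sigma_sets_subset)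
qed

lemma BM_filtration_mono: "s \<le> t \<Longrightarrow> subalgebra (BM_filtration P W t) (BM_filtration P W s)"
  unfolding subalgebra_def sets_BM_filtration space_BM_filtration
  by (intro conjI refl sigma_sets_mono') (blast intro: order_trans)

lemma BM_filtration_increment_measurable:
  assumes "u \<le> t" "v \<le> t"
  shows "(\<lambda>\<omega>. W u \<omega> - W v \<omega>) \<in> borel_measurable (BM_filtration P W t)"
proof (rule measurableI)
  fix B :: "real set" assume "B \<in> sets borel"
  then show "(\<lambda>\<omega>. W u \<omega> - W v \<omega>) -` B \<inter> space (BM_filtration P W t) \<in> sets (BM_filtration P W t)"
    unfolding space_BM_filtration sets_BM_filtration using assms by (intro sigma_sets.Basic) blast
qed simp

lemma BM_increment_moments:
  assumes "s \<le> t"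
  shows "integrable P (\<lambda>\<omega>. W t \<omega> - W s \<omega>)" "expectation (\<lambda>\<omega>. W t \<omega> - W s \<omega>) = 0"
    "integrable P (\<lambda>\<omega>. (W t \<omega> - W s \<omega>)\<^sup>2)" "expectation (\<lambda>\<omega>. (W t \<omega> - W s \<omega>)\<^sup>2) = t - s"
proof -
  have "integrable P (\<lambda>\<omega>. W t \<omega> - W s \<omega>) \<and> expectation (\<lambda>\<omega>. W t \<omega> - W s \<omega>) = 0 \<and>
    integrable P (\<lambda>\<omega>. (W t \<omega> - W s \<omega>)\<^sup>2) \<and> expectation (\<lambda>\<omega>. (W t \<omega> - W s \<omega>)\<^sup>2) = t - s"
  proof (cases "s = t")
    case False
    then have st: "s < t" using assms by simp
    then have \<sigma>: "0 < sqrt (t - s)" by simp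
    note D = BM_increment_distributed[OF st]
    have i1: "integrable lborel (\<lambda>x. normal_density 0 (sqrt (t - s)) x * x)"
      using integrable_normal_moment_nz_1[OF \<sigma>, of 0] .
    have i2: "integrable lborel (\<lambda>x. normal_density 0 (sqrt (t - s)) x * x\<^sup>2)"
      using integrable_normal_moment[OF \<sigma>, of 0 2] by simp
    have "integrable P (\<lambda>\<omega>. W t \<omega> - W s \<omega>)"
      using distributed_integrable[OF D, of "\<lambda>x. x"] i1 by simp
    moreover have "expectation (\<lambda>\<omega>. W t \<omega> - W s \<omega>) = 0"
      using distributed_integral[OF D, of "\<lambda>x. x"] integral_normal_moment_nz_1[OF \<sigma>, of 0] by simp
    moreover have "integrable P (\<lambda>\<omega>. (W t \<omega> - W s \<omega>)\<^sup>2)"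
      using distributed_integrable[OF D, of "\<lambda>x. x\<^sup>2"] i2 by simp
    moreover have "expectation (\<lambda>\<omega>. (W t \<omega> - W s \<omega>)\<^sup>2) = t - s"
      using distributed_integral[OF D, of "\<lambda>x. x\<^sup>2"] integral_normal_moment_even[OF \<sigma>, of 0 1] st
      by simp
    ultimately show ?thesis by blast
  qed simp
  then show "integrable P (\<lambda>\<omega>. W t \<omega> - W s \<omega>)" "expectation (\<lambda>\<omega>. W t \<omega> - W s \<omega>) = 0"
    "integrable P (\<lambda>\<omega>. (W t \<omega> - W s \<omega>)\<^sup>2)" "expectation (\<lambda>\<omega>. (W t \<omega> - W s \<omega>)\<^sup>2) = t - s"
    by blast+
qed

text \<open>Sorting the times turns arbitrary increments into sums of consecutive ones, whose joint
  independence is what the definition of Brownian motion provides.\<close>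

lemma BM_finite_past_indep:
  assumes S: "finite S" "\<And>u. u \<in> S \<Longrightarrow> u \<le> s" "s \<in> S" and st: "s < t"
  shows "\<exists>(n::nat) X Y. indep_var (PiM {..<n} (\<lambda>_. borel)) X (PiM {n} (\<lambda>_. borel)) Y \<and>
    (\<forall>\<omega>. W t \<omega> - W s \<omega> = Y \<omega> n) \<and>
    (\<forall>u\<in>S. \<forall>v\<in>S. \<exists>f \<in> borel_measurable (PiM {..<n} (\<lambda>_. borel)). \<forall>\<omega>. W u \<omega> - W v \<omega> = f (X \<omega>))"
proof -
  define l where "l = sorted_list_of_set S"
  have l: "sorted l" "distinct l" "set l = S" using S by (auto simp: l_def)
  have len: "0 < length l" using l S by (cases l) auto
  define n where "n = length l - 1"
  \<comment> \<open>Index \<open>n\<close> is the last entry of \<open>l\<close>, which is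
    \<open>s\<close>, and the next time is \<open>t\<close>. Increment number \<open>n\<close> is
    thus the one from \<open>s\<close> to \<open>t\<close>; the earlier ones describe the
    past.\<close>
  define \<tau> where "\<tau> i = (if i < length l then l ! i else t)" for i
  have last: "l ! n = s"
  proof -
    from S l obtain j where j: "j < length l" "l ! j = s" by (metis in_set_conv_nth)
    then have "l ! j \<le> l ! n" using l(1) by (intro sorted_nth_mono) (auto simp: n_def)
    moreover have "l ! n \<le> s" using S(2) l(3) len by (auto simp: n_def)
    ultimately show ?thesis using j by auto
  qed
  have inc: "\<tau> i < \<tau> (Suc i)" if "i < Suc n" for i
  proof (cases "Suc i < length l")
    case True
    have "sorted_wrt (<) l" using l strict_sorted_iff by blast
    then show ?thesis using True by (auto simp: \<tau>_def sorted_wrt_iff_nth_less)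
  next
    case False
    then have "i = n" using that by (auto simp: n_def)
    then show ?thesis using last st len by (auto simp: \<tau>_def n_def)
  qed
  let ?D = "\<lambda>i \<omega>. W (\<tau> (Suc i)) \<omega> - W (\<tau> i) \<omega>"
  define X where "X \<omega> = restrict (\<lambda>i. ?D i \<omega>) {..<n}" for \<omega>
  have "indep_vars (\<lambda>_. borel) ?D {..<Suc n}"
    by (rule BM_increments_indep) (use inc in auto)
  then have "indep_var (PiM {..<n} (\<lambda>_. borel)) X
      (PiM {n} (\<lambda>_. borel)) (\<lambda>\<omega>. restrict (\<lambda>i. ?D i \<omega>) {n})"
    unfolding X_def by (rule indep_var_restrict) auto
  moreover have "W t \<omega> - W s \<omega> = restrict (\<lambda>i. ?D i \<omega>) {n} n" for \<omega>
    using last len by (auto simp: \<tau>_def n_def)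
  moreover have "\<exists>f \<in> borel_measurable (PiM {..<n} (\<lambda>_. borel)). \<forall>\<omega>. W u \<omega> - W v \<omega> = f (X \<omega>)"
    if "u \<in> S" "v \<in> S" for u v
  proof -
    from that l obtain i j where i: "i < length l" "l ! i = u" and j: "j < length l" "l ! j = v"
      by (metis in_set_conv_nth)
    \<comment> \<open>The increments telescope, so \<open>W u - W v\<close> is a difference of two
      partial sums of the components of \<open>X\<close>; the starting value
      \<open>W (\<tau> 0)\<close> cancels.\<close>
    have tel: "(\<Sum>k<i. X \<omega> k) = W (\<tau> i) \<omega> - W (\<tau> 0) \<omega>" if "i \<le> n" for i \<omega>
    proof -
      have "(\<Sum>k<i. X \<omega> k) = (\<Sum>k<i. W (\<tau> (Suc k)) \<omega> - W (\<tau> k) \<omega>)"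
        using that by (intro sum.cong) (auto simp: X_def)
      then show ?thesis using sum_lessThan_telescope[of "\<lambda>k. W (\<tau> k) \<omega>" i] by simp
    qed
    have "(\<lambda>g. (\<Sum>k<i. g k) - (\<Sum>k<j. g k)) \<in> borel_measurable (PiM {..<n} (\<lambda>_. borel :: real measure))"
      using i j by (intro borel_measurable_diff borel_measurable_sum measurable_component_singleton)
        (auto simp: n_def)
    moreover have "W u \<omega> - W v \<omega> = (\<Sum>k<i. X \<omega> k) - (\<Sum>k<j. X \<omega> k)" for \<omega>
      using i j tel[of i \<omega>] tel[of j \<omega>] by (auto simp: \<tau>_def n_def)
    ultimately show ?thesis by (intro bexI[where x="\<lambda>g. (\<Sum>k<i. g k) - (\<Sum>k<j. g k)"]) simp_all
  qed
  ultimately show ?thesis by blast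
qed

text \<open>The events that generate the past are not closed under intersection. Those determined by
  finitely many times, collected in \<open>\<X>\<close>, are, because two finite sets of times have
  a finite union. Independence from this Int-stable family extends to the sigma-algebra it
  generates, which contains the past. Each set of times is made to contain \<open>s\<close> so that
  \<open>BM_finite_past_indep\<close> applies.\<close>

lemma BM_increment_indep_past:
  assumes st: "s < t"
  shows "indep_set
    (sigma_sets (space P) {(\<lambda>\<omega>. W t \<omega> - W s \<omega>) -` B \<inter> space P | B. B \<in> sets borel})
    (sets (BM_filtration P W s))"
proof -
  note [measurable] = BM_measurable
  let ?Gen = "{(\<lambda>\<omega>. W u \<omega> - W v \<omega>) -` B \<inter> space P | u v B. u \<le> s \<and> v \<le> s \<and> B \<in> sets borel}"
  let ?H = "{(\<lambda>\<omega>. W t \<omega> - W s \<omega>) -` B \<inter> space P | B. B \<in> sets borel}"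
  define gen where "gen S = {(\<lambda>\<omega>. W u \<omega> - W v \<omega>) -` B \<inter> space P | u v B.
    u \<in> S \<and> v \<in> S \<and> B \<in> sets borel}" for S
  have gen_mono: "gen S \<subseteq> gen S'" if "S \<subseteq> S'" for S S'
    using that unfolding gen_def by blast
  have gen_events: "gen S \<subseteq> events" for S
    unfolding gen_def by auto
  define \<X> where "\<X> = {A. \<exists>S. finite S \<and> (\<forall>u\<in>S. u \<le> s) \<and> s \<in> S \<and> A \<in> sigma_sets (space P) (gen S)}"
  have stX: "Int_stable \<X>"
  proof (rule Int_stableI)
    fix A A' assume "A \<in> \<X>" "A' \<in> \<X>"
    then obtain S S' where S: "finite S" "\<forall>u\<in>S. u \<le> s" "s \<in> S" "A \<in> sigma_sets (space P) (gen S)"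
      and S': "finite S'" "\<forall>u\<in>S'. u \<le> s" "A' \<in> sigma_sets (space P) (gen S')"
      unfolding \<X>_def by blast
    have "gen (S \<union> S') \<subseteq> Pow (space P)" unfolding gen_def by blast
    then interpret U: sigma_algebra "space P" "sigma_sets (space P) (gen (S \<union> S'))"
      by (rule sigma_algebra_sigma_sets)
    have "A \<in> sigma_sets (space P) (gen (S \<union> S'))" "A' \<in> sigma_sets (space P) (gen (S \<union> S'))"
      using S(4) S'(3) sigma_sets_mono'[OF gen_mono[of S "S \<union> S'"]]
        sigma_sets_mono'[OF gen_mono[of S' "S \<union> S'"]] by blast+
    then have "A \<inter> A' \<in> sigma_sets (space P) (gen (S \<union> S'))" by (rule U.Int)
    moreover have "finite (S \<union> S')" "\<forall>u\<in>S \<union> S'. u \<le> s" "s \<in> S \<union> S'"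
      using S S' by auto
    ultimately show "A \<inter> A' \<in> \<X>" unfolding \<X>_def by blast
  qed
  have stH: "Int_stable ?H"
  proof (rule Int_stableI)
    fix A A' assume "A \<in> ?H" "A' \<in> ?H"
    then obtain B B' where "A = (\<lambda>\<omega>. W t \<omega> - W s \<omega>) -` B \<inter> space P" "B \<in> sets borel"
      "A' = (\<lambda>\<omega>. W t \<omega> - W s \<omega>) -` B' \<inter> space P" "B' \<in> sets borel" by auto
    then have "A \<inter> A' = (\<lambda>\<omega>. W t \<omega> - W s \<omega>) -` (B \<inter> B') \<inter> space P \<and> B \<inter> B' \<in> sets borel" by auto
    then show "A \<inter> A' \<in> ?H" by blast
  qed
  have ind: "indep_set ?H \<X>"
  proof (rule indep_setI)
    show "\<X> \<subseteq> events"
      using sets.sigma_sets_subset[OF gen_events] unfolding \<X>_def by blast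
    show "?H \<subseteq> events" by auto
    fix B A assume "B \<in> ?H" "A \<in> \<X>"
    then obtain S C where S: "finite S" "\<And>u. u\<in>S \<Longrightarrow> u \<le> s" "s \<in> S"
      and A: "A \<in> sigma_sets (space P) (gen S)"
      and C: "C \<in> sets borel" and B: "B = (\<lambda>\<omega>. W t \<omega> - W s \<omega>) -` C \<inter> space P"
      unfolding \<X>_def by blast
    have "\<exists>(n::nat) X Y. indep_var (PiM {..<n} (\<lambda>_. borel)) X (PiM {n} (\<lambda>_. borel)) Y \<and>
      (\<forall>\<omega>. W t \<omega> - W s \<omega> = Y \<omega> n) \<and>
      (\<forall>u\<in>S. \<forall>v\<in>S. \<exists>f \<in> borel_measurable (PiM {..<n} (\<lambda>_. borel)). \<forall>\<omega>. W u \<omega> - W v \<omega> = f (X \<omega>))"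
      by (rule BM_finite_past_indep[OF S(1) S(2) S(3) st])
    then obtain n :: nat and X Y where ind: "indep_var (PiM {..<n} (\<lambda>_. borel)) X (PiM {n} (\<lambda>_. borel)) Y"
      and Y: "\<And>\<omega>. W t \<omega> - W s \<omega> = Y \<omega> n"
      and X: "\<And>u v. u \<in> S \<Longrightarrow> v \<in> S \<Longrightarrow>
      \<exists>f \<in> borel_measurable (PiM {..<n} (\<lambda>_. borel)). \<forall>\<omega>. W u \<omega> - W v \<omega> = f (X \<omega>)"
      by blast
    let ?M = "PiM {..<n} (\<lambda>_. borel) :: (nat \<Rightarrow> real) measure"
    have Xm: "X \<in> measurable P ?M" using ind by (rule indep_var_rv1)
    \<comment> \<open>All increments with times in \<open>S\<close> are functions of the single
      vector \<open>X\<close>. Hence every event in the sigma-algebra of \<open>gen S\<close> is a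
      preimage under \<open>X\<close>, and the independence of \<open>X\<close> and \<open>Y\<close>
      can be used.\<close>
    define V where "V = vimage_algebra (space P) X ?M"
    have sub: "gen S \<subseteq> sets V"
      unfolding gen_def
    proof clarify
      fix u v and B :: "real set" assume uv: "u \<in> S" "v \<in> S" and B: "B \<in> sets borel"
      from X[OF uv] obtain f where f: "f \<in> borel_measurable ?M" "\<And>\<omega>. W u \<omega> - W v \<omega> = f (X \<omega>)" by blast
      have "(\<lambda>\<omega>. W u \<omega> - W v \<omega>) -` B \<inter> space P = X -` (f -` B \<inter> space ?M) \<inter> space P"
        unfolding f(2) using measurable_space[OF Xm] by blast
      then show "(\<lambda>\<omega>. W u \<omega> - W v \<omega>) -` B \<inter> space P \<in> sets V"
        unfolding V_def using in_vimage_algebra[OF measurable_sets[OF f(1) B]] by simp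
    qed
    have "space V = space P" by (simp add: V_def)
    with sets.sigma_sets_subset[OF sub] A have "A \<in> sets V" by auto
    moreover have "X \<in> space P \<rightarrow> space ?M" using measurable_space[OF Xm] by blast
    ultimately obtain E where E: "E \<in> sets ?M" "A = X -` E \<inter> space P"
      unfolding V_def by (subst (asm) sets_vimage_algebra2) blast+
    define C' where "C' = (\<lambda>f. f n) -` C \<inter> space (PiM {n} (\<lambda>_. borel :: real measure))"
    have C': "C' \<in> sets (PiM {n} (\<lambda>_. borel))"
      unfolding C'_def using C by (intro measurable_sets[OF measurable_component_singleton]) auto
    have "B = Y -` C' \<inter> space P"
      unfolding B C'_def Y using measurable_space[OF indep_var_rv2[OF ind]] by blast
    moreover have "A \<inter> (Y -` C' \<inter> space P) = (\<lambda>x. (X x, Y x)) -` (E \<times> C') \<inter> space P"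
      using E by auto
    ultimately show "prob (B \<inter> A) = prob B * prob A"
      using indep_varD[OF ind E(1) C'] E by (simp add: ac_simps)
  qed
  have ind: "indep_set (sigma_sets (space P) ?H) (sigma_sets (space P) \<X>)"
    by (rule indep_set_sigma_sets[OF ind stH stX])
  have "?Gen \<subseteq> \<X>"
  proof
    fix A assume "A \<in> ?Gen"
    then obtain u v B where "u \<le> s" "v \<le> s" "B \<in> sets borel" "A = (\<lambda>\<omega>. W u \<omega> - W v \<omega>) -` B \<inter> space P"
      by blast
    then have "A \<in> gen {u, v, s}" unfolding gen_def by blast
    then have "A \<in> sigma_sets (space P) (gen {u, v, s})" by (rule sigma_sets.Basic)
    moreover have "finite {u, v, s}" "\<forall>r\<in>{u, v, s}. r \<le> s" "s \<in> {u, v, s}"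
      using \<open>u \<le> s\<close> \<open>v \<le> s\<close> by auto
    ultimately show "A \<in> \<X>" unfolding \<X>_def by blast
  qed
  then have "sets (BM_filtration P W s) \<subseteq> sigma_sets (space P) \<X>"
    unfolding sets_BM_filtration by (rule sigma_sets_mono')
  then show ?thesis
    by (rule indep_set_mono[OF ind order_refl])
qed

text \<open>Real \<open>Z\<close> suffice: Hilbert space valued coefficients enter the isometry only
  through inner products and squared norms.\<close>

lemma BM_increment_indep_var:
  assumes st: "s < t" and Z: "Z \<in> borel_measurable (BM_filtration P W s)"
  shows "indep_var borel (\<lambda>\<omega>. W t \<omega> - W s \<omega>) borel (Z :: 'w \<Rightarrow> real)"
proof -
  have ZP: "Z \<in> borel_measurable P" by (rule measurable_from_subalg[OF subalgebra_BM_filtration Z])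
  have sub: "{Z -` A \<inter> space P | A. A \<in> sets borel} \<subseteq> sets (BM_filtration P W s)"
    using measurable_sets[OF Z] by auto
  have "sigma_sets (space P) {Z -` A \<inter> space P | A. A \<in> sets borel} \<subseteq> sets (BM_filtration P W s)"
    using sets.sigma_sets_subset[OF sub] by simp
  then have "indep_set (sigma_sets (space P) {(\<lambda>\<omega>. W t \<omega> - W s \<omega>) -` B \<inter> space P | B. B \<in> sets borel})
      (sigma_sets (space P) {Z -` A \<inter> space P | A. A \<in> sets borel})"
    by (rule indep_set_mono[OF BM_increment_indep_past[OF st] order_refl])
  then show ?thesis
    unfolding indep_var_eq using ZP by (auto intro!: borel_measurable_diff BM_measurable)
qed

end

subsection \<open>Elementary integrands and the Ito isometry\<close>

lemma monotone_steps:
  fixes \<tau> :: "nat \<Rightarrow> real"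
  assumes "\<And>i. i < n \<Longrightarrow> \<tau> i \<le> \<tau> (Suc i)" "i \<le> j" "j \<le> n"
  shows "\<tau> i \<le> \<tau> j"
  using assms(2,3)
proof (induction j rule: dec_induct)
  case (step k)
  then show ?case using assms(1)[of k] by auto
qed simp

lemma elementary_mono:
  assumes "elementary \<F> a b n \<tau> \<xi>"
  shows "i \<le> j \<Longrightarrow> j \<le> n \<Longrightarrow> \<tau> i \<le> \<tau> j" "i \<le> n \<Longrightarrow> a \<le> \<tau> i" "i \<le> n \<Longrightarrow> \<tau> i \<le> b"
proof -
  show *: "\<tau> i \<le> \<tau> j" if "i \<le> j" "j \<le> n" for i j
    by (rule monotone_steps[OF _ that]) (use assms in \<open>auto simp: elementary_def\<close>)
  show "i \<le> n \<Longrightarrow> a \<le> \<tau> i" "i \<le> n \<Longrightarrow> \<tau> i \<le> b"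
    using *[of 0 i] *[of i n] assms by (auto simp: elementary_def)
qed

lemma elementary_process_eq:
  assumes "\<And>i. i < n \<Longrightarrow> \<tau> i \<le> \<tau> (Suc i)" "j < n" "\<tau> j < s" "s \<le> \<tau> (Suc j)"
  shows "elementary_process n \<tau> \<xi> s \<omega> = \<xi> j \<omega>"
proof -
  have "indicat_real {\<tau> i<..\<tau> (Suc i)} s *\<^sub>R \<xi> i \<omega> = 0" if "i < n" "i \<noteq> j" for i
  proof (cases "i < j")
    case True
    then have "\<tau> (Suc i) \<le> \<tau> j" using assms by (intro monotone_steps[of n \<tau>, OF assms(1)]) auto
    then show ?thesis using assms by auto
  next
    case False
    then have "\<tau> (Suc j) \<le> \<tau> i" using assms that by (intro monotone_steps[of n \<tau>, OF assms(1)]) auto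
    then show ?thesis using assms by auto
  qed
  then have "elementary_process n \<tau> \<xi> s \<omega> = (\<Sum>i\<in>{j}. indicat_real {\<tau> i<..\<tau> (Suc i)} s *\<^sub>R \<xi> i \<omega>)"
    unfolding elementary_process_def using assms(2) by (intro sum.mono_neutral_right) auto
  then show ?thesis using assms by simp
qed

lemma elementary_process_outside:
  assumes "\<And>i. i < n \<Longrightarrow> \<not> (\<tau> i < s \<and> s \<le> \<tau> (Suc i))"
  shows "elementary_process n \<tau> \<xi> s \<omega> = 0"
  unfolding elementary_process_def using assms by (intro sum.neutral) auto

text \<open>The interval containing \<open>s\<close> is the same for all scalings \<open>c\<close>
  of the coefficients. Quantifying over \<open>c\<close> within each case allows a process and its
  switched off version to be compared at the same \<open>s\<close> and
  \<open>\<omega>\<close>.\<close>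

lemma elementary_process_scale:
  assumes "\<And>i. i < n \<Longrightarrow> \<tau> i \<le> \<tau> (Suc i)"
  obtains "\<And>c. elementary_process n \<tau> (\<lambda>i \<omega>. c i \<omega> *\<^sub>R \<xi> i \<omega>) s \<omega> = 0"
      "elementary_process n \<tau> \<xi> s \<omega> = 0"
  | i where "i < n" "\<tau> i < s" "s \<le> \<tau> (Suc i)" "elementary_process n \<tau> \<xi> s \<omega> = \<xi> i \<omega>"
      "\<And>c. elementary_process n \<tau> (\<lambda>i \<omega>. c i \<omega> *\<^sub>R \<xi> i \<omega>) s \<omega> = c i \<omega> *\<^sub>R \<xi> i \<omega>"
proof (cases "\<exists>i<n. \<tau> i < s \<and> s \<le> \<tau> (Suc i)")
  case True
  then obtain i where i: "i < n" "\<tau> i < s" "s \<le> \<tau> (Suc i)" by blast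
  show ?thesis
    by (rule that(2)[OF i elementary_process_eq[OF assms i] elementary_process_eq[OF assms i]])
next
  case False
  then have "\<not> (\<tau> i < s \<and> s \<le> \<tau> (Suc i))" if "i < n" for i using that by blast
  then show ?thesis by (intro that(1) elementary_process_outside)
qed

text \<open>At each time at most one interval is active, so there are no mixed terms. The right hand
  side is itself an elementary process with the real coefficients |\<xi> i|^2, so the same
  evaluation lemmas apply to both sides.\<close>

lemma elementary_process_sq:
  assumes "\<And>i. i < n \<Longrightarrow> \<tau> i \<le> \<tau> (Suc i)"
  shows "(norm (elementary_process n \<tau> \<xi> s \<omega>))\<^sup>2 =
    (\<Sum>i<n. indicat_real {\<tau> i<..\<tau> (Suc i)} s * (norm (\<xi> i \<omega>))\<^sup>2)"
proof (cases "\<exists>i<n. \<tau> i < s \<and> s \<le> \<tau> (Suc i)")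
  case True
  then obtain i where "i < n" "\<tau> i < s" "s \<le> \<tau> (Suc i)" by blast
  from elementary_process_eq[OF assms this, of \<xi> \<omega>]
    elementary_process_eq[OF assms this, of "\<lambda>i \<omega>. (norm (\<xi> i \<omega>))\<^sup>2" \<omega>]
  show ?thesis by (simp add: elementary_process_def)
next
  case False
  then show ?thesis using elementary_process_outside[of n \<tau> s \<xi> \<omega>]
     elementary_process_outside[of n \<tau> s "\<lambda>i \<omega>. (norm (\<xi> i \<omega>))\<^sup>2" \<omega>]
    by (auto simp: elementary_process_def)
qed

lemma nn_integral_elementary_process_sq:
  assumes el: "elementary \<F> a b n \<tau> \<xi>"
  shows "(\<integral>\<^sup>+s\<in>{a..b}. ennreal ((norm (elementary_process n \<tau> \<xi> s \<omega>))\<^sup>2) \<partial>lborel) =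
    ennreal (\<Sum>i<n. (\<tau> (Suc i) - \<tau> i) * (norm (\<xi> i \<omega>))\<^sup>2)"
proof -
  have le: "\<tau> i \<le> \<tau> (Suc i)" if "i < n" for i using el that by (auto simp: elementary_def)
  have eq: "ennreal ((norm (elementary_process n \<tau> \<xi> s \<omega>))\<^sup>2) * indicator {a..b} s =
      (\<Sum>i<n. ennreal ((norm (\<xi> i \<omega>))\<^sup>2) * indicator {\<tau> i<..\<tau> (Suc i)} s)" for s
  proof -
    have sq: "(norm (elementary_process n \<tau> \<xi> s \<omega>))\<^sup>2 =
      (\<Sum>i<n. indicat_real {\<tau> i<..\<tau> (Suc i)} s * (norm (\<xi> i \<omega>))\<^sup>2)"
      by (rule elementary_process_sq) (rule le)
    have "ennreal ((norm (elementary_process n \<tau> \<xi> s \<omega>))\<^sup>2) =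
      (\<Sum>i<n. ennreal (indicat_real {\<tau> i<..\<tau> (Suc i)} s * (norm (\<xi> i \<omega>))\<^sup>2))"
      unfolding sq
      by (rule sum_ennreal[symmetric]) simp
    then have "ennreal ((norm (elementary_process n \<tau> \<xi> s \<omega>))\<^sup>2) * indicator {a..b} s =
      (\<Sum>i<n. ennreal (indicat_real {\<tau> i<..\<tau> (Suc i)} s * (norm (\<xi> i \<omega>))\<^sup>2) * indicator {a..b} s)"
      by (simp only: sum_distrib_right)
    also have "\<dots> = (\<Sum>i<n. ennreal ((norm (\<xi> i \<omega>))\<^sup>2) * indicator {\<tau> i<..\<tau> (Suc i)} s)"
    proof (rule sum.cong)
      fix i assume "i \<in> {..<n}"
      then have "a \<le> \<tau> i" "\<tau> (Suc i) \<le> b" using elementary_mono[OF el] by auto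
      then show "ennreal (indicat_real {\<tau> i<..\<tau> (Suc i)} s * (norm (\<xi> i \<omega>))\<^sup>2) * indicator {a..b} s =
        ennreal ((norm (\<xi> i \<omega>))\<^sup>2) * indicator {\<tau> i<..\<tau> (Suc i)} s"
        by (auto simp: indicator_def)
    qed simp
    finally show ?thesis .
  qed
  have "(\<integral>\<^sup>+s\<in>{a..b}. ennreal ((norm (elementary_process n \<tau> \<xi> s \<omega>))\<^sup>2) \<partial>lborel) =
      (\<Sum>i<n. \<integral>\<^sup>+s. ennreal ((norm (\<xi> i \<omega>))\<^sup>2) * indicator {\<tau> i<..\<tau> (Suc i)} s \<partial>lborel)"
    unfolding eq by (rule nn_integral_sum) auto
  also have "\<dots> = (\<Sum>i<n. ennreal ((norm (\<xi> i \<omega>))\<^sup>2) * emeasure lborel {\<tau> i<..\<tau> (Suc i)})"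
    by (intro sum.cong refl nn_integral_cmult_indicator) auto
  also have "\<dots> = (\<Sum>i<n. ennreal ((\<tau> (Suc i) - \<tau> i) * (norm (\<xi> i \<omega>))\<^sup>2))"
    using le by (intro sum.cong) (auto simp: ennreal_mult' mult.commute)
  also have "\<dots> = ennreal (\<Sum>i<n. (\<tau> (Suc i) - \<tau> i) * (norm (\<xi> i \<omega>))\<^sup>2)"
    using le by (intro sum_ennreal) auto
  finally show ?thesis .
qed

text \<open>The index \<open>p = i m + j\<close> with \<open>j < m\<close> denotes the point at fraction \<open>j / m\<close> of the interval \<open>i\<close>.\<close>

definition refine_times :: "nat \<Rightarrow> (nat \<Rightarrow> real) \<Rightarrow> nat \<Rightarrow> real" where
  "refine_times m \<tau> p = \<tau> (p div m) + real (p mod m) / real m * (\<tau> (Suc (p div m)) - \<tau> (p div m))"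

lemma refine_times_Suc:
  assumes "0 < m"
  shows "refine_times m \<tau> (Suc p) =
    \<tau> (p div m) + (real (p mod m) + 1) / real m * (\<tau> (Suc (p div m)) - \<tau> (p div m))"
proof (cases "Suc (p mod m) = m")
  case True
  then have "Suc p mod m = 0" "Suc p div m = Suc (p div m)" "real (p mod m) + 1 = real m"
    by (auto simp: mod_Suc div_Suc)
  then show ?thesis using assms by (simp add: refine_times_def)
next
  case False
  then have "Suc p mod m = Suc (p mod m)" "Suc p div m = p div m"
    by (auto simp: mod_Suc div_Suc)
  then show ?thesis by (simp add: refine_times_def add.commute)
qed

lemma refine_times_step:
  assumes "0 < m"
  shows "refine_times m \<tau> (Suc p) - refine_times m \<tau> p = (\<tau> (Suc (p div m)) - \<tau> (p div m)) / m"
  unfolding refine_times_Suc[OF assms] by (simp add: refine_times_def add_divide_distrib diff_divide_distrib ring_distribs)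

text \<open>The function \<open>g\<close> is arbitrary to serve two purposes. With a path of
  \<open>W\<close> it shows that refinement preserves the integral. With the indicator of
  \<open>{s..}\<close>, whose increment from \<open>u\<close> to \<open>v\<close> is the indicator
  of \<open>{u<..v}\<close> at \<open>s\<close>, it shows that refinement preserves the
  process.\<close>

lemma sum_refine:
  fixes f :: "nat \<Rightarrow> 'b::real_vector"
  assumes "0 < m"
  shows "(\<Sum>p<n * m. (g (refine_times m \<tau> (Suc p)) - g (refine_times m \<tau> p)) *\<^sub>R f (p div m)) =
    (\<Sum>i<n. (g (\<tau> (Suc i)) - g (\<tau> i)) *\<^sub>R f i)"
proof -
  have "(\<Sum>p<n * m. (g (refine_times m \<tau> (Suc p)) - g (refine_times m \<tau> p)) *\<^sub>R f (p div m)) =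
    (\<Sum>i<n. \<Sum>p\<in>{i * m..<i * m + m}. (g (refine_times m \<tau> (Suc p)) - g (refine_times m \<tau> p)) *\<^sub>R f (p div m))"
    by (rule sum.nat_group[symmetric])
  also have "\<dots> = (\<Sum>i<n. (g (\<tau> (Suc i)) - g (\<tau> i)) *\<^sub>R f i)"
  proof (rule sum.cong)
    fix i
    have "(\<Sum>p\<in>{i * m..<i * m + m}. (g (refine_times m \<tau> (Suc p)) - g (refine_times m \<tau> p)) *\<^sub>R f (p div m)) =
      (\<Sum>p\<in>{i * m..<i * m + m}. (g (refine_times m \<tau> (Suc p)) - g (refine_times m \<tau> p)) *\<^sub>R f i)"
    proof (rule sum.cong)
      fix p assume p: "p \<in> {i * m..<i * m + m}"
      then have "p div m = i" by (intro div_nat_eqI) (auto simp: algebra_simps)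
      then show "(g (refine_times m \<tau> (Suc p)) - g (refine_times m \<tau> p)) *\<^sub>R f (p div m) =
        (g (refine_times m \<tau> (Suc p)) - g (refine_times m \<tau> p)) *\<^sub>R f i" by simp
    qed simp
    also have "\<dots> = (\<Sum>p\<in>{i * m..<i * m + m}. g (refine_times m \<tau> (Suc p)) - g (refine_times m \<tau> p)) *\<^sub>R f i"
      by (simp add: scaleR_sum_left)
    also have "(\<Sum>p\<in>{i * m..<i * m + m}. g (refine_times m \<tau> (Suc p)) - g (refine_times m \<tau> p)) =
      g (refine_times m \<tau> (i * m + m)) - g (refine_times m \<tau> (i * m))"
      using sum_Suc_diff'[of "i * m" "i * m + m" "\<lambda>p. g (refine_times m \<tau> p)"] by simp
    also have "refine_times m \<tau> (i * m) = \<tau> i" using assms by (simp add: refine_times_def)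
    also have "refine_times m \<tau> (i * m + m) = \<tau> (Suc i)" using assms by (simp add: refine_times_def)
    finally show "(\<Sum>p\<in>{i * m..<i * m + m}. (g (refine_times m \<tau> (Suc p)) - g (refine_times m \<tau> p)) *\<^sub>R f (p div m)) =
      (g (\<tau> (Suc i)) - g (\<tau> i)) *\<^sub>R f i" .
  qed simp
  finally show ?thesis .
qed

lemma elementary_integral_refine:
  "0 < m \<Longrightarrow> elementary_integral W (n * m) (refine_times m \<tau>) (\<lambda>p. \<xi> (p div m)) \<omega> =
    elementary_integral W n \<tau> \<xi> \<omega>"
  unfolding elementary_integral_def by (rule sum_refine[where g="\<lambda>r. W r \<omega>"])

lemma elementary_process_refine:
  assumes m: "0 < m" and \<tau>: "\<And>i. i < n \<Longrightarrow> \<tau> i \<le> \<tau> (Suc i)"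
  shows "elementary_process (n * m) (refine_times m \<tau>) (\<lambda>p. \<xi> (p div m)) s \<omega> =
    elementary_process n \<tau> \<xi> s \<omega>"
proof -
  have ind: "indicat_real {u<..v} s = indicator {s..} v - indicator {s..} u" if "u \<le> v" for u v
    using that by (auto simp: indicator_def)
  have "refine_times m \<tau> p \<le> refine_times m \<tau> (Suc p)" if "p < n * m" for p
  proof -
    have "p div m < n" using that m by (simp add: less_mult_imp_div_less)
    then have "0 \<le> (\<tau> (Suc (p div m)) - \<tau> (p div m)) / m" using \<tau> by simp
    then show ?thesis using refine_times_step[OF m, of \<tau> p] by linarith
  qed
  then show ?thesis unfolding elementary_process_def
    using sum_refine[OF m, where g="indicator {s..}" and n=n and \<tau>=\<tau> and f="\<lambda>i. \<xi> i \<omega>"] \<tau>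
    by (simp add: ind)
qed

lemma elementary_refine:
  assumes el: "elementary \<F> a b n \<tau> \<xi>" and m: "0 < m"
    and F: "\<And>s t. a \<le> s \<Longrightarrow> s \<le> t \<Longrightarrow> subalgebra (\<F> t) (\<F> s)"
  shows "elementary \<F> a b (n * m) (refine_times m \<tau>) (\<lambda>p. \<xi> (p div m))"
  unfolding elementary_def
proof (intro conjI allI impI)
  \<comment> \<open>At the last index \<open>n * m\<close> the definition refers to
    \<open>\<tau> (Suc n)\<close>, which lies beyond the partition; its weight is 0 because the
    index is a multiple of \<open>m\<close>.\<close>
  show "a \<le> refine_times m \<tau> 0" "refine_times m \<tau> (n * m) \<le> b"
    using el m by (auto simp: elementary_def refine_times_def)
next
  fix p assume "p < n * m"
  then have i: "p div m < n" using m by (simp add: less_mult_imp_div_less)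
  then have le: "0 \<le> (\<tau> (Suc (p div m)) - \<tau> (p div m)) / m" using el by (simp add: elementary_def)
  then show "refine_times m \<tau> p \<le> refine_times m \<tau> (Suc p)"
    using refine_times_step[OF m, of \<tau> p] by linarith
  have "0 \<le> real (p mod m) / real m * (\<tau> (Suc (p div m)) - \<tau> (p div m))"
    using i el by (auto simp: elementary_def)
  then have le: "\<tau> (p div m) \<le> refine_times m \<tau> p" by (simp add: refine_times_def)
  have sub: "subalgebra (\<F> (refine_times m \<tau> p)) (\<F> (\<tau> (p div m)))"
    using le elementary_mono(2)[OF el] i by (intro F) auto
  show "\<xi> (p div m) \<in> borel_measurable (\<F> (refine_times m \<tau> p))"
    using el i by (intro measurable_from_subalg[OF sub]) (auto simp: elementary_def)
  show "\<exists>C. \<forall>\<omega>\<in>space (\<F> (refine_times m \<tau> p)). norm (\<xi> (p div m) \<omega>) \<le> C"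
    using el i sub unfolding elementary_def subalgebra_def by metis
qed

text \<open>The definition of the integral lets the approximating partitions stay coarse. The
  stopping argument needs a mesh tending to 0, so that a switch at the left end points reacts to the
  clock in time.\<close>

lemma refine_times_mesh:
  assumes el: "elementary \<F> a b n \<tau> \<xi>" and m: "0 < m" and p: "p < n * m"
  shows "refine_times m \<tau> (Suc p) - refine_times m \<tau> p \<le> (b - a) / m"
proof -
  have i: "p div m < n" using m p by (simp add: less_mult_imp_div_less)
  have "\<tau> (Suc (p div m)) - \<tau> (p div m) \<le> b - a"
    using elementary_mono(2,3)[OF el, of "p div m"] elementary_mono(2,3)[OF el, of "Suc (p div m)"] i
    by linarith
  then show ?thesis unfolding refine_times_step[OF m] using m by (simp add: divide_right_mono)
qed

text \<open>Discrete stopping without overshoot: the test for keeping \<open>v i\<close> already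
  includes \<open>v i\<close>. If the last term is kept, the whole sum is at most \<open>L\<close>;
  otherwise nothing is added.\<close>

lemma sum_stopped_le:
  fixes v :: "nat \<Rightarrow> real"
  assumes "\<And>i. 0 \<le> v i" "0 \<le> L"
  shows "(\<Sum>i<n. if (\<Sum>j\<le>i. v j) \<le> L then v i else 0) \<le> L"
proof (induction n)
  case (Suc n)
  show ?case
  proof (cases "(\<Sum>j\<le>n. v j) \<le> L")
    case True
    have "(\<Sum>i<Suc n. if (\<Sum>j\<le>i. v j) \<le> L then v i else 0) \<le> (\<Sum>i<Suc n. v i)"
      using assms by (intro sum_mono) auto
    then show ?thesis using True by (simp add: lessThan_Suc_atMost)
  qed (use Suc in simp)
qed (use assms in simp)

section \<open>The Ito isometry for elementary integrands\<close>

context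
  fixes P :: "'w measure" and W :: "real \<Rightarrow> 'w \<Rightarrow> real"
  assumes BM: "two_sided_BM P W"
begin

interpretation prob_space P
  by (rule BM[unfolded two_sided_BM_def, THEN conjunct1])

text \<open>Induction on the number of intervals. The new increment is independent of all that is
  known at \<open>\<tau> n\<close>, so the mixed term has mean 0 and the mean of the square term
  factors.\<close>

lemma elementary_integral_isometry:
  fixes \<xi> :: "nat \<Rightarrow> 'w \<Rightarrow> 'h::{real_inner, second_countable_topology}"
  assumes "\<And>i. i < n \<Longrightarrow> \<tau> i \<le> \<tau> (Suc i)"
    and "\<And>i. i < n \<Longrightarrow> \<xi> i \<in> borel_measurable (BM_filtration P W (\<tau> i))"
    and "\<And>i. i < n \<Longrightarrow> \<exists>C. \<forall>\<omega>\<in>space P. norm (\<xi> i \<omega>) \<le> C"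
  shows "integrable P (\<lambda>\<omega>. (norm (elementary_integral W n \<tau> \<xi> \<omega>))\<^sup>2) \<and>
    expectation (\<lambda>\<omega>. (norm (elementary_integral W n \<tau> \<xi> \<omega>))\<^sup>2) =
    (\<Sum>i<n. (\<tau> (Suc i) - \<tau> i) * expectation (\<lambda>\<omega>. (norm (\<xi> i \<omega>))\<^sup>2))"
  using assms
proof (induction n)
  case 0
  show ?case by (simp add: elementary_integral_def)
next
  case (Suc n)
  let ?F = "BM_filtration P W"
  let ?S = "elementary_integral W n \<tau> \<xi>" and ?D = "\<lambda>\<omega>. W (\<tau> (Suc n)) \<omega> - W (\<tau> n) \<omega>"
  have "integrable P (\<lambda>\<omega>. (norm (?S \<omega>))\<^sup>2) \<and>
    expectation (\<lambda>\<omega>. (norm (?S \<omega>))\<^sup>2) = (\<Sum>i<n. (\<tau> (Suc i) - \<tau> i) * expectation (\<lambda>\<omega>. (norm (\<xi> i \<omega>))\<^sup>2))"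
    by (rule Suc.IH; rule Suc.prems; simp)
  then have IH: "integrable P (\<lambda>\<omega>. (norm (?S \<omega>))\<^sup>2)"
    "expectation (\<lambda>\<omega>. (norm (?S \<omega>))\<^sup>2) = (\<Sum>i<n. (\<tau> (Suc i) - \<tau> i) * expectation (\<lambda>\<omega>. (norm (\<xi> i \<omega>))\<^sup>2))"
    by blast+
  have mono: "\<tau> i \<le> \<tau> j" if "i \<le> j" "j \<le> n" for i j
    by (rule monotone_steps[OF _ that]; rule Suc.prems(1); simp)
  have S_meas: "?S \<in> borel_measurable (?F (\<tau> n))"
    unfolding elementary_integral_def[abs_def]
  proof (intro borel_measurable_sum borel_measurable_scaleR)
    fix i assume i: "i \<in> {..<n}"
    have le: "\<tau> i \<le> \<tau> n" "\<tau> (Suc i) \<le> \<tau> n"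
      using i by (auto intro: mono)
    then show "(\<lambda>\<omega>. W (\<tau> (Suc i)) \<omega> - W (\<tau> i) \<omega>) \<in> borel_measurable (?F (\<tau> n))"
      by (intro BM_filtration_increment_measurable[OF BM])
    show "\<xi> i \<in> borel_measurable (?F (\<tau> n))"
      by (rule measurable_from_subalg[OF BM_filtration_mono[OF BM le(1)] Suc.prems(2)]) (use i in simp)
  qed
  have \<xi>_meas: "\<xi> n \<in> borel_measurable (?F (\<tau> n))" by (rule Suc.prems(2)) simp
  note toP = measurable_from_subalg[OF subalgebra_BM_filtration[OF BM, of "\<tau> n"]]
  have S_P [measurable]: "?S \<in> borel_measurable P" and \<xi>_P [measurable]: "\<xi> n \<in> borel_measurable P"
    using toP[OF S_meas] toP[OF \<xi>_meas] .
  obtain C where C: "\<And>\<omega>. \<omega> \<in> space P \<Longrightarrow> norm (\<xi> n \<omega>) \<le> C" using Suc.prems(3)[OF lessI] by blast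
  obtain \<omega>0 where "\<omega>0 \<in> space P" using not_empty by blast
  from order_trans[OF norm_ge_zero C[OF this]] have C0: "0 \<le> C" .
  have int1: "integrable P (\<lambda>\<omega>. ?S \<omega> \<bullet> \<xi> n \<omega>)"
  proof (rule Bochner_Integration.integrable_bound[where f="\<lambda>\<omega>. C * (1 + (norm (?S \<omega>))\<^sup>2)"])
    show "AE \<omega> in P. norm (?S \<omega> \<bullet> \<xi> n \<omega>) \<le> norm (C * (1 + (norm (?S \<omega>))\<^sup>2))"
    proof (rule AE_I2)
      fix \<omega> assume \<omega>: "\<omega> \<in> space P"
      have "norm (?S \<omega>) \<le> 1 + (norm (?S \<omega>))\<^sup>2"
        using sum_squares_bound[of "norm (?S \<omega>)" 1, simplified] norm_ge_zero[of "?S \<omega>"] by linarith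
      then have "norm (?S \<omega>) * norm (\<xi> n \<omega>) \<le> (1 + (norm (?S \<omega>))\<^sup>2) * C"
        using C[OF \<omega>] by (intro mult_mono) auto
      moreover have "\<bar>?S \<omega> \<bullet> \<xi> n \<omega>\<bar> \<le> norm (?S \<omega>) * norm (\<xi> n \<omega>)"
        by (rule Cauchy_Schwarz_ineq2)
      moreover have "0 \<le> C * (1 + (norm (?S \<omega>))\<^sup>2)" using C0 by simp
      ultimately show "norm (?S \<omega> \<bullet> \<xi> n \<omega>) \<le> norm (C * (1 + (norm (?S \<omega>))\<^sup>2))"
        unfolding real_norm_def by (simp only: abs_of_nonneg mult.commute[of C])
    qed
  next
    show "integrable P (\<lambda>\<omega>. C * (1 + (norm (?S \<omega>))\<^sup>2))"
      using IH(1) by (intro integrable_mult_right Bochner_Integration.integrable_add) auto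
  qed measurable
  have int2: "integrable P (\<lambda>\<omega>. (norm (\<xi> n \<omega>))\<^sup>2)"
    by (rule integrable_const_bound[where B="C\<^sup>2"]) (use C in \<open>auto simp: power_mono\<close>)
  have le: "\<tau> n \<le> \<tau> (Suc n)" by (rule Suc.prems(1)) simp
  have cross: "integrable P (\<lambda>\<omega>. ?D \<omega> * (?S \<omega> \<bullet> \<xi> n \<omega>)) \<and> expectation (\<lambda>\<omega>. ?D \<omega> * (?S \<omega> \<bullet> \<xi> n \<omega>)) = 0"
  and diag: "integrable P (\<lambda>\<omega>. (?D \<omega>)\<^sup>2 * (norm (\<xi> n \<omega>))\<^sup>2) \<and>
    expectation (\<lambda>\<omega>. (?D \<omega>)\<^sup>2 * (norm (\<xi> n \<omega>))\<^sup>2) = (\<tau> (Suc n) - \<tau> n) * expectation (\<lambda>\<omega>. (norm (\<xi> n \<omega>))\<^sup>2)"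
  proof -
    have "(integrable P (\<lambda>\<omega>. ?D \<omega> * (?S \<omega> \<bullet> \<xi> n \<omega>)) \<and> expectation (\<lambda>\<omega>. ?D \<omega> * (?S \<omega> \<bullet> \<xi> n \<omega>)) = 0) \<and>
     (integrable P (\<lambda>\<omega>. (?D \<omega>)\<^sup>2 * (norm (\<xi> n \<omega>))\<^sup>2) \<and>
    expectation (\<lambda>\<omega>. (?D \<omega>)\<^sup>2 * (norm (\<xi> n \<omega>))\<^sup>2) = (\<tau> (Suc n) - \<tau> n) * expectation (\<lambda>\<omega>. (norm (\<xi> n \<omega>))\<^sup>2))"
    \<comment> \<open>Elementary processes may have intervals of length 0, whose increment vanishes.
      Independence from the past is available for \<open>\<tau> n < \<tau> (Suc n)\<close>.\<close>
    proof (cases "\<tau> n = \<tau> (Suc n)")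
      case False
      then have lt: "\<tau> n < \<tau> (Suc n)" using le by simp
      note mom = BM_increment_moments[OF BM le]
      have m1: "(\<lambda>\<omega>. ?S \<omega> \<bullet> \<xi> n \<omega>) \<in> borel_measurable (?F (\<tau> n))"
        and m2: "(\<lambda>\<omega>. (norm (\<xi> n \<omega>))\<^sup>2) \<in> borel_measurable (?F (\<tau> n))"
        using S_meas \<xi>_meas by measurable
      have ind1: "indep_var borel ?D borel (\<lambda>\<omega>. ?S \<omega> \<bullet> \<xi> n \<omega>)"
        by (rule BM_increment_indep_var[OF BM lt m1])
      have "indep_var borel ((\<lambda>x. x\<^sup>2) \<circ> ?D) borel (id \<circ> (\<lambda>\<omega>. (norm (\<xi> n \<omega>))\<^sup>2))"
        by (rule indep_var_compose[OF BM_increment_indep_var[OF BM lt m2]]) auto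
      then have ind2: "indep_var borel (\<lambda>\<omega>. (?D \<omega>)\<^sup>2) borel (\<lambda>\<omega>. (norm (\<xi> n \<omega>))\<^sup>2)"
        by (simp add: o_def)
      show ?thesis
        using indep_var_integrable[OF ind1 mom(1) int1] indep_var_lebesgue_integral[OF ind1 mom(1) int1]
          indep_var_integrable[OF ind2 mom(3) int2] indep_var_lebesgue_integral[OF ind2 mom(3) int2] mom
        by simp
    qed simp
    then show "integrable P (\<lambda>\<omega>. ?D \<omega> * (?S \<omega> \<bullet> \<xi> n \<omega>)) \<and> expectation (\<lambda>\<omega>. ?D \<omega> * (?S \<omega> \<bullet> \<xi> n \<omega>)) = 0"
     "integrable P (\<lambda>\<omega>. (?D \<omega>)\<^sup>2 * (norm (\<xi> n \<omega>))\<^sup>2) \<and>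
    expectation (\<lambda>\<omega>. (?D \<omega>)\<^sup>2 * (norm (\<xi> n \<omega>))\<^sup>2) = (\<tau> (Suc n) - \<tau> n) * expectation (\<lambda>\<omega>. (norm (\<xi> n \<omega>))\<^sup>2)"
      by blast+
  qed
  have eq: "(norm (elementary_integral W (Suc n) \<tau> \<xi> \<omega>))\<^sup>2 =
    (norm (?S \<omega>))\<^sup>2 + 2 * (?D \<omega> * (?S \<omega> \<bullet> \<xi> n \<omega>)) + (?D \<omega>)\<^sup>2 * (norm (\<xi> n \<omega>))\<^sup>2" for \<omega>
  proof -
    have eq: "elementary_integral W (Suc n) \<tau> \<xi> \<omega> = ?S \<omega> + ?D \<omega> *\<^sub>R \<xi> n \<omega>"
      by (simp add: elementary_integral_def)
    have "(norm (u + c *\<^sub>R v))\<^sup>2 = (norm u)\<^sup>2 + 2 * (c * (u \<bullet> v)) + c\<^sup>2 * (norm v)\<^sup>2" for u v :: 'h and c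
      unfolding power2_norm_eq_inner
      by (simp add: inner_add_left inner_add_right inner_commute[of v u] power2_eq_square ring_distribs)
    then show ?thesis unfolding eq .
  qed
  show ?case unfolding eq using IH cross diag by simp
qed

lemma elementary_integral_isometry_nn:
  fixes \<xi> :: "nat \<Rightarrow> 'w \<Rightarrow> 'h::{real_inner, second_countable_topology}"
  assumes el: "elementary (BM_filtration P W) a b n \<tau> \<xi>"
  shows "(\<integral>\<^sup>+\<omega>. ennreal ((norm (elementary_integral W n \<tau> \<xi> \<omega>))\<^sup>2) \<partial>P) =
    (\<integral>\<^sup>+\<omega>. (\<integral>\<^sup>+s\<in>{a..b}. ennreal ((norm (elementary_process n \<tau> \<xi> s \<omega>))\<^sup>2) \<partial>lborel) \<partial>P)"
proof -
  have le: "\<tau> i \<le> \<tau> (Suc i)" and meas: "\<xi> i \<in> borel_measurable (BM_filtration P W (\<tau> i))"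
    and bd: "\<exists>C. \<forall>\<omega>\<in>space P. norm (\<xi> i \<omega>) \<le> C" if "i < n" for i
    using el that space_BM_filtration[OF BM] by (auto simp: elementary_def)
  have iso: "integrable P (\<lambda>\<omega>. (norm (elementary_integral W n \<tau> \<xi> \<omega>))\<^sup>2)"
    "expectation (\<lambda>\<omega>. (norm (elementary_integral W n \<tau> \<xi> \<omega>))\<^sup>2) =
      (\<Sum>i<n. (\<tau> (Suc i) - \<tau> i) * expectation (\<lambda>\<omega>. (norm (\<xi> i \<omega>))\<^sup>2))"
    using elementary_integral_isometry[of n \<tau> \<xi>] le meas bd by blast+
  have int: "integrable P (\<lambda>\<omega>. (norm (\<xi> i \<omega>))\<^sup>2)" if i: "i < n" for i
  proof -
    have [measurable]: "\<xi> i \<in> borel_measurable P"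
      by (rule measurable_from_subalg[OF subalgebra_BM_filtration[OF BM] meas[OF i]])
    from bd[OF i] obtain C where "\<And>\<omega>. \<omega> \<in> space P \<Longrightarrow> norm (\<xi> i \<omega>) \<le> C" by blast
    then show ?thesis
      by (intro integrable_const_bound[where B="C\<^sup>2"]) (auto simp: power_mono)
  qed
  have "(\<integral>\<^sup>+\<omega>. ennreal ((norm (elementary_integral W n \<tau> \<xi> \<omega>))\<^sup>2) \<partial>P) =
    ennreal (expectation (\<lambda>\<omega>. (norm (elementary_integral W n \<tau> \<xi> \<omega>))\<^sup>2))"
    using iso by (intro nn_integral_eq_integral) auto
  also have "expectation (\<lambda>\<omega>. (norm (elementary_integral W n \<tau> \<xi> \<omega>))\<^sup>2) =
    expectation (\<lambda>\<omega>. \<Sum>i<n. (\<tau> (Suc i) - \<tau> i) * (norm (\<xi> i \<omega>))\<^sup>2)"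
    using iso int by (simp add: Bochner_Integration.integral_sum)
  also have "ennreal \<dots> = (\<integral>\<^sup>+\<omega>. ennreal (\<Sum>i<n. (\<tau> (Suc i) - \<tau> i) * (norm (\<xi> i \<omega>))\<^sup>2) \<partial>P)"
    using int le by (intro nn_integral_eq_integral[symmetric] AE_I2 sum_nonneg
        Bochner_Integration.integrable_sum integrable_mult_right mult_nonneg_nonneg) auto
  also have "\<dots> = (\<integral>\<^sup>+\<omega>. (\<integral>\<^sup>+s\<in>{a..b}. ennreal ((norm (elementary_process n \<tau> \<xi> s \<omega>))\<^sup>2) \<partial>lborel) \<partial>P)"
    unfolding nn_integral_elementary_process_sq[OF el] ..
  finally show ?thesis .
qed

end

subsection \<open>Time integrals of adapted processes and almost sure subsequences\<close>

text \<open>For \<open>Z = X - \<E>(X | F)\<close> with \<open>X = \<integral> f s\<close> one has \<open>\<E> (Z f s) = 0\<close> for every \<open>s\<close>, hence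
  \<open>\<E> Z\<^sup>2 = \<E> (Z X) = 0\<close>. Joint measurability and adaptedness do not make \<open>f\<close> progressively measurable,
  so that in general \<open>X\<close> itself is not \<open>F\<close>-measurable.\<close>

lemma (in prob_space) AE_integral_adapted:
  fixes f :: "'s \<Rightarrow> 'a \<Rightarrow> real"
  assumes N: "finite_measure N" and sub: "subalgebra M F"
    and meas: "case_prod f \<in> borel_measurable (N \<Otimes>\<^sub>M M)"
    and ad: "\<And>s. s \<in> space N \<Longrightarrow> f s \<in> borel_measurable F"
    and bd: "\<And>s \<omega>. s \<in> space N \<Longrightarrow> \<omega> \<in> space M \<Longrightarrow> \<bar>f s \<omega>\<bar> \<le> K"
  shows "\<exists>X \<in> borel_measurable F. AE \<omega> in M. X \<omega> = (\<integral>s. f s \<omega> \<partial>N)"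
proof -
  interpret N: finite_measure N by (rule N)
  interpret MN: pair_sigma_finite M N ..
  interpret sf: sigma_finite_subalgebra M F
    by (rule finite_measure_subalgebra_is_sigma_finite) (unfold_locales, rule sub)
  have swap [measurable]: "(\<lambda>(\<omega>, s). f s \<omega>) \<in> borel_measurable (M \<Otimes>\<^sub>M N)"
    using measurable_pair_swap[OF meas] by simp
  define X where "X \<omega> = (\<integral>s. f s \<omega> \<partial>N)" for \<omega>
  have X_meas [measurable]: "X \<in> borel_measurable M"
    unfolding X_def by measurable
  have fs_meas [measurable]: "f s \<in> borel_measurable M" if "s \<in> space N" for s
    by (rule measurable_from_subalg[OF sub ad[OF that]])
  have f_meas2 [measurable]: "(\<lambda>s. f s \<omega>) \<in> borel_measurable N" if "\<omega> \<in> space M" for \<omega>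
    using measurable_compose[OF measurable_Pair1'[OF that] swap] by simp
  have f_int: "integrable N (\<lambda>s. f s \<omega>)" if "\<omega> \<in> space M" for \<omega>
    by (rule N.integrable_const_bound[where B=K]) (use bd that f_meas2 in auto)
  define K' where "K' = K * measure N (space N)"
  have X_bd: "\<bar>X \<omega>\<bar> \<le> K'" if \<omega>: "\<omega> \<in> space M" for \<omega>
  proof -
    have "\<bar>X \<omega>\<bar> \<le> (\<integral>s. \<bar>f s \<omega>\<bar> \<partial>N)" unfolding X_def by (rule integral_abs_bound)
    also have "\<dots> \<le> (\<integral>s. K \<partial>N)"
      using f_int[OF \<omega>] bd \<omega> by (intro integral_mono) auto
    finally show ?thesis by (simp add: K'_def mult.commute)
  qed
  have X_int: "integrable M X"
    by (rule integrable_const_bound[where B=K']) (use X_bd in auto)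
  define X' where "X' = real_cond_exp M F X"
  have X'_F: "X' \<in> borel_measurable F" unfolding X'_def by simp
  have [measurable]: "X' \<in> borel_measurable M" by (rule measurable_from_subalg[OF sub X'_F])
  have X'_int: "integrable M X'" unfolding X'_def by (rule sf.real_cond_exp_int(1)[OF X_int])
  have mult_int: "integrable M (\<lambda>\<omega>. Y \<omega> * X \<omega>)" if "integrable M Y" for Y
  proof (rule Bochner_Integration.integrable_bound[where f="\<lambda>\<omega>. K' * Y \<omega>"])
    have [measurable]: "Y \<in> borel_measurable M" using that by auto
    show "(\<lambda>\<omega>. Y \<omega> * X \<omega>) \<in> borel_measurable M" by measurable
    show "AE \<omega> in M. norm (Y \<omega> * X \<omega>) \<le> norm (K' * Y \<omega>)"
    proof (rule AE_I2)
      fix \<omega> assume "\<omega> \<in> space M"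
      then have "\<bar>X \<omega>\<bar> \<le> \<bar>K'\<bar>" using X_bd by fastforce
      then show "norm (Y \<omega> * X \<omega>) \<le> norm (K' * Y \<omega>)"
        by (simp add: abs_mult mult.commute mult_right_mono)
    qed
  qed (use that in simp)
  define Z where "Z \<omega> = X \<omega> - X' \<omega>" for \<omega>
  have Z_meas [measurable]: "Z \<in> borel_measurable M" unfolding Z_def by measurable
  have Z_int: "integrable M Z" unfolding Z_def using X_int X'_int by simp
  have Zf: "(\<integral>\<omega>. Z \<omega> * f s \<omega> \<partial>M) = 0" if s: "s \<in> space N" for s
  proof -
    have fsi: "integrable M (f s)"
      by (rule integrable_const_bound[where B=K]) (use bd s fs_meas in auto)
    note i1 = mult_int[OF fsi]
    note i2 = sf.real_cond_exp_intg[OF i1 ad[OF s] X_meas, folded X'_def]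
    have "(\<integral>\<omega>. Z \<omega> * f s \<omega> \<partial>M) = (\<integral>\<omega>. f s \<omega> * X \<omega> - f s \<omega> * X' \<omega> \<partial>M)"
      by (intro Bochner_Integration.integral_cong refl) (simp add: Z_def algebra_simps)
    also have "\<dots> = 0" using i1 i2 by simp
    finally show ?thesis .
  qed
  have Zf_int: "integrable (M \<Otimes>\<^sub>M N) (\<lambda>(\<omega>, s). Z \<omega> * f s \<omega>)"
  proof (rule Bochner_Integration.integrable_bound)
    show "integrable (M \<Otimes>\<^sub>M N) (\<lambda>(\<omega>, s). K * Z \<omega>)"
      using Z_int by (intro MN.Fubini_integrable) (auto simp: split_beta' abs_mult intro!: N.integrable_const integrable_mult_right)
    show "AE p in M \<Otimes>\<^sub>M N. norm (case p of (\<omega>, s) \<Rightarrow> Z \<omega> * f s \<omega>) \<le> norm (case p of (\<omega>, s) \<Rightarrow> K * Z \<omega>)"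
    proof (rule AE_I2)
      fix p assume "p \<in> space (M \<Otimes>\<^sub>M N)"
      then have "\<bar>f (snd p) (fst p)\<bar> \<le> \<bar>K\<bar>" using bd[of "snd p" "fst p"] by (auto simp: space_pair_measure)
      then show "norm (case p of (\<omega>, s) \<Rightarrow> Z \<omega> * f s \<omega>) \<le> norm (case p of (\<omega>, s) \<Rightarrow> K * Z \<omega>)"
        by (simp add: split_beta abs_mult mult.commute[of "\<bar>K\<bar>"] mult_left_mono)
    qed
  qed measurable
  have "(\<integral>\<omega>. Z \<omega> * X \<omega> \<partial>M) = (\<integral>\<omega>. (\<integral>s. Z \<omega> * f s \<omega> \<partial>N) \<partial>M)"
    unfolding X_def by simp
  also have "\<dots> = (\<integral>s. (\<integral>\<omega>. Z \<omega> * f s \<omega> \<partial>M) \<partial>N)"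
    using MN.Fubini_integral[OF Zf_int] by simp
  also have "\<dots> = (\<integral>s. 0 \<partial>N)"
    by (intro Bochner_Integration.integral_cong refl) (simp add: Zf)
  finally have ZX: "(\<integral>\<omega>. Z \<omega> * X \<omega> \<partial>M) = 0" by simp
  note i1 = mult_int[OF X'_int]
  note i2 = sf.real_cond_exp_intg[OF i1 X'_F X_meas, folded X'_def]
  \<comment> \<open>Both parts have mean 0: \<open>Z \<omega> * X \<omega>\<close> by the Fubini
    argument above, and the bracket because \<open>X'\<close> is the conditional expectation of
    \<open>X\<close> and is itself \<open>F\<close>-measurable.\<close>
  have eq: "(Z \<omega>)\<^sup>2 = Z \<omega> * X \<omega> - (X' \<omega> * X \<omega> - X' \<omega> * X' \<omega>)" for \<omega>
    by (simp add: Z_def power2_eq_square algebra_simps)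
  have "integrable M (\<lambda>\<omega>. (Z \<omega>)\<^sup>2)" and "(\<integral>\<omega>. (Z \<omega>)\<^sup>2 \<partial>M) = 0"
    unfolding eq using i1 i2 mult_int[OF Z_int] ZX by simp_all
  then have "AE \<omega> in M. (Z \<omega>)\<^sup>2 = 0"
    by (subst (asm) integral_nonneg_eq_0_iff_AE) auto
  then have "AE \<omega> in M. X' \<omega> = X \<omega>" by eventually_elim (simp add: Z_def)
  then show ?thesis using X'_F unfolding X_def by blast
qed

text \<open>Truncation at level \<open>k\<close> reduces to the bounded real case, and a supremum of
  countably many measurable versions is again a measurable version by monotone convergence.
  Truncating before \<open>enn2real\<close> matters, since \<open>enn2real\<close> sends the value
  top to 0.\<close>

lemma (in prob_space) AE_nn_integral_adapted:
  fixes g :: "'s \<Rightarrow> 'a \<Rightarrow> ennreal"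
  assumes N: "finite_measure N" and sub: "subalgebra M F"
    and meas: "case_prod g \<in> borel_measurable (N \<Otimes>\<^sub>M M)"
    and ad: "\<And>s. s \<in> space N \<Longrightarrow> g s \<in> borel_measurable F"
  shows "\<exists>X \<in> borel_measurable F. AE \<omega> in M. X \<omega> = (\<integral>\<^sup>+s. g s \<omega> \<partial>N)"
proof -
  interpret N: finite_measure N by (rule N)
  define f where "f k s \<omega> = enn2real (min (g s \<omega>) (ennreal (real k)))" for k :: nat and s \<omega>
  have f_ennreal: "ennreal (f k s \<omega>) = min (g s \<omega>) (ennreal (real k))" for k s \<omega>
    unfolding f_def by (intro ennreal_enn2real) (auto simp: min_def less_top[symmetric] top_unique)
  have f_bd: "0 \<le> f k s \<omega>" "f k s \<omega> \<le> real k" for k s \<omega>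
    unfolding f_def by (auto intro!: enn2real_leI)
  note meas[measurable]
  have fm: "case_prod (f k) \<in> borel_measurable (N \<Otimes>\<^sub>M M)" for k
    unfolding f_def split_beta' using meas unfolding split_beta' by measurable
  have "\<exists>X \<in> borel_measurable F. AE \<omega> in M. X \<omega> = (\<integral>s. f k s \<omega> \<partial>N)" for k
  proof (rule AE_integral_adapted[OF N sub fm])
    show "f k s \<in> borel_measurable F" if "s \<in> space N" for s
      using ad[OF that] unfolding f_def by measurable
    show "\<bar>f k s \<omega>\<bar> \<le> real k" for s \<omega> using f_bd[of k s \<omega>] by simp
  qed
  then obtain X where X: "\<And>k. X k \<in> borel_measurable F" "\<And>k. AE \<omega> in M. X k \<omega> = (\<integral>s. f k s \<omega> \<partial>N)"
    by metis
  have "AE \<omega> in M. \<forall>k. X k \<omega> = (\<integral>s. f k s \<omega> \<partial>N)"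
    using X(2) by (simp add: AE_all_countable)
  then have "AE \<omega> in M. (SUP k. ennreal (X k \<omega>)) = (\<integral>\<^sup>+s. g s \<omega> \<partial>N)"
    using AE_space
  proof eventually_elim
    case (elim \<omega>)
    have fm2 [measurable]: "(\<lambda>s. f k s \<omega>) \<in> borel_measurable N" for k
      using measurable_compose[OF measurable_Pair2'[OF elim(2)] fm[of k]] by simp
    have pt: "(SUP k. ennreal (f k s \<omega>)) = g s \<omega>" for s
    proof (rule antisym)
      show "(SUP k. ennreal (f k s \<omega>)) \<le> g s \<omega>" unfolding f_ennreal by (auto intro!: SUP_least)
      have "min (g s \<omega>) (\<Squnion>k. ennreal (real k)) \<le> (SUP k. min (g s \<omega>) (ennreal (real k)))"
        by (simp add: inf_SUP flip: inf_min)
      then show "g s \<omega> \<le> (SUP k. ennreal (f k s \<omega>))"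
        unfolding f_ennreal by (simp add: ennreal_SUP_of_nat_eq_top flip: ennreal_of_nat_eq_real_of_nat)
    qed
    have "(SUP k. ennreal (X k \<omega>)) = (SUP k. \<integral>\<^sup>+s. ennreal (f k s \<omega>) \<partial>N)"
    proof (rule SUP_cong)
      fix k
      have "integrable N (\<lambda>s. f k s \<omega>)"
        by (rule N.integrable_const_bound[where B="real k"]) (use f_bd in auto)
      then show "ennreal (X k \<omega>) = (\<integral>\<^sup>+s. ennreal (f k s \<omega>) \<partial>N)"
        using elim(1) f_bd by (simp add: nn_integral_eq_integral)
    qed simp
    also have "\<dots> = (\<integral>\<^sup>+s. (SUP k. ennreal (f k s \<omega>)) \<partial>N)"
    proof (rule nn_integral_monotone_convergence_SUP[symmetric])
      show "incseq (\<lambda>k s. ennreal (f k s \<omega>))"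
        unfolding f_ennreal by (auto simp: incseq_def le_fun_def intro!: min.coboundedI2 ennreal_leI)
    qed measurable
    finally show ?case unfolding pt .
  qed
  moreover have "(\<lambda>\<omega>. SUP k. ennreal (X k \<omega>)) \<in> borel_measurable F"
    using X(1) by measurable
  ultimately show ?thesis by (intro bexI[of _ "\<lambda>\<omega>. SUP k. ennreal (X k \<omega>)"])
qed

text \<open>Borel-Cantelli: at stage \<open>k\<close> an index is picked at which (1/2)^k is
  exceeded with probability below (1/2)^k. The map \<open>r\<close> is not made increasing, since it
  only serves to re-index the approximations.\<close>

lemma (in prob_space) tendsto_in_prob_AE_subseq:
  fixes R :: "nat \<Rightarrow> 'a \<Rightarrow> ennreal"
  assumes [measurable]: "\<And>k. R k \<in> borel_measurable M"
    and lim: "\<And>\<epsilon>. 0 < \<epsilon> \<Longrightarrow> (\<lambda>k. prob {\<omega>\<in>space M. R k \<omega> > ennreal \<epsilon>}) \<longlonglongrightarrow> 0"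
  shows "\<exists>r :: nat \<Rightarrow> nat. AE \<omega> in M. (\<lambda>k. R (r k) \<omega>) \<longlonglongrightarrow> 0"
proof -
  have "\<exists>j. prob {\<omega>\<in>space M. R j \<omega> > ennreal ((1/2)^k)} < (1/2)^k" for k :: nat
    using order_tendstoD(2)[OF lim[of "(1/2)^k"], of "(1/2)^k"] by (auto simp: eventually_sequentially)
  then obtain r where r: "\<And>k. prob {\<omega>\<in>space M. R (r k) \<omega> > ennreal ((1/2)^k)} < (1/2)^k"
    by metis
  have "AE \<omega> in M. eventually (\<lambda>k. \<omega> \<in> space M - {\<omega>\<in>space M. R (r k) \<omega> > ennreal ((1/2)^k)}) sequentially"
  proof (rule borel_cantelli_AE1)
    show "summable (\<lambda>k. prob {\<omega>\<in>space M. R (r k) \<omega> > ennreal ((1/2)^k)})"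
      by (rule summable_comparison_test'[where g="\<lambda>k. (1/2)^k" and N=0])
        (use r in \<open>auto intro: less_imp_le summable_geometric\<close>)
  qed (auto simp: emeasure_eq_measure)
  then have "AE \<omega> in M. (\<lambda>k. R (r k) \<omega>) \<longlonglongrightarrow> 0"
  proof eventually_elim
    case (elim \<omega>)
    have "(\<lambda>k. ennreal ((1/2)^k)) \<longlonglongrightarrow> ennreal 0"
      by (intro tendsto_ennrealI LIMSEQ_power_zero) auto
    then have l0: "(\<lambda>k. ennreal ((1/2)^k)) \<longlonglongrightarrow> 0" by simp
    show ?case
    proof (rule tendsto_sandwich[OF _ _ tendsto_const l0])
      show "eventually (\<lambda>k. R (r k) \<omega> \<le> ennreal ((1/2)^k)) sequentially"
        using elim by eventually_elim (auto simp: not_less)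
    qed simp
  qed
  then show ?thesis by blast
qed

subsection \<open>A stopped second moment inequality for the Ito integral\<close>

text \<open>Young's inequality. The weight on \<open>v\<close> can be taken arbitrarily close to 1,
  so no constant is lost in the limit; the large weight falls on \<open>u - v\<close>, which will
  tend to 0.\<close>

lemma norm_sq_le_weighted:
  fixes u v :: "'h::real_inner"
  assumes "0 < \<delta>"
  shows "(norm u)\<^sup>2 \<le> (1 + \<delta>) * (norm v)\<^sup>2 + (1 + 1 / \<delta>) * (norm (u - v))\<^sup>2"
proof -
  have "norm u \<le> norm v + norm (u - v)" using norm_triangle_sub[of u v] by simp
  then have "(norm u)\<^sup>2 \<le> (norm v + norm (u - v))\<^sup>2" by (rule power_mono) simp
  also have "\<dots> = (norm v)\<^sup>2 + (norm (u - v))\<^sup>2 + 2 * norm v * norm (u - v)"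
    by (simp add: power2_sum)
  also have "2 * norm v * norm (u - v) \<le> \<delta> * (norm v)\<^sup>2 + (norm (u - v))\<^sup>2 / \<delta>"
  proof -
    have "0 \<le> (\<delta> * norm v - norm (u - v))\<^sup>2 / \<delta>" using assms by simp
    also have "\<dots> = \<delta> * (norm v)\<^sup>2 + (norm (u - v))\<^sup>2 / \<delta> - 2 * norm v * norm (u - v)"
      using assms by (simp add: power2_eq_square field_simps)
    finally show ?thesis by simp
  qed
  finally show ?thesis by (simp add: algebra_simps)
qed

text \<open>The approximations converge in L2, the cut-off factors only pointwise. The weighted
  inequality leaves the cut-off on the limit \<open>f\<close>, where dominated convergence applies,
  and on the difference it is bounded by 1.\<close>

lemma limsup_nn_integral_stopped_le:
  fixes f :: "'s \<Rightarrow> 'h::{real_inner, second_countable_topology}" and fk :: "nat \<Rightarrow> 's \<Rightarrow> 'h"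
    and g :: "'s \<Rightarrow> ennreal"
  assumes [measurable]: "f \<in> borel_measurable M" "\<And>k. fk k \<in> borel_measurable M"
      "g \<in> borel_measurable M" "\<And>k. gk k \<in> borel_measurable M"
    and fin: "(\<integral>\<^sup>+s. ennreal ((norm (f s))\<^sup>2) \<partial>M) < \<infinity>"
    and lim: "(\<lambda>k. \<integral>\<^sup>+s. ennreal ((norm (fk k s - f s))\<^sup>2) \<partial>M) \<longlonglongrightarrow> 0"
    and g1: "\<And>k s. gk k s \<le> 1" and glim: "\<And>s. s \<in> space M \<Longrightarrow> (\<lambda>k. gk k s) \<longlonglongrightarrow> g s"
  shows "limsup (\<lambda>k. \<integral>\<^sup>+s. ennreal ((norm (fk k s))\<^sup>2) * gk k s \<partial>M) \<le>
    (\<integral>\<^sup>+s. ennreal ((norm (f s))\<^sup>2) * g s \<partial>M)" (is "?L \<le> ?Q")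
proof (rule ennreal_le_epsilon)
  fix e :: real assume Q: "?Q < top" and e: "0 < e"
  \<comment> \<open>Chosen such that \<delta> times \<open>?Q\<close> is at most \<open>e\<close>;
    the added 1 keeps the denominator positive when \<open>?Q\<close> is 0.\<close>
  define \<delta> where "\<delta> = e / (enn2real ?Q + 1)"
  have \<delta>: "0 < \<delta>" using e by (auto simp: \<delta>_def intro!: divide_pos_pos add_nonneg_pos)
  let ?R = "\<lambda>k. \<integral>\<^sup>+s. ennreal ((norm (fk k s - f s))\<^sup>2) \<partial>M"
  let ?Qk = "\<lambda>k. \<integral>\<^sup>+s. ennreal ((norm (f s))\<^sup>2) * gk k s \<partial>M"
  have le: "(\<integral>\<^sup>+s. ennreal ((norm (fk k s))\<^sup>2) * gk k s \<partial>M) \<le>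
      ennreal (1 + \<delta>) * ?Qk k + ennreal (1 + 1 / \<delta>) * ?R k" for k
  proof -
    have "ennreal ((norm (fk k s))\<^sup>2) * gk k s \<le>
      ennreal (1 + \<delta>) * (ennreal ((norm (f s))\<^sup>2) * gk k s) + ennreal (1 + 1 / \<delta>) * ennreal ((norm (fk k s - f s))\<^sup>2)" for s
    proof -
      have "ennreal ((norm (fk k s))\<^sup>2) \<le> ennreal ((1 + \<delta>) * (norm (f s))\<^sup>2 + (1 + 1 / \<delta>) * (norm (fk k s - f s))\<^sup>2)"
        by (rule ennreal_leI[OF norm_sq_le_weighted[OF \<delta>]])
      also have "\<dots> = ennreal (1 + \<delta>) * ennreal ((norm (f s))\<^sup>2) + ennreal (1 + 1 / \<delta>) * ennreal ((norm (fk k s - f s))\<^sup>2)"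
        using \<delta> by (simp add: ennreal_plus ennreal_mult' del: ennreal_plus[symmetric])
      finally have "ennreal ((norm (fk k s))\<^sup>2) * gk k s \<le>
          (ennreal (1 + \<delta>) * ennreal ((norm (f s))\<^sup>2) + ennreal (1 + 1 / \<delta>) * ennreal ((norm (fk k s - f s))\<^sup>2)) * gk k s"
        by (rule mult_right_mono) simp
      also have "\<dots> = ennreal (1 + \<delta>) * (ennreal ((norm (f s))\<^sup>2) * gk k s) +
          ennreal (1 + 1 / \<delta>) * ennreal ((norm (fk k s - f s))\<^sup>2) * gk k s"
        by (simp only: distrib_right mult.assoc)
      also have "\<dots> \<le> ennreal (1 + \<delta>) * (ennreal ((norm (f s))\<^sup>2) * gk k s) +
          ennreal (1 + 1 / \<delta>) * ennreal ((norm (fk k s - f s))\<^sup>2) * 1"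
        by (intro add_left_mono mult_left_mono g1) simp
      finally show ?thesis by (simp only: mult_1_right)
    qed
    then have "(\<integral>\<^sup>+s. ennreal ((norm (fk k s))\<^sup>2) * gk k s \<partial>M) \<le>
      (\<integral>\<^sup>+s. ennreal (1 + \<delta>) * (ennreal ((norm (f s))\<^sup>2) * gk k s) + ennreal (1 + 1 / \<delta>) * ennreal ((norm (fk k s - f s))\<^sup>2) \<partial>M)"
      by (intro nn_integral_mono)
    also have "\<dots> = ennreal (1 + \<delta>) * ?Qk k + ennreal (1 + 1 / \<delta>) * ?R k"
      by (subst nn_integral_add; (subst nn_integral_cmult)?; (subst nn_integral_cmult)?; simp)
    finally show ?thesis .
  qed
  have "?Qk \<longlonglongrightarrow> ?Q"
  proof (rule nn_integral_dominated_convergence[where w="\<lambda>s. ennreal ((norm (f s))\<^sup>2)"])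
    show "AE s in M. ennreal ((norm (f s))\<^sup>2) * gk k s \<le> ennreal ((norm (f s))\<^sup>2)" for k
      using mult_left_mono[OF g1[of k]] by (intro AE_I2) (metis mult_1_right zero_le)
    show "AE s in M. (\<lambda>k. ennreal ((norm (f s))\<^sup>2) * gk k s) \<longlonglongrightarrow> ennreal ((norm (f s))\<^sup>2) * g s"
      by (intro AE_I2 ennreal_tendsto_cmult glim) auto
  qed (use fin in auto)
  then have "(\<lambda>k. ennreal (1 + \<delta>) * ?Qk k + ennreal (1 + 1 / \<delta>) * ?R k) \<longlonglongrightarrow>
      ennreal (1 + \<delta>) * ?Q + ennreal (1 + 1 / \<delta>) * 0"
    by (intro tendsto_add ennreal_tendsto_cmult lim) auto
  then have "limsup (\<lambda>k. ennreal (1 + \<delta>) * ?Qk k + ennreal (1 + 1 / \<delta>) * ?R k) = ennreal (1 + \<delta>) * ?Q"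
    using lim_imp_Limsup[OF sequentially_bot] by fastforce
  moreover have "?L \<le> limsup (\<lambda>k. ennreal (1 + \<delta>) * ?Qk k + ennreal (1 + 1 / \<delta>) * ?R k)"
    by (intro Limsup_mono always_eventually allI le)
  ultimately have "?L \<le> ennreal (1 + \<delta>) * ?Q" by simp
  also have "\<dots> = ?Q + ennreal \<delta> * ?Q" using \<delta> by (simp add: ennreal_plus distrib_right del: ennreal_plus[symmetric])
  also have "ennreal \<delta> * ?Q = ennreal (\<delta> * enn2real ?Q)" using Q \<delta> by (simp add: ennreal_mult' less_top)
  also have "\<dots> \<le> ennreal e"
    using e by (intro ennreal_leI) (simp add: \<delta>_def field_simps add_pos_nonneg)
  finally show "?L \<le> ?Q + ennreal e" by (simp add: add_left_mono)
qed

lemma set_nn_integral_restrict: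
  "(\<integral>\<^sup>+s\<in>{a..b}. f s \<partial>lborel) = (\<integral>\<^sup>+s. f s \<partial>restrict_space lborel {a..b::real})"
  by (simp add: nn_integral_restrict_space)

lemma borel_measurable_lborel_Icc:
  "continuous_on UNIV f \<Longrightarrow> f \<in> borel_measurable (restrict_space lborel {a..b})"
  by (rule measurable_restrict_space1) (simp add: borel_measurable_continuous_onI)

lemma finite_measure_lborel_Icc: "finite_measure (restrict_space lborel {a..b::real})"
  by (rule finite_measureI)
    (simp add: emeasure_restrict_space space_restrict_space emeasure_lborel_Icc_eq)

context
  fixes P :: "'w measure" and W :: "real \<Rightarrow> 'w \<Rightarrow> real"
  assumes BM: "two_sided_BM P W"
begin

interpretation prob_space P
  by (rule BM[unfolded two_sided_BM_def, THEN conjunct1])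

lemma elementary_process_measurable:
  fixes \<xi> :: "nat \<Rightarrow> 'w \<Rightarrow> 'h::{real_normed_vector, second_countable_topology}"
  assumes el: "elementary (BM_filtration P W) a b n \<tau> \<xi>"
  shows "(\<lambda>(s, \<omega>). elementary_process n \<tau> \<xi> s \<omega>) \<in> borel_measurable (restrict_space lborel {a..b} \<Otimes>\<^sub>M P)"
    and "elementary_integral W n \<tau> \<xi> \<in> borel_measurable P"
proof -
  have \<xi>: "\<xi> i \<in> borel_measurable P" if "i < n" for i
    using el that by (intro measurable_from_subalg[OF subalgebra_BM_filtration[OF BM]])
      (auto simp: elementary_def)
  have "(\<lambda>p. (indicat_real {\<tau> i<..\<tau> (Suc i)} (fst p)) *\<^sub>R \<xi> i (snd p)) \<in> borel_measurable (restrict_space lborel {a..b} \<Otimes>\<^sub>M P)"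
    if "i < n" for i
  proof (rule borel_measurable_scaleR)
    have "indicat_real {\<tau> i<..\<tau> (Suc i)} \<in> borel_measurable (restrict_space lborel {a..b})"
      by (rule measurable_restrict_space1) simp
    from measurable_compose[OF measurable_fst this]
    show "(\<lambda>p. indicat_real {\<tau> i<..\<tau> (Suc i)} (fst p)) \<in> borel_measurable (restrict_space lborel {a..b} \<Otimes>\<^sub>M P)" .
  qed (rule measurable_compose[OF measurable_snd \<xi>[OF that]])
  then show "(\<lambda>(s, \<omega>). elementary_process n \<tau> \<xi> s \<omega>) \<in> borel_measurable (restrict_space lborel {a..b} \<Otimes>\<^sub>M P)"
    unfolding elementary_process_def split_beta' by (intro borel_measurable_sum) simp
  show "elementary_integral W n \<tau> \<xi> \<in> borel_measurable P"
    unfolding elementary_integral_def[abs_def]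
    by (intro borel_measurable_sum borel_measurable_scaleR borel_measurable_diff BM_measurable[OF BM] \<xi>) simp
qed

text \<open>A subsequence turns both convergences in probability into almost sure ones. Every
  interval of the \<open>k\<close>-th partition is then cut into \<open>Suc k\<close> pieces, which
  changes neither process nor integral but forces the mesh to 0.\<close>

lemma Ito_integral_AE_approximation:
  fixes \<phi> :: "real \<Rightarrow> 'w \<Rightarrow> 'h::{real_inner, second_countable_topology}"
  assumes I: "has_Ito_integral P (BM_filtration P W) W \<phi> a b Y"
  shows "\<exists>(n :: nat \<Rightarrow> nat) (\<tau> :: nat \<Rightarrow> nat \<Rightarrow> real) (\<xi> :: nat \<Rightarrow> nat \<Rightarrow> 'w \<Rightarrow> 'h).
    (\<forall>k. elementary (BM_filtration P W) a b (n k) (\<tau> k) (\<xi> k)) \<and>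
    (\<forall>k. \<forall>p<n k. \<tau> k (Suc p) - \<tau> k p \<le> (b - a) / Suc k) \<and>
    (AE \<omega> in P. (\<lambda>k. \<integral>\<^sup>+s. ennreal ((norm (elementary_process (n k) (\<tau> k) (\<xi> k) s \<omega> - \<phi> s \<omega>))\<^sup>2)
        \<partial>restrict_space lborel {a..b}) \<longlonglongrightarrow> 0) \<and>
    (AE \<omega> in P. (\<lambda>k. elementary_integral W (n k) (\<tau> k) (\<xi> k) \<omega>) \<longlonglongrightarrow> Y \<omega>)"
proof -
  let ?F = "BM_filtration P W"
  define N where "N = restrict_space lborel {a..b}"
  have toN: "(\<integral>\<^sup>+s\<in>{a..b}. f s \<partial>lborel) = (\<integral>\<^sup>+s. f s \<partial>N)" for f
    unfolding N_def by (simp add: nn_integral_restrict_space)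
  have fmN: "finite_measure N"
    unfolding N_def by (rule finite_measure_lborel_Icc)
  interpret N: finite_measure N by (rule fmN)
  from I obtain n \<tau> \<xi> where el: "\<And>k. elementary ?F a b (n k) (\<tau> k) (\<xi> k)"
    and L1: "\<And>\<epsilon>. 0 < \<epsilon> \<Longrightarrow> (\<lambda>k. measure P {\<omega>\<in>space P.
            (\<integral>\<^sup>+s\<in>{a..b}. ennreal ((norm (elementary_process (n k) (\<tau> k) (\<xi> k) s \<omega> - \<phi> s \<omega>))\<^sup>2) \<partial>lborel)
              > ennreal \<epsilon>}) \<longlonglongrightarrow> 0"
    and L2: "\<And>\<epsilon>. 0 < \<epsilon> \<Longrightarrow> (\<lambda>k. measure P {\<omega>\<in>space P.
            norm (elementary_integral W (n k) (\<tau> k) (\<xi> k) \<omega> - Y \<omega>) > \<epsilon>}) \<longlonglongrightarrow> 0"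
    unfolding has_Ito_integral_def by blast
  have \<phi>: "case_prod \<phi> \<in> borel_measurable (N \<Otimes>\<^sub>M P)" and Y [measurable]: "Y \<in> borel_measurable P"
    using I unfolding has_Ito_integral_def N_def by blast+
  define R where "R k \<omega> = (\<integral>\<^sup>+s. ennreal ((norm (elementary_process (n k) (\<tau> k) (\<xi> k) s \<omega> - \<phi> s \<omega>))\<^sup>2) \<partial>N)" for k \<omega>
  define D where "D k \<omega> = norm (elementary_integral W (n k) (\<tau> k) (\<xi> k) \<omega> - Y \<omega>)" for k \<omega>
  have [measurable]: "R k \<in> borel_measurable P" for k
  proof -
    have "(\<lambda>(s, \<omega>). ennreal ((norm (elementary_process (n k) (\<tau> k) (\<xi> k) s \<omega> - \<phi> s \<omega>))\<^sup>2)) \<in> borel_measurable (N \<Otimes>\<^sub>M P)"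
      using borel_measurable_diff[OF elementary_process_measurable(1)[OF el[of k], folded N_def] \<phi>]
      unfolding split_beta' by measurable
    from measurable_pair_swap[OF this] show ?thesis
      unfolding R_def by (intro N.borel_measurable_nn_integral) simp
  qed
  have [measurable]: "D k \<in> borel_measurable P" for k
    unfolding D_def using elementary_process_measurable(2)[OF el[of k]] by measurable
  \<comment> \<open>Adding the errors of the process and of the integral yields one re-indexing that
    serves both.\<close>
  have "\<exists>r :: nat \<Rightarrow> nat. AE \<omega> in P. (\<lambda>k. R (r k) \<omega> + ennreal (D (r k) \<omega>)) \<longlonglongrightarrow> 0"
  proof (rule tendsto_in_prob_AE_subseq)
    fix \<epsilon> :: real assume "0 < \<epsilon>"
    then have e: "0 < \<epsilon> / 2" by simp
    show "(\<lambda>k. prob {\<omega>\<in>space P. R k \<omega> + ennreal (D k \<omega>) > ennreal \<epsilon>}) \<longlonglongrightarrow> 0"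
    proof (rule tendsto_sandwich[OF _ _ tendsto_const])
      have "(\<lambda>k. prob {\<omega>\<in>space P. R k \<omega> > ennreal (\<epsilon> / 2)} + prob {\<omega>\<in>space P. D k \<omega> > \<epsilon> / 2}) \<longlonglongrightarrow> 0 + 0"
        unfolding R_def D_def by (intro tendsto_add L1[OF e, unfolded toN] L2[OF e])
      then show "(\<lambda>k. prob {\<omega>\<in>space P. R k \<omega> > ennreal (\<epsilon> / 2)} + prob {\<omega>\<in>space P. D k \<omega> > \<epsilon> / 2}) \<longlonglongrightarrow> 0"
        by simp
      show "\<forall>\<^sub>F k in sequentially. prob {\<omega>\<in>space P. R k \<omega> + ennreal (D k \<omega>) > ennreal \<epsilon>} \<le>
          prob {\<omega>\<in>space P. R k \<omega> > ennreal (\<epsilon> / 2)} + prob {\<omega>\<in>space P. D k \<omega> > \<epsilon> / 2}"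
      proof (intro always_eventually allI)
        fix k
        have "{\<omega>\<in>space P. R k \<omega> + ennreal (D k \<omega>) > ennreal \<epsilon>} \<subseteq>
          {\<omega>\<in>space P. R k \<omega> > ennreal (\<epsilon> / 2)} \<union> {\<omega>\<in>space P. D k \<omega> > \<epsilon> / 2}"
        proof (rule subsetI, rule ccontr)
          fix \<omega> assume \<omega>: "\<omega> \<in> {\<omega>\<in>space P. R k \<omega> + ennreal (D k \<omega>) > ennreal \<epsilon>}"
            "\<omega> \<notin> {\<omega>\<in>space P. R k \<omega> > ennreal (\<epsilon> / 2)} \<union> {\<omega>\<in>space P. D k \<omega> > \<epsilon> / 2}"
          then have "R k \<omega> + ennreal (D k \<omega>) \<le> ennreal (\<epsilon> / 2) + ennreal (\<epsilon> / 2)"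
            by (intro add_mono ennreal_leI) auto
          also have "\<dots> = ennreal \<epsilon>" using e by (simp flip: ennreal_plus)
          finally show False using \<omega> by auto
        qed
        then have "prob {\<omega>\<in>space P. R k \<omega> + ennreal (D k \<omega>) > ennreal \<epsilon>} \<le>
          prob ({\<omega>\<in>space P. R k \<omega> > ennreal (\<epsilon> / 2)} \<union> {\<omega>\<in>space P. D k \<omega> > \<epsilon> / 2})"
          by (rule finite_measure_mono) measurable
        also have "\<dots> \<le> prob {\<omega>\<in>space P. R k \<omega> > ennreal (\<epsilon> / 2)} + prob {\<omega>\<in>space P. D k \<omega> > \<epsilon> / 2}"
          by (rule measure_Un_le) measurable
        finally show "prob {\<omega>\<in>space P. R k \<omega> + ennreal (D k \<omega>) > ennreal \<epsilon>} \<le>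
          prob {\<omega>\<in>space P. R k \<omega> > ennreal (\<epsilon> / 2)} + prob {\<omega>\<in>space P. D k \<omega> > \<epsilon> / 2}" .
      qed
    qed simp
  qed measurable
  then obtain r :: "nat \<Rightarrow> nat" where r: "AE \<omega> in P. (\<lambda>k. R (r k) \<omega> + ennreal (D (r k) \<omega>)) \<longlonglongrightarrow> 0"
    by blast
  have r1: "AE \<omega> in P. (\<lambda>k. R (r k) \<omega>) \<longlonglongrightarrow> 0"
    using r by eventually_elim (rule tendsto_sandwich[OF _ _ tendsto_const], auto intro!: always_eventually)
  have r2: "AE \<omega> in P. (\<lambda>k. elementary_integral W (n (r k)) (\<tau> (r k)) (\<xi> (r k)) \<omega>) \<longlonglongrightarrow> Y \<omega>"
    using r
  proof eventually_elim
    case (elim \<omega>)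
    have "(\<lambda>k. ennreal (D (r k) \<omega>)) \<longlonglongrightarrow> 0"
      by (rule tendsto_sandwich[OF _ _ tendsto_const elim]) (auto intro!: always_eventually)
    then have "(\<lambda>k. D (r k) \<omega>) \<longlonglongrightarrow> 0"
      using tendsto_ennreal_iff[of "\<lambda>k. D (r k) \<omega>" sequentially 0] by (simp add: D_def)
    then show ?case unfolding D_def by (subst LIM_zero_iff[symmetric]) (rule tendsto_norm_zero_cancel)
  qed
  have steps: "\<tau> k i \<le> \<tau> k (Suc i)" if "i < n k" for k i using el[of k] that by (simp add: elementary_def)
  let ?n = "\<lambda>k. n (r k) * Suc k" and ?\<tau> = "\<lambda>k. refine_times (Suc k) (\<tau> (r k))"
  let ?\<xi> = "\<lambda>k p. \<xi> (r k) (p div Suc k)"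
  have pr: "elementary_process (?n k) (?\<tau> k) (?\<xi> k) s \<omega> = elementary_process (n (r k)) (\<tau> (r k)) (\<xi> (r k)) s \<omega>" for k s \<omega>
    by (rule elementary_process_refine) (auto intro: steps)
  have int: "elementary_integral W (?n k) (?\<tau> k) (?\<xi> k) \<omega> = elementary_integral W (n (r k)) (\<tau> (r k)) (\<xi> (r k)) \<omega>" for k \<omega>
    by (rule elementary_integral_refine) simp
  have "elementary ?F a b (?n k) (?\<tau> k) (?\<xi> k)" for k
    by (rule elementary_refine[OF el]) (auto intro: BM_filtration_mono[OF BM])
  moreover have "?\<tau> k (Suc p) - ?\<tau> k p \<le> (b - a) / Suc k" if "p < ?n k" for k p
    by (rule refine_times_mesh[OF el _ that]) simp
  ultimately show ?thesis
    using r1[unfolded R_def] r2 unfolding N_def[symmetric]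
    by (intro exI[of _ ?n] exI[of _ ?\<tau>] exI[of _ ?\<xi>] conjI) (simp_all only: pr int, blast+)
qed

end

text \<open>The pathwise bound behind the second switch. The lengths carry absolute values because
  \<tau> is known to increase only below \<open>n\<close>, while \<open>sum_stopped_le\<close> asks
  for nonnegative terms at all indices.\<close>

lemma elementary_stopped_sq_le:
  fixes \<xi> :: "nat \<Rightarrow> 'w \<Rightarrow> 'h::{real_normed_vector, second_countable_topology}"
  assumes el: "elementary \<F> a b n \<tau> \<xi>" and L: "0 \<le> L"
    and c: "\<And>i. i < n \<Longrightarrow> c i \<omega> = 1 \<Longrightarrow> (\<Sum>j\<le>i. \<bar>\<tau> (Suc j) - \<tau> j\<bar> * (norm (\<xi> j \<omega>))\<^sup>2) \<le> L"
    and c01: "\<And>i. c i \<omega> = 0 \<or> c i \<omega> = (1::real)"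
  shows "(\<Sum>i<n. (\<tau> (Suc i) - \<tau> i) * (norm (c i \<omega> *\<^sub>R \<xi> i \<omega>))\<^sup>2) \<le> L"
proof -
  let ?v = "\<lambda>i. \<bar>\<tau> (Suc i) - \<tau> i\<bar> * (norm (\<xi> i \<omega>))\<^sup>2"
  have "(\<Sum>i<n. (\<tau> (Suc i) - \<tau> i) * (norm (c i \<omega> *\<^sub>R \<xi> i \<omega>))\<^sup>2) \<le>
      (\<Sum>i<n. if (\<Sum>j\<le>i. ?v j) \<le> L then ?v i else 0)"
  proof (rule sum_mono)
    fix i assume i: "i \<in> {..<n}"
    show "(\<tau> (Suc i) - \<tau> i) * (norm (c i \<omega> *\<^sub>R \<xi> i \<omega>))\<^sup>2 \<le> (if (\<Sum>j\<le>i. ?v j) \<le> L then ?v i else 0)"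
    proof (cases "c i \<omega> = 1")
      case True
      then show ?thesis using c[of i] i by (auto intro!: mult_right_mono)
    next
      case False
      then have "c i \<omega> = 0" using c01 by blast
      then show ?thesis by simp
    qed
  qed
  also have "\<dots> \<le> L" by (rule sum_stopped_le) (use L in auto)
  finally show ?thesis .
qed

context
  fixes P :: "'w measure" and W :: "real \<Rightarrow> 'w \<Rightarrow> real"
  assumes BM: "two_sided_BM P W"
begin

interpretation prob_space P
  by (rule BM[unfolded two_sided_BM_def, THEN conjunct1])

text \<open>The approximating elementary processes are multiplied by indicators which are known at the
  left end point of each partition interval. They switch the process off once \<open>h\<close> exceeds \<open>c\<close>, and
  before its squared \<open>L\<^sup>2\<close>-norm exceeds \<open>K + 1\<close>; on the event \<open>h b \<le> c\<close> neither of this happens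
  eventually, so that the integrals still converge to \<open>Y\<close> there.\<close>

lemma Ito_stopped_second_moment:
  fixes \<phi> :: "real \<Rightarrow> 'w \<Rightarrow> 'h::{real_inner, second_countable_topology}" and h :: "real \<Rightarrow> 'w \<Rightarrow> ennreal"
  assumes I: "has_Ito_integral P (BM_filtration P W) W \<phi> a b Y" and ab: "a \<le> b"
    and h_ad: "\<And>r. a \<le> r \<Longrightarrow> r \<le> b \<Longrightarrow> \<exists>X\<in>borel_measurable (BM_filtration P W r). AE \<omega> in P. X \<omega> = h r \<omega>"
    and h_mono: "\<And>r s \<omega>. \<omega> \<in> space P \<Longrightarrow> a \<le> r \<Longrightarrow> r \<le> s \<Longrightarrow> s \<le> b \<Longrightarrow> h r \<omega> \<le> h s \<omega>"
    and h_left: "\<And>s \<omega>. \<omega> \<in> space P \<Longrightarrow> a \<le> s \<Longrightarrow> s \<le> b \<Longrightarrow> c < h s \<omega> \<Longrightarrow> \<exists>r. a \<le> r \<and> r < s \<and> c < h r \<omega>"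
    and h_meas: "case_prod h \<in> borel_measurable (restrict_space lborel {a..b} \<Otimes>\<^sub>M P)"
    and K0: "0 \<le> K"
    and K: "AE \<omega> in P. h b \<omega> \<le> c \<longrightarrow> (\<integral>\<^sup>+s\<in>{a..b}. ennreal ((norm (\<phi> s \<omega>))\<^sup>2) \<partial>lborel) \<le> ennreal K"
  shows "(\<integral>\<^sup>+\<omega>. ennreal ((norm (Y \<omega>))\<^sup>2) * indicator {\<omega>. h b \<omega> \<le> c} \<omega> \<partial>P) \<le>
      (\<integral>\<^sup>+\<omega>. (\<integral>\<^sup>+s. ennreal ((norm (\<phi> s \<omega>))\<^sup>2) * indicator {s. h s \<omega> \<le> c} s \<partial>restrict_space lborel {a..b}) \<partial>P)" (is "?E1")
    and "(\<integral>\<^sup>+\<omega>. ennreal ((norm (Y \<omega>))\<^sup>2) * indicator {\<omega>. h b \<omega> \<le> c} \<omega> \<partial>P) \<le> ennreal (K + 1)" (is "?E2")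
proof -
  let ?F = "BM_filtration P W"
  define N where "N = restrict_space lborel {a..b}"
  have toN: "(\<integral>\<^sup>+s\<in>{a..b}. f s \<partial>lborel) = (\<integral>\<^sup>+s. f s \<partial>N)" for f
    unfolding N_def by (simp add: nn_integral_restrict_space)
  have spN: "space N = {a..b}" by (simp add: N_def space_restrict_space)
  interpret N: finite_measure N unfolding N_def by (rule finite_measure_lborel_Icc)
  obtain n \<tau> and \<xi> :: "nat \<Rightarrow> nat \<Rightarrow> 'w \<Rightarrow> 'h" where el: "\<And>k. elementary ?F a b (n k) (\<tau> k) (\<xi> k)"
    and mesh: "\<And>k p. p < n k \<Longrightarrow> \<tau> k (Suc p) - \<tau> k p \<le> (b - a) / Suc k"
    and R: "AE \<omega> in P. (\<lambda>k. \<integral>\<^sup>+s. ennreal ((norm (elementary_process (n k) (\<tau> k) (\<xi> k) s \<omega> - \<phi> s \<omega>))\<^sup>2) \<partial>N) \<longlonglongrightarrow> 0"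
    and D: "AE \<omega> in P. (\<lambda>k. elementary_integral W (n k) (\<tau> k) (\<xi> k) \<omega>) \<longlonglongrightarrow> Y \<omega>"
    using Ito_integral_AE_approximation[OF BM I] unfolding N_def[symmetric] by blast
  have \<phi>_meas: "case_prod \<phi> \<in> borel_measurable (N \<Otimes>\<^sub>M P)" and Y [measurable]: "Y \<in> borel_measurable P"
    and \<phi>_fin: "AE \<omega> in P. (\<integral>\<^sup>+s. ennreal ((norm (\<phi> s \<omega>))\<^sup>2) \<partial>N) < \<infinity>"
    using I unfolding has_Ito_integral_def N_def toN[unfolded N_def] by blast+
  have sect: "(\<lambda>s. g s \<omega>) \<in> borel_measurable N"
    if "case_prod g \<in> borel_measurable (N \<Otimes>\<^sub>M P)" "\<omega> \<in> space P" for g :: "real \<Rightarrow> 'w \<Rightarrow> 'z::topological_space" and \<omega>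
    using measurable_compose[OF measurable_Pair2'[OF that(2)] that(1)] by simp
  have \<phi>_s [measurable]: "(\<lambda>s. \<phi> s \<omega>) \<in> borel_measurable N" if "\<omega> \<in> space P" for \<omega>
    by (rule sect[OF \<phi>_meas that])
  have h_s [measurable]: "(\<lambda>s. h s \<omega>) \<in> borel_measurable N" if "\<omega> \<in> space P" for \<omega>
    by (rule sect[OF h_meas[folded N_def] that])
  have step: "\<tau> k p \<le> \<tau> k (Suc p)" if "p < n k" for k p using el[of k] that by (simp add: elementary_def)
  have rng: "a \<le> \<tau> k p" "\<tau> k p \<le> b" if "p \<le> n k" for k p
    using elementary_mono(2,3)[OF el[of k]] that by auto
  have "\<exists>X\<in>borel_measurable (?F (\<tau> k p)). AE \<omega> in P. X \<omega> = h (\<tau> k p) \<omega>" if "p < n k" for k p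
    using rng[of p k] that by (intro h_ad) auto
  then have "\<forall>k p. \<exists>X. p < n k \<longrightarrow> X \<in> borel_measurable (?F (\<tau> k p)) \<and> (AE \<omega> in P. X \<omega> = h (\<tau> k p) \<omega>)"
    by blast
  then obtain X where X_all: "\<forall>k p. p < n k \<longrightarrow>
      X k p \<in> borel_measurable (?F (\<tau> k p)) \<and> (AE \<omega> in P. X k p \<omega> = h (\<tau> k p) \<omega>)"
    unfolding choice_iff by blast
  then have X: "X k p \<in> borel_measurable (?F (\<tau> k p))" if "p < n k" for k p using that by blast
  have "AE \<omega> in P. p < n k \<longrightarrow> X k p \<omega> = h (\<tau> k p) \<omega>" for k p
    using X_all by (cases "p < n k") auto
  then have Xh: "AE \<omega> in P. \<forall>k p. p < n k \<longrightarrow> X k p \<omega> = h (\<tau> k p) \<omega>"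
    by (simp add: AE_all_countable)
  define S where "S k p \<omega> = (\<Sum>j\<le>p. \<bar>\<tau> k (Suc j) - \<tau> k j\<bar> * (norm (\<xi> k j \<omega>))\<^sup>2)" for k p \<omega>
  \<comment> \<open>The switch uses the adapted version \<open>X\<close> of \<open>h\<close>, since
    \<open>h\<close> itself need not be measurable for the filtration. The sum \<open>S k p\<close>
    already contains the term of interval \<open>p\<close>: its coefficient is known at the left end
    point, so overshooting can be avoided.\<close>
  define cc where "cc k p \<omega> = (if X k p \<omega> \<le> c \<and> S k p \<omega> \<le> K + 1 then 1 else 0 :: real)" for k p \<omega>
  define \<psi> where "\<psi> k p \<omega> = cc k p \<omega> *\<^sub>R \<xi> k p \<omega>" for k p \<omega>
  have \<xi>_F: "\<xi> k j \<in> borel_measurable (?F (\<tau> k p))" if "j \<le> p" "p < n k" for k j p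
  proof (rule measurable_from_subalg[OF BM_filtration_mono[OF BM]])
    show "\<tau> k j \<le> \<tau> k p" by (rule elementary_mono(1)[OF el]) (use that in auto)
    show "\<xi> k j \<in> borel_measurable (?F (\<tau> k j))" using el[of k] that by (simp add: elementary_def)
  qed
  have el\<psi>: "elementary ?F a b (n k) (\<tau> k) (\<psi> k)" for k
    unfolding elementary_def
  proof (intro conjI allI impI)
    show "a \<le> \<tau> k 0" "\<tau> k (n k) \<le> b" using el[of k] by (auto simp: elementary_def)
    fix p assume p: "p < n k"
    show "\<tau> k p \<le> \<tau> k (Suc p)" by (rule step[OF p])
    have [measurable]: "S k p \<in> borel_measurable (?F (\<tau> k p))"
      unfolding S_def[abs_def]
    proof (rule borel_measurable_sum)
      fix j assume "j \<in> {..p}"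
      then have "\<xi> k j \<in> borel_measurable (?F (\<tau> k p))" using p by (intro \<xi>_F) auto
      then show "(\<lambda>\<omega>. \<bar>\<tau> k (Suc j) - \<tau> k j\<bar> * (norm (\<xi> k j \<omega>))\<^sup>2) \<in> borel_measurable (?F (\<tau> k p))"
        by measurable
    qed
    have [measurable]: "cc k p \<in> borel_measurable (?F (\<tau> k p))"
      unfolding cc_def[abs_def] using X[OF p] by measurable
    show "\<psi> k p \<in> borel_measurable (?F (\<tau> k p))"
      unfolding \<psi>_def[abs_def] using \<xi>_F[OF order_refl p] by measurable
    obtain C where C: "\<And>\<omega>. \<omega> \<in> space (?F (\<tau> k p)) \<Longrightarrow> norm (\<xi> k p \<omega>) \<le> C"
      using el[of k] p unfolding elementary_def by blast
    have "norm (\<psi> k p \<omega>) \<le> C" if "\<omega> \<in> space (?F (\<tau> k p))" for \<omega>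
      using C[OF that] order_trans[OF norm_ge_zero C[OF that]] by (simp add: \<psi>_def cc_def)
    then show "\<exists>C. \<forall>\<omega>\<in>space (?F (\<tau> k p)). norm (\<psi> k p \<omega>) \<le> C" by blast
  qed
  let ?ep = "\<lambda>k s \<omega>. elementary_process (n k) (\<tau> k) (\<xi> k) s \<omega>"
  let ?es = "\<lambda>k s \<omega>. elementary_process (n k) (\<tau> k) (\<psi> k) s \<omega>"
  let ?J = "\<lambda>k \<omega>. elementary_integral W (n k) (\<tau> k) (\<psi> k) \<omega>"
  have ep_meas: "case_prod (?ep k) \<in> borel_measurable (N \<Otimes>\<^sub>M P)"
    and es_meas: "case_prod (?es k) \<in> borel_measurable (N \<Otimes>\<^sub>M P)" for k
    unfolding N_def by (rule elementary_process_measurable[OF BM el] elementary_process_measurable[OF BM el\<psi>])+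
  have J_meas [measurable]: "?J k \<in> borel_measurable P" for k
    by (rule elementary_process_measurable(2)[OF BM el\<psi>])
  define Q where "Q k \<omega> = (\<integral>\<^sup>+s. ennreal ((norm (?es k s \<omega>))\<^sup>2) \<partial>N)" for k \<omega>
  have Q_meas [measurable]: "Q k \<in> borel_measurable P" for k
  proof -
    have "(\<lambda>(s, \<omega>). ennreal ((norm (?es k s \<omega>))\<^sup>2)) \<in> borel_measurable (N \<Otimes>\<^sub>M P)"
      using es_meas unfolding split_beta' by measurable
    from measurable_pair_swap[OF this] show ?thesis
      unfolding Q_def by (intro N.borel_measurable_nn_integral) simp
  qed
  have Q_le: "Q k \<omega> \<le> ennreal (K + 1)" for k \<omega>
    unfolding Q_def toN[symmetric] nn_integral_elementary_process_sq[OF el\<psi>] unfolding \<psi>_def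
    by (intro ennreal_leI elementary_stopped_sq_le[OF el]) (use K0 in \<open>auto simp: cc_def S_def split: if_splits\<close>)
  have iso: "(\<integral>\<^sup>+\<omega>. ennreal ((norm (?J k \<omega>))\<^sup>2) \<partial>P) = (\<integral>\<^sup>+\<omega>. Q k \<omega> \<partial>P)" for k
    unfolding Q_def toN[symmetric] by (rule elementary_integral_isometry_nn[OF BM el\<psi>])
  have conv: "AE \<omega> in P. h b \<omega> \<le> c \<longrightarrow> (\<lambda>k. ?J k \<omega>) \<longlonglongrightarrow> Y \<omega>"
    using R D K Xh AE_space
  proof eventually_elim
    case (elim \<omega>)
    show ?case
    proof
      assume hb: "h b \<omega> \<le> c"
      have \<phi>K: "(\<integral>\<^sup>+s. ennreal ((norm (\<phi> s \<omega>))\<^sup>2) \<partial>N) \<le> ennreal K" using elim(3) hb toN by simp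
      \<comment> \<open>With the constant factor 1 this compares the full norms. The gap between
        \<open>K\<close> and \<open>K + 1\<close> makes the bound strict, so it holds for all large
        \<open>k\<close> and the second switch stays on.\<close>
      have "limsup (\<lambda>k. \<integral>\<^sup>+s. ennreal ((norm (?ep k s \<omega>))\<^sup>2) * 1 \<partial>N) \<le> (\<integral>\<^sup>+s. ennreal ((norm (\<phi> s \<omega>))\<^sup>2) * 1 \<partial>N)"
        by (rule limsup_nn_integral_stopped_le[OF \<phi>_s[OF elim(5)] sect[OF ep_meas elim(5)]])
          (use elim(1) \<phi>K in \<open>auto simp: le_less_trans\<close>)
      also have "\<dots> \<le> ennreal K" using \<phi>K by simp
      also have "\<dots> < ennreal (K + 1)" using K0 by (intro ennreal_lessI) auto
      finally have "limsup (\<lambda>k. \<integral>\<^sup>+s. ennreal ((norm (?ep k s \<omega>))\<^sup>2) * 1 \<partial>N) < ennreal (K + 1)" .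
      from Limsup_lessD[OF this]
      have "eventually (\<lambda>k. (\<integral>\<^sup>+s. ennreal ((norm (?ep k s \<omega>))\<^sup>2) \<partial>N) < ennreal (K + 1)) sequentially" by simp
      then have "eventually (\<lambda>k. ?J k \<omega> = elementary_integral W (n k) (\<tau> k) (\<xi> k) \<omega>) sequentially"
      proof eventually_elim
        case (elim k)
        have nonneg: "0 \<le> (\<Sum>p<n k. (\<tau> k (Suc p) - \<tau> k p) * (norm (\<xi> k p \<omega>))\<^sup>2)"
          by (rule sum_nonneg) (use step in simp)
        have le: "(\<Sum>p<n k. (\<tau> k (Suc p) - \<tau> k p) * (norm (\<xi> k p \<omega>))\<^sup>2) < K + 1"
          using elim unfolding toN[symmetric] nn_integral_elementary_process_sq[OF el] ennreal_less_iff[OF nonneg] .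
        have "\<psi> k p \<omega> = \<xi> k p \<omega>" if p: "p < n k" for p
        proof -
          have "S k p \<omega> \<le> (\<Sum>j<n k. \<bar>\<tau> k (Suc j) - \<tau> k j\<bar> * (norm (\<xi> k j \<omega>))\<^sup>2)"
            unfolding S_def using p by (intro sum_mono2) auto
          also have "\<dots> = (\<Sum>j<n k. (\<tau> k (Suc j) - \<tau> k j) * (norm (\<xi> k j \<omega>))\<^sup>2)"
            using step by (intro sum.cong) auto
          finally have "S k p \<omega> \<le> K + 1" using le by simp
          moreover have "X k p \<omega> \<le> c"
            using \<open>\<forall>k p. p < n k \<longrightarrow> X k p \<omega> = h (\<tau> k p) \<omega>\<close> p hb
              h_mono[OF \<open>\<omega> \<in> space P\<close> rng(1)[of p k] rng(2)[of p k] order_refl] by simp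
          ultimately show ?thesis by (simp add: \<psi>_def cc_def)
        qed
        then show ?case unfolding elementary_integral_def by (intro sum.cong) auto
      qed
      then show "(\<lambda>k. ?J k \<omega>) \<longlonglongrightarrow> Y \<omega>"
        using elim(2) by (subst tendsto_cong)
    qed
  qed
  let ?B = "{\<omega>. h b \<omega> \<le> c}"
  have "(\<integral>\<^sup>+\<omega>. ennreal ((norm (Y \<omega>))\<^sup>2) * indicator ?B \<omega> \<partial>P) \<le> (\<integral>\<^sup>+\<omega>. liminf (\<lambda>k. ennreal ((norm (?J k \<omega>))\<^sup>2)) \<partial>P)"
  proof (rule nn_integral_mono_AE)
    show "AE \<omega> in P. ennreal ((norm (Y \<omega>))\<^sup>2) * indicator ?B \<omega> \<le> liminf (\<lambda>k. ennreal ((norm (?J k \<omega>))\<^sup>2))"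
      using conv
    proof eventually_elim
      case (elim \<omega>)
      show ?case
      proof (cases "h b \<omega> \<le> c")
        case True
        then have "(\<lambda>k. ennreal ((norm (?J k \<omega>))\<^sup>2)) \<longlonglongrightarrow> ennreal ((norm (Y \<omega>))\<^sup>2)"
          using elim by (intro tendsto_ennrealI tendsto_power tendsto_norm) simp
        from lim_imp_Liminf[OF sequentially_bot this] show ?thesis by (simp add: indicator_def)
      qed simp
    qed
  qed
  also have "\<dots> \<le> liminf (\<lambda>k. \<integral>\<^sup>+\<omega>. ennreal ((norm (?J k \<omega>))\<^sup>2) \<partial>P)"
    by (rule nn_integral_liminf) measurable
  also have "\<dots> \<le> limsup (\<lambda>k. \<integral>\<^sup>+\<omega>. Q k \<omega> \<partial>P)"
    unfolding iso by (rule Liminf_le_Limsup) simp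
  finally have fatou: "(\<integral>\<^sup>+\<omega>. ennreal ((norm (Y \<omega>))\<^sup>2) * indicator ?B \<omega> \<partial>P) \<le> limsup (\<lambda>k. \<integral>\<^sup>+\<omega>. Q k \<omega> \<partial>P)" .
  have EQ: "(\<integral>\<^sup>+\<omega>. Q k \<omega> \<partial>P) \<le> ennreal (K + 1)" for k
  proof -
    have "(\<integral>\<^sup>+\<omega>. Q k \<omega> \<partial>P) \<le> (\<integral>\<^sup>+\<omega>. ennreal (K + 1) \<partial>P)" by (intro nn_integral_mono Q_le)
    then show ?thesis by (simp add: emeasure_space_1)
  qed
  have "limsup (\<lambda>k. \<integral>\<^sup>+\<omega>. Q k \<omega> \<partial>P) \<le> ennreal (K + 1)"
    by (rule Limsup_bounded) (auto intro!: always_eventually EQ)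
  with fatou show ?E2 by (rule order_trans)

  have lsQ: "AE \<omega> in P. limsup (\<lambda>k. Q k \<omega>) \<le> (\<integral>\<^sup>+s. ennreal ((norm (\<phi> s \<omega>))\<^sup>2) * indicator {s. h s \<omega> \<le> c} s \<partial>N)"
    using R \<phi>_fin Xh AE_space
  proof eventually_elim
    case (elim \<omega>)
    \<comment> \<open>Contains all times at which the switched process can be nonzero: the intervals
      whose left end point satisfies \<open>h \<le> c\<close>. The times \<open>s\<close> with
      \<open>h s \<omega> \<le> c\<close> are added even where no interval covers them, so that the
      indicators converge exactly to the indicator of those times.\<close>
    define Ak where "Ak k = {s. h s \<omega> \<le> c} \<union> (\<Union>p\<in>{p. p < n k \<and> h (\<tau> k p) \<omega> \<le> c}. {\<tau> k p<..\<tau> k (Suc p)})" for k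
    have ind_meas: "indicator {s. h s \<omega> \<le> c} \<in> borel_measurable N"
      using h_s[OF elim(4)] by measurable
    have "{s\<in>space N. h s \<omega> \<le> c} \<in> sets N" using h_s[OF elim(4)] by measurable
    moreover have "{\<tau> k p<..\<tau> k (Suc p)} \<inter> space N \<in> sets N" for k p
      unfolding N_def by (auto simp: sets_restrict_space space_restrict_space)
    ultimately have "{s\<in>space N. h s \<omega> \<le> c} \<union> (\<Union>p\<in>{p. p < n k \<and> h (\<tau> k p) \<omega> \<le> c}. {\<tau> k p<..\<tau> k (Suc p)} \<inter> space N) \<in> sets N" for k
      by (intro sets.Un sets.finite_UN) auto
    also have "{s\<in>space N. h s \<omega> \<le> c} \<union> (\<Union>p\<in>{p. p < n k \<and> h (\<tau> k p) \<omega> \<le> c}. {\<tau> k p<..\<tau> k (Suc p)} \<inter> space N) = Ak k \<inter> space N" for k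
      unfolding Ak_def by auto
    finally have Ak_meas: "(indicator (Ak k) :: real \<Rightarrow> ennreal) \<in> borel_measurable N" for k
      by (simp add: borel_measurable_indicator_iff)
    have lim: "(\<lambda>k. indicator (Ak k) s :: ennreal) \<longlonglongrightarrow> indicator {s. h s \<omega> \<le> c} s" if s: "s \<in> space N" for s
    proof (cases "h s \<omega> \<le> c")
      case True
      then have "s \<in> Ak k" for k by (simp add: Ak_def)
      then show ?thesis using True by simp
    next
      case False
      \<comment> \<open>At \<open>r\<close>, strictly before \<open>s\<close>, the level
        \<open>c\<close> is already exceeded. Once the mesh is below \<open>s - r\<close>, an
        interval containing \<open>s\<close> starts no earlier than \<open>r\<close> and is switched
        off.\<close>
      then obtain r where r: "a \<le> r" "r < s" "c < h r \<omega>"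
        using h_left[OF elim(4), of s] s unfolding spN atLeastAtMost_iff not_le by blast
      have "(\<lambda>k. (b - a) / real (Suc k)) \<longlonglongrightarrow> 0"
        by (rule LIMSEQ_Suc[OF lim_const_over_n])
      then have "eventually (\<lambda>k. (b - a) / real (Suc k) < s - r) sequentially"
        using r by (intro order_tendstoD(2)[where y=0]) auto
      then have "eventually (\<lambda>k. indicator (Ak k) s = (0::ennreal)) sequentially"
      proof eventually_elim
        case (elim k)
        have "s \<notin> {\<tau> k p<..\<tau> k (Suc p)}" if p: "p < n k" "h (\<tau> k p) \<omega> \<le> c" for p
        proof
          assume "s \<in> {\<tau> k p<..\<tau> k (Suc p)}"
          then have "r \<le> \<tau> k p" using mesh[OF p(1)] elim by auto
          then have "h r \<omega> \<le> h (\<tau> k p) \<omega>"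
            using rng(2)[of p k] p r by (intro h_mono[OF \<open>\<omega> \<in> space P\<close>]) auto
          then show False using p r by auto
        qed
        then show ?case using False by (auto simp: Ak_def)
      qed
      then show ?thesis using False by (simp add: tendsto_eventually)
    qed
    have "Q k \<omega> \<le> (\<integral>\<^sup>+s. ennreal ((norm (?ep k s \<omega>))\<^sup>2) * indicator (Ak k) s \<partial>N)" for k
      unfolding Q_def
    proof (rule nn_integral_mono)
      fix s
      show "ennreal ((norm (?es k s \<omega>))\<^sup>2) \<le> ennreal ((norm (?ep k s \<omega>))\<^sup>2) * indicator (Ak k) s"
      proof (rule elementary_process_scale[of "n k" "\<tau> k" "\<xi> k" s \<omega>])
        show "\<tau> k i \<le> \<tau> k (Suc i)" if "i < n k" for i by (rule step[OF that])
      next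
        assume "\<And>c. elementary_process (n k) (\<tau> k) (\<lambda>i \<omega>. c i \<omega> *\<^sub>R \<xi> k i \<omega>) s \<omega> = 0"
        from this[of "cc k"] show ?thesis by (simp add: \<psi>_def[abs_def])
      next
        fix i assume i: "i < n k" "\<tau> k i < s" "s \<le> \<tau> k (Suc i)" "?ep k s \<omega> = \<xi> k i \<omega>"
          "\<And>c. elementary_process (n k) (\<tau> k) (\<lambda>i \<omega>. c i \<omega> *\<^sub>R \<xi> k i \<omega>) s \<omega> = c i \<omega> *\<^sub>R \<xi> k i \<omega>"
        have es: "?es k s \<omega> = cc k i \<omega> *\<^sub>R \<xi> k i \<omega>" using i(5)[of "cc k"] by (simp add: \<psi>_def[abs_def])
        show ?thesis
        proof (cases "cc k i \<omega> = 0")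
          case False
          then have "cc k i \<omega> = 1" "X k i \<omega> \<le> c" by (auto simp: cc_def split: if_splits)
          then have "s \<in> Ak k" using i elim(3) by (auto simp: Ak_def)
          then show ?thesis using es i(4) \<open>cc k i \<omega> = 1\<close> by simp
        qed (simp add: es)
      qed
    qed
    then have "limsup (\<lambda>k. Q k \<omega>) \<le> limsup (\<lambda>k. \<integral>\<^sup>+s. ennreal ((norm (?ep k s \<omega>))\<^sup>2) * indicator (Ak k) s \<partial>N)"
      by (intro Limsup_mono always_eventually allI)
    also have "\<dots> \<le> (\<integral>\<^sup>+s. ennreal ((norm (\<phi> s \<omega>))\<^sup>2) * indicator {s. h s \<omega> \<le> c} s \<partial>N)"
    proof (rule limsup_nn_integral_stopped_le[OF \<phi>_s[OF elim(4)] sect[OF ep_meas elim(4)] ind_meas Ak_meas elim(2) elim(1)])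
      show "indicator (Ak k) s \<le> (1::ennreal)" for k s by (simp add: indicator_def)
    qed (rule lim)
    finally show ?case .
  qed
  \<comment> \<open>The reverse Fatou lemma needs an integrable majorant, and the second switch
    provides the constant \<open>K + 1\<close>.\<close>
  have "limsup (\<lambda>k. \<integral>\<^sup>+\<omega>. Q k \<omega> \<partial>P) \<le> (\<integral>\<^sup>+\<omega>. limsup (\<lambda>k. Q k \<omega>) \<partial>P)"
    by (rule nn_integral_limsup[where w="\<lambda>_. ennreal (K + 1)"]) (auto intro!: AE_I2 Q_le simp: emeasure_space_1)
  also have "\<dots> \<le> (\<integral>\<^sup>+\<omega>. (\<integral>\<^sup>+s. ennreal ((norm (\<phi> s \<omega>))\<^sup>2) * indicator {s. h s \<omega> \<le> c} s \<partial>N) \<partial>P)"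
    by (rule nn_integral_mono_AE) (rule lsQ)
  finally show ?E1 using fatou unfolding N_def[symmetric] by (rule order_trans[rotated])
qed

end

subsection \<open>Second moments of mild solutions\<close>

text \<open>If \<open>f\<close> is not integrable, its Bochner integral is 0 by default, so the
  bound covers that case too.\<close>

lemma norm_integral_le_nn_integral:
  fixes f :: "'a \<Rightarrow> 'b::{banach, second_countable_topology}"
  shows "ennreal (norm (integral\<^sup>L M f)) \<le> (\<integral>\<^sup>+s. ennreal (norm (f s)) \<partial>M)"
  by (cases "integrable M f") (auto intro: integral_norm_bound_ennreal simp: not_integrable_integral_eq)

lemma norm_add3_sq_le:
  fixes u v w :: "'a::real_normed_vector"
  shows "(norm (u + v + w))\<^sup>2 \<le> 3 * (norm u)\<^sup>2 + 3 * (norm v)\<^sup>2 + 3 * (norm w)\<^sup>2"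
proof -
  have "norm (u + v + w) \<le> norm u + norm v + norm w"
    by (metis add_mono_thms_linordered_semiring(3) norm_triangle_ineq order_trans)
  then have "(norm (u + v + w))\<^sup>2 \<le> (norm u + norm v + norm w)\<^sup>2" by (rule power_mono) simp
  also have "\<dots> \<le> 3 * (norm u)\<^sup>2 + 3 * (norm v)\<^sup>2 + 3 * (norm w)\<^sup>2"
    using sum_squares_bound[of "norm u" "norm v"] sum_squares_bound[of "norm u" "norm w"]
      sum_squares_bound[of "norm v" "norm w"]
    by (simp add: power2_eq_square algebra_simps)
  finally show ?thesis .
qed

text \<open>The measure with density \<open>g\<close> does not charge \<open>s\<close>, and by
  continuity from below the half lines up to \<open>s - 1 / Suc k\<close> exhaust its mass before
  \<open>s\<close>. This includes infinite integrals, where subtracting a small remainder would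
  fail. The cut-off \<open>g'\<close> extends \<open>g\<close>, measurable on \<open>{a..b}\<close>,
  to the line.\<close>

lemma nn_integral_Icc_left_continuous:
  fixes g :: "real \<Rightarrow> ennreal"
  assumes g: "g \<in> borel_measurable (restrict_space lborel {a..b})" and s: "s \<le> b"
    and c: "c < (\<integral>\<^sup>+r\<in>{a..s}. g r \<partial>lborel)"
  shows "\<exists>r. a \<le> r \<and> r < s \<and> c < (\<integral>\<^sup>+u\<in>{a..r}. g u \<partial>lborel)"
proof -
  define g' where "g' r = g r * indicator {a..b} r" for r
  have g' [measurable]: "g' \<in> borel_measurable lborel"
    using g unfolding g'_def by (subst (asm) borel_measurable_restrict_space_iff_ennreal) auto
  define \<mu> where "\<mu> = density lborel g'"
  have h: "(\<integral>\<^sup>+u\<in>{a..r}. g u \<partial>lborel) = emeasure \<mu> {..r}" if "r \<le> b" for r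
    unfolding \<mu>_def g'_def[symmetric]
    by (subst emeasure_density) (use that in \<open>auto simp: g'_def indicator_def intro!: nn_integral_cong\<close>)
  have "emeasure \<mu> {..s} = emeasure \<mu> {..<s}"
  proof (rule emeasure_eq_AE)
    have "AE r in lborel. r \<noteq> s" by (rule AE_lborel_singleton)
    then have "AE r in \<mu>. r \<noteq> s" unfolding \<mu>_def
      by (subst AE_density) (auto elim: eventually_mono)
    then show "AE r in \<mu>. r \<in> {..s} \<longleftrightarrow> r \<in> {..<s}" by eventually_elim auto
  qed (auto simp: \<mu>_def)
  also have "{..<s} = (\<Union>k. {..s - 1 / real (Suc k)})"
  proof (intro equalityI subsetI)
    fix r assume "r \<in> {..<s}"
    then obtain k where "inverse (real (Suc k)) < s - r" using reals_Archimedean[of "s - r"] by auto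
    then show "r \<in> (\<Union>k. {..s - 1 / real (Suc k)})" by (auto intro!: exI[of _ k] simp: inverse_eq_divide)
  next
    fix r assume "r \<in> (\<Union>k. {..s - 1 / real (Suc k)})"
    then obtain k where "r \<le> s - 1 / real (Suc k)" by auto
    also have "s - 1 / real (Suc k) < s" by simp
    finally show "r \<in> {..<s}" by simp
  qed
  also have "emeasure \<mu> \<dots> = (SUP k. emeasure \<mu> {..s - 1 / real (Suc k)})"
    by (rule SUP_emeasure_incseq[symmetric])
      (auto simp: \<mu>_def incseq_def intro!: atMost_subset_iff[THEN iffD2] diff_left_mono frac_le)
  finally obtain k where k: "c < emeasure \<mu> {..s - 1 / real (Suc k)}"
    using c h[OF s] less_SUP_iff by (metis (no_types, lifting) UNIV_I)
  define r where "r = s - 1 / real (Suc k)"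
  have "r < s" by (simp add: r_def)
  moreover have cr: "c < (\<integral>\<^sup>+u\<in>{a..r}. g u \<partial>lborel)" using k h[of r] \<open>r < s\<close> s unfolding r_def[symmetric] by simp
  moreover have "a \<le> r"
  proof (rule ccontr)
    assume "\<not> a \<le> r"
    then have "{a..r} = {}" by auto
    then show False using cr by simp
  qed
  ultimately show ?thesis by blast
qed

section \<open>The clock and the events on which it is bounded\<close>

context
  fixes P :: "'w measure" and W :: "real \<Rightarrow> 'w \<Rightarrow> real"
    and U :: "real \<Rightarrow> 'h::{real_inner, banach, second_countable_topology} \<Rightarrow>\<^sub>L 'h"
    and F G :: "real \<Rightarrow> 'h \<Rightarrow> 'h"
    and N \<nu> A\<^sub>0 M t0 :: real
    and x0 :: "'w \<Rightarrow> 'h" and x :: "real \<Rightarrow> 'w \<Rightarrow> 'h"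
  assumes BM: "two_sided_BM P W"
    and N: "N > 0" and \<nu>: "\<nu> > 0" and U: "\<And>s. 0 \<le> s \<Longrightarrow> norm (U s) \<le> N * exp (- \<nu> * s)"
    and F_cont: "continuous_on UNIV (\<lambda>(s, y). F s y)" and G_cont: "continuous_on UNIV (\<lambda>(s, y). G s y)"
    and A\<^sub>0: "A\<^sub>0 > 0" and M: "M > 0"
    and F_le: "\<And>s y. norm (F s y) \<le> A\<^sub>0 + M * norm y" and G_le: "\<And>s y. norm (G s y) \<le> A\<^sub>0 + M * norm y"
    and sol: "mild_solution P W U F G t0 x0 x"
    and x0_int: "integrable P (\<lambda>\<omega>. (norm (x0 \<omega>))\<^sup>2)"
begin

interpretation prob_space P
  by (rule BM[unfolded two_sided_BM_def, THEN conjunct1])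

text \<open>The exponents 1 on \<open>F\<close> and 2 on \<open>G\<close> are those for which
  \<open>mild_solution\<close> grants almost sure integrability in time, and those that control the
  drift and the noise.\<close>

definition load :: "real \<Rightarrow> 'w \<Rightarrow> ennreal" where
  "load s \<omega> = ennreal (norm (F s (x s \<omega>))) + ennreal ((norm (G s (x s \<omega>)))\<^sup>2)"

definition clock :: "real \<Rightarrow> 'w \<Rightarrow> ennreal" where
  "clock r \<omega> = (\<integral>\<^sup>+s\<in>{t0..r}. load s \<omega> \<partial>lborel)"

text \<open>The solution is replaced by 0 once the clock has passed \<open>c\<close>, not frozen at
  that moment: the mild equation is available at deterministic times only. The value is an
  \<open>ennreal\<close> because finiteness is not known beforehand.\<close>

definition stopped_moment :: "real \<Rightarrow> real \<Rightarrow> ennreal" where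
  "stopped_moment c t = (\<integral>\<^sup>+\<omega>. ennreal ((norm (x t \<omega>))\<^sup>2) * indicator {\<omega>. clock t \<omega> \<le> ennreal c} \<omega> \<partial>P)"

lemma solution_measurable:
  "(\<lambda>p. x (fst p) (snd p)) \<in> borel_measurable (restrict_space lborel {t0..t} \<Otimes>\<^sub>M P)"
proof -
  have x: "case_prod x \<in> borel_measurable (restrict_space lborel {t0..} \<Otimes>\<^sub>M P)"
    using sol unfolding mild_solution_def by blast
  have "(\<lambda>s. s) \<in> measurable (restrict_space lborel {t0..t}) (restrict_space lborel {t0..})"
    by (rule measurable_restrict_space3) auto
  then have "(\<lambda>p. (fst p, snd p)) \<in> measurable (restrict_space lborel {t0..t} \<Otimes>\<^sub>M P) (restrict_space lborel {t0..} \<Otimes>\<^sub>M P)"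
    by (intro measurable_Pair measurable_compose[OF measurable_fst] measurable_snd)
  from measurable_compose[OF this x] show ?thesis by simp
qed

lemma coefficient_measurable:
  fixes H :: "real \<Rightarrow> 'h \<Rightarrow> 'h"
  assumes H: "continuous_on UNIV (\<lambda>(s, y). H s y)"
  shows "(\<lambda>p. H (fst p) (x (fst p) (snd p))) \<in> borel_measurable (restrict_space lborel {t0..t} \<Otimes>\<^sub>M P)"
    and "t0 \<le> s \<Longrightarrow> s \<le> r \<Longrightarrow> (\<lambda>\<omega>. H s (x s \<omega>)) \<in> borel_measurable (BM_filtration P W r)"
proof -
  have H': "continuous_on UNIV (\<lambda>p. H (fst p) (snd p))" using H by (simp add: split_beta')
  have "(\<lambda>s. s) \<in> borel_measurable (restrict_space lborel {t0..t})"
    by (rule measurable_restrict_space1) simp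
  then have "(\<lambda>p. fst p) \<in> borel_measurable (restrict_space lborel {t0..t} \<Otimes>\<^sub>M P)"
    by (rule measurable_compose[OF measurable_fst])
  from borel_measurable_continuous_Pair[OF this solution_measurable H']
  show "(\<lambda>p. H (fst p) (x (fst p) (snd p))) \<in> borel_measurable (restrict_space lborel {t0..t} \<Otimes>\<^sub>M P)" .
  assume s: "t0 \<le> s" "s \<le> r"
  have "x s \<in> borel_measurable (BM_filtration P W s)"
    using sol s(1) unfolding mild_solution_def by blast
  then have "x s \<in> borel_measurable (BM_filtration P W r)"
    by (rule measurable_from_subalg[OF BM_filtration_mono[OF BM s(2)]])
  from borel_measurable_continuous_Pair[OF borel_measurable_const this H']
  show "(\<lambda>\<omega>. H s (x s \<omega>)) \<in> borel_measurable (BM_filtration P W r)" .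
qed

lemma load_measurable:
  "case_prod load \<in> borel_measurable (restrict_space lborel {t0..t} \<Otimes>\<^sub>M P)"
  unfolding load_def split_beta'
  using coefficient_measurable(1)[OF F_cont] coefficient_measurable(1)[OF G_cont] by measurable

lemma load_section:
  "\<omega> \<in> space P \<Longrightarrow> (\<lambda>s. load s \<omega>) \<in> borel_measurable (restrict_space lborel {t0..t})"
  using measurable_compose[OF measurable_Pair2' load_measurable] by simp

lemma clock_adapted:
  "\<exists>X\<in>borel_measurable (BM_filtration P W r). AE \<omega> in P. X \<omega> = clock r \<omega>"
  unfolding clock_def set_nn_integral_restrict
proof (rule AE_nn_integral_adapted[OF finite_measure_lborel_Icc subalgebra_BM_filtration[OF BM] load_measurable])
  fix s assume "s \<in> space (restrict_space lborel {t0..r})"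
  then have s: "t0 \<le> s" "s \<le> r" by (auto simp: space_restrict_space)
  show "load s \<in> borel_measurable (BM_filtration P W r)"
    unfolding load_def
    using coefficient_measurable(2)[OF F_cont s] coefficient_measurable(2)[OF G_cont s] by measurable
qed

lemma clock_mono: "r \<le> s \<Longrightarrow> clock r \<omega> \<le> clock s \<omega>"
  unfolding clock_def by (intro nn_integral_mono) (auto simp: indicator_def)

lemma clock_left:
  "\<omega> \<in> space P \<Longrightarrow> c < clock s \<omega> \<Longrightarrow> \<exists>r. t0 \<le> r \<and> r < s \<and> c < clock r \<omega>"
  unfolding clock_def by (rule nn_integral_Icc_left_continuous[OF load_section order_refl])

text \<open>With the upper limit moved into an indicator, the clock becomes a parametric integral
  over a fixed finite measure space, with an integrand jointly measurable in the limit,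
  \<open>\<omega>\<close> and the integration variable.\<close>

lemma clock_measurable:
  "case_prod clock \<in> borel_measurable (restrict_space lborel {t0..t} \<Otimes>\<^sub>M P)"
proof -
  define L where "L = restrict_space lborel {t0..t}"
  interpret L: finite_measure L unfolding L_def by (rule finite_measure_lborel_Icc)
  have spL: "space L = {t0..t}" by (simp add: L_def space_restrict_space)
  have eq: "clock (fst p) (snd p) = (\<integral>\<^sup>+s. load s (snd p) * indicator {s. s \<le> fst p} s \<partial>L)"
    if "p \<in> space (L \<Otimes>\<^sub>M P)" for p
    unfolding clock_def L_def set_nn_integral_restrict[symmetric]
    using that by (intro nn_integral_cong) (auto simp: spL space_pair_measure indicator_def)
  have id: "(\<lambda>s. s) \<in> borel_measurable L" unfolding L_def by (rule measurable_restrict_space1) simp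
  have f1: "(\<lambda>q. fst (fst q)) \<in> borel_measurable ((L \<Otimes>\<^sub>M P) \<Otimes>\<^sub>M L)"
    by (rule measurable_compose[OF _ id]) measurable
  have f2: "(\<lambda>q. snd q) \<in> borel_measurable ((L \<Otimes>\<^sub>M P) \<Otimes>\<^sub>M L)"
    by (rule measurable_compose[OF measurable_snd id])
  have "(\<lambda>q. (snd q, snd (fst q))) \<in> measurable ((L \<Otimes>\<^sub>M P) \<Otimes>\<^sub>M L) (L \<Otimes>\<^sub>M P)" by measurable
  from measurable_compose[OF this load_measurable[of t, folded L_def]]
  have f3: "(\<lambda>q. load (snd q) (snd (fst q))) \<in> borel_measurable ((L \<Otimes>\<^sub>M P) \<Otimes>\<^sub>M L)" by simp
  have f4: "(\<lambda>q. load (snd q) (snd (fst q)) * (if snd q \<le> fst (fst q) then 1 else 0)) \<in> borel_measurable ((L \<Otimes>\<^sub>M P) \<Otimes>\<^sub>M L)"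
    using f1 f2 f3 by measurable
  have "(\<lambda>p. \<integral>\<^sup>+s. load s (snd p) * indicator {s. s \<le> fst p} s \<partial>L) \<in> borel_measurable (L \<Otimes>\<^sub>M P)"
    by (rule L.borel_measurable_nn_integral) (use f4 in \<open>simp add: split_beta' indicator_def of_bool_def\<close>)
  then have "(\<lambda>p. clock (fst p) (snd p)) \<in> borel_measurable (L \<Otimes>\<^sub>M P)"
    by (subst measurable_cong[OF eq])
  then show ?thesis unfolding L_def by (simp add: split_beta')
qed

lemma clock_measurable_at: "t0 \<le> t \<Longrightarrow> clock t \<in> borel_measurable P"
  using measurable_compose[OF measurable_Pair1' clock_measurable[of t], of t]
  by (simp add: space_restrict_space)

lemma solution_measurable_at: "t0 \<le> t \<Longrightarrow> x t \<in> borel_measurable P"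
  using sol unfolding mild_solution_def
  by (intro measurable_from_subalg[OF subalgebra_BM_filtration[OF BM]]) blast

text \<open>Here the integrability clauses of \<open>mild_solution\<close> enter. They make the
  events \<open>clock t \<omega> \<le> c\<close> exhaust the probability space, up to a null set, as
  \<open>c\<close> grows.\<close>

lemma clock_finite:
  assumes "t0 \<le> t"
  shows "AE \<omega> in P. clock t \<omega> < \<infinity>"
proof -
  have 1: "AE \<omega> in P. set_integrable lborel {t0..t} (\<lambda>s. F s (x s \<omega>))"
    and 2: "AE \<omega> in P. (\<integral>\<^sup>+s\<in>{t0..t}. ennreal ((norm (G s (x s \<omega>)))\<^sup>2) \<partial>lborel) < \<infinity>"
    using sol assms unfolding mild_solution_def by blast+
  from 1 2 AE_space show ?thesis
  proof eventually_elim
    case (elim \<omega>)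
    define L where "L = restrict_space lborel {t0..t}"
    have sect: "(\<lambda>s. H s (x s \<omega>)) \<in> borel_measurable L" if "continuous_on UNIV (\<lambda>(s, y). H s y)" for H :: "real \<Rightarrow> 'h \<Rightarrow> 'h"
      unfolding L_def using measurable_compose[OF measurable_Pair2'[OF elim(3)] coefficient_measurable(1)[OF that]] by simp
    note [measurable] = sect[OF F_cont] sect[OF G_cont]
    have "(\<integral>\<^sup>+s. ennreal (norm (F s (x s \<omega>))) \<partial>L) = (\<integral>\<^sup>+s. ennreal (norm (indicat_real {t0..t} s *\<^sub>R F s (x s \<omega>))) \<partial>lborel)"
      unfolding L_def set_nn_integral_restrict[symmetric] by (intro nn_integral_cong) (auto simp: indicator_def)
    also have "\<dots> < \<infinity>"
      using elim(1) unfolding set_integrable_def by (simp add: integrable_iff_bounded)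
    finally have "(\<integral>\<^sup>+s. ennreal (norm (F s (x s \<omega>))) \<partial>L) < \<infinity>" .
    moreover have "clock t \<omega> = (\<integral>\<^sup>+s. ennreal (norm (F s (x s \<omega>))) \<partial>L) + (\<integral>\<^sup>+s. ennreal ((norm (G s (x s \<omega>)))\<^sup>2) \<partial>L)"
      unfolding clock_def set_nn_integral_restrict load_def L_def[symmetric] by (rule nn_integral_add) measurable
    ultimately show ?case using elim(2) unfolding set_nn_integral_restrict L_def[symmetric] by simp
  qed
qed

section \<open>Bounds for the three terms of the mild formula\<close>

lemma semigroup_le: "0 \<le> s \<Longrightarrow> norm (U s y) \<le> N * exp (- \<nu> * s) * norm y"
  by (rule order_trans[OF norm_blinfun]) (intro mult_right_mono U norm_ge_zero)

text \<open>Squaring doubles the decay rate. One of the two factors is given up, so that the initial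
  term and the noise carry the same kernel that the Cauchy-Schwarz inequality leaves for the
  drift.\<close>

lemma semigroup_sq_le:
  assumes "0 \<le> s"
  shows "(norm (U s y))\<^sup>2 \<le> N\<^sup>2 * exp (- \<nu> * s) * (norm y)\<^sup>2"
proof -
  have "(norm (U s y))\<^sup>2 \<le> (N * exp (- \<nu> * s) * norm y)\<^sup>2"
    by (rule power_mono[OF semigroup_le[OF assms]]) simp
  also have "\<dots> = N\<^sup>2 * (exp (- \<nu> * s))\<^sup>2 * (norm y)\<^sup>2" by (simp add: power_mult_distrib)
  also have "(exp (- \<nu> * s))\<^sup>2 \<le> exp (- \<nu> * s)"
    unfolding power2_eq_square using \<nu> assms by (intro mult_left_le) auto
  finally show ?thesis by (simp add: mult_left_mono mult_right_mono)
qed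


lemma initial_moment_le:
  assumes t: "t0 \<le> t"
  shows "(\<integral>\<^sup>+\<omega>. ennreal ((norm (U (t - t0) (x0 \<omega>)))\<^sup>2) \<partial>P) \<le>
    ennreal (N\<^sup>2 * exp (- \<nu> * (t - t0)) * expectation (\<lambda>\<omega>. (norm (x0 \<omega>))\<^sup>2))"
proof -
  have "(\<integral>\<^sup>+\<omega>. ennreal ((norm (U (t - t0) (x0 \<omega>)))\<^sup>2) \<partial>P) \<le>
      (\<integral>\<^sup>+\<omega>. ennreal (N\<^sup>2 * exp (- \<nu> * (t - t0)) * (norm (x0 \<omega>))\<^sup>2) \<partial>P)"
    using t by (intro nn_integral_mono ennreal_leI semigroup_sq_le) simp
  also have "\<dots> = ennreal (expectation (\<lambda>\<omega>. N\<^sup>2 * exp (- \<nu> * (t - t0)) * (norm (x0 \<omega>))\<^sup>2))"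
    using x0_int by (intro nn_integral_eq_integral integrable_mult_right) auto
  finally show ?thesis by simp
qed

abbreviation (input) drift :: "real \<Rightarrow> 'w \<Rightarrow> 'h" where
  "drift t \<omega> \<equiv> (LINT s:{t0..t}|lborel. U (t - s) (F s (x s \<omega>)))"

lemma drift_le:
  "ennreal (norm (drift t \<omega>)) \<le>
    (\<integral>\<^sup>+s. ennreal (N * exp (- \<nu> * (t - s))) * ennreal (norm (F s (x s \<omega>))) \<partial>restrict_space lborel {t0..t})"
proof -
  have "ennreal (norm (drift t \<omega>)) \<le>
      (\<integral>\<^sup>+s. ennreal (norm (indicat_real {t0..t} s *\<^sub>R U (t - s) (F s (x s \<omega>)))) \<partial>lborel)"
    unfolding set_lebesgue_integral_def by (rule norm_integral_le_nn_integral)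
  also have "\<dots> \<le> (\<integral>\<^sup>+s\<in>{t0..t}. ennreal (N * exp (- \<nu> * (t - s))) * ennreal (norm (F s (x s \<omega>))) \<partial>lborel)"
  proof (intro nn_integral_mono)
    fix s
    show "ennreal (norm (indicat_real {t0..t} s *\<^sub>R U (t - s) (F s (x s \<omega>)))) \<le>
      ennreal (N * exp (- \<nu> * (t - s))) * ennreal (norm (F s (x s \<omega>))) * indicator {t0..t} s"
      using semigroup_le[of "t - s" "F s (x s \<omega>)"] N
      by (auto simp: indicator_def ennreal_mult'[symmetric] intro!: ennreal_leI)
  qed
  finally show ?thesis unfolding set_nn_integral_restrict .
qed

lemma coefficient_section:
  fixes H :: "real \<Rightarrow> 'h \<Rightarrow> 'h"
  assumes "continuous_on UNIV (\<lambda>(s, y). H s y)" "\<omega> \<in> space P"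
  shows "(\<lambda>s. H s (x s \<omega>)) \<in> borel_measurable (restrict_space lborel {t0..t})"
  using measurable_compose[OF measurable_Pair2'[OF assms(2)] coefficient_measurable(1)[OF assms(1)]] by simp

text \<open>The kernel is bounded by \<open>N\<close> and |F| by the load. The resulting bound is
  crude but does not depend on \<open>t\<close>, as the start of the iteration requires.\<close>

lemma drift_bounded:
  assumes \<omega>: "\<omega> \<in> space P" "clock t \<omega> \<le> ennreal c" and c: "0 \<le> c"
  shows "(norm (drift t \<omega>))\<^sup>2 \<le> (N * c)\<^sup>2"
proof -
  have "ennreal (norm (drift t \<omega>)) \<le> (\<integral>\<^sup>+s. ennreal N * load s \<omega> \<partial>restrict_space lborel {t0..t})"
  proof (rule order_trans[OF drift_le nn_integral_mono], rule mult_mono)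
    fix s assume "s \<in> space (restrict_space lborel {t0..t})"
    then have "0 \<le> \<nu> * (t - s)" using \<nu> by (simp add: space_restrict_space)
    then show "ennreal (N * exp (- \<nu> * (t - s))) \<le> ennreal N"
      using N by (intro ennreal_leI mult_left_le) auto
  qed (auto simp: load_def)
  also have "\<dots> = ennreal N * clock t \<omega>"
    unfolding clock_def set_nn_integral_restrict by (rule nn_integral_cmult[OF load_section[OF \<omega>(1)]])
  also have "\<dots> \<le> ennreal N * ennreal c" by (rule mult_left_mono[OF \<omega>(2)]) simp
  also have "\<dots> = ennreal (N * c)" using N c by (simp add: ennreal_mult)
  finally have "norm (drift t \<omega>) \<le> N * c" using N c by simp
  then show ?thesis by (rule power_mono) simp
qed

lemma nn_integral_exp_le:
  "(\<integral>\<^sup>+s. ennreal (exp (- \<nu> * (t - s))) \<partial>restrict_space lborel {t0..t}) \<le> ennreal (1 / \<nu>)"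
proof (cases "t0 \<le> t")
  case True
  have "(\<integral>\<^sup>+s\<in>{t0..t}. ennreal (exp (- \<nu> * (t - s))) \<partial>lborel) =
      ennreal (exp (- \<nu> * (t - t)) / \<nu> - exp (- \<nu> * (t - t0)) / \<nu>)"
    by (rule nn_integral_FTC_Icc) (use \<nu> True in \<open>auto intro!: derivative_eq_intros\<close>)
  also have "\<dots> \<le> ennreal (1 / \<nu>)" using \<nu> by (intro ennreal_leI) simp
  finally show ?thesis unfolding set_nn_integral_restrict .
next
  case False
  then show ?thesis unfolding set_nn_integral_restrict[symmetric] by simp
qed

text \<open>Cauchy-Schwarz with the kernel split evenly into \<open>N * q s\<close> and
  \<open>q s * |F|\<close>, where \<open>q\<close> is the square root of the exponential. The square
  of the first factor has integral at most \<open>N^2 / \<nu>\<close>.\<close>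

lemma drift_sq_le:
  assumes \<omega>: "\<omega> \<in> space P"
  shows "ennreal ((norm (drift t \<omega>))\<^sup>2) \<le> ennreal (N\<^sup>2 / \<nu>) *
    (\<integral>\<^sup>+s. ennreal (exp (- \<nu> * (t - s))) * ennreal ((norm (F s (x s \<omega>)))\<^sup>2) \<partial>restrict_space lborel {t0..t})"
proof -
  let ?L = "restrict_space lborel {t0..t}"
  let ?f = "\<lambda>s. ennreal (N * exp (- \<nu> * (t - s) / 2))"
  let ?g = "\<lambda>s. ennreal (exp (- \<nu> * (t - s) / 2) * norm (F s (x s \<omega>)))"
  note F_sect = coefficient_section[OF F_cont \<omega>, of t]
  have [measurable]: "(\<lambda>s. exp (- \<nu> * (t - s) / 2)) \<in> borel_measurable ?L"
    "(\<lambda>s. exp (- \<nu> * (t - s))) \<in> borel_measurable ?L"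
    by (rule borel_measurable_lborel_Icc, intro continuous_intros, simp?)+
  define q where "q s = exp (- \<nu> * (t - s) / 2)" for s
  have q0: "0 \<le> q s" and half: "exp (- \<nu> * (t - s)) = q s * q s" for s
    by (simp_all add: q_def flip: exp_add)
  have f: "?f \<in> borel_measurable ?L" by measurable
  have g: "?g \<in> borel_measurable ?L" using F_sect by measurable
  have "ennreal ((norm (drift t \<omega>))\<^sup>2) = (ennreal (norm (drift t \<omega>)))\<^sup>2" by (simp add: ennreal_power)
  also have "\<dots> \<le> (\<integral>\<^sup>+s. ennreal (N * exp (- \<nu> * (t - s))) * ennreal (norm (F s (x s \<omega>))) \<partial>?L)\<^sup>2"
    by (rule power_mono[OF drift_le]) simp
  also have "(\<integral>\<^sup>+s. ennreal (N * exp (- \<nu> * (t - s))) * ennreal (norm (F s (x s \<omega>))) \<partial>?L) = (\<integral>\<^sup>+s. ?f s * ?g s \<partial>?L)"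
    unfolding half q_def[symmetric] using N q0
    by (intro nn_integral_cong) (simp add: ennreal_mult'[symmetric] mult.assoc)
  also have "\<dots>\<^sup>2 \<le> (\<integral>\<^sup>+s. ?f s ^ 2 \<partial>?L) * (\<integral>\<^sup>+s. ?g s ^ 2 \<partial>?L)"
    by (rule Cauchy_Schwarz_nn_integral[OF f g])
  also have "(\<integral>\<^sup>+s. ?f s ^ 2 \<partial>?L) = (\<integral>\<^sup>+s. ennreal (N\<^sup>2) * ennreal (exp (- \<nu> * (t - s))) \<partial>?L)"
    unfolding half q_def[symmetric] using N q0
    by (intro nn_integral_cong) (simp add: ennreal_mult'[symmetric] ennreal_power power2_eq_square ac_simps)
  also have "\<dots> = ennreal (N\<^sup>2) * (\<integral>\<^sup>+s. ennreal (exp (- \<nu> * (t - s))) \<partial>?L)"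
    by (rule nn_integral_cmult) measurable
  also have "(\<integral>\<^sup>+s. ?g s ^ 2 \<partial>?L) =
      (\<integral>\<^sup>+s. ennreal (exp (- \<nu> * (t - s))) * ennreal ((norm (F s (x s \<omega>)))\<^sup>2) \<partial>?L)"
    unfolding half q_def[symmetric] using q0
    by (intro nn_integral_cong) (simp add: ennreal_mult'[symmetric] ennreal_power power2_eq_square ac_simps)
  also have "ennreal (N\<^sup>2) * (\<integral>\<^sup>+s. ennreal (exp (- \<nu> * (t - s))) \<partial>?L) * (\<integral>\<^sup>+s. ennreal (exp (- \<nu> * (t - s))) * ennreal ((norm (F s (x s \<omega>)))\<^sup>2) \<partial>?L)
     \<le> ennreal (N\<^sup>2) * ennreal (1 / \<nu>) * (\<integral>\<^sup>+s. ennreal (exp (- \<nu> * (t - s))) * ennreal ((norm (F s (x s \<omega>)))\<^sup>2) \<partial>?L)"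
    by (intro mult_right_mono mult_left_mono nn_integral_exp_le) auto
  also have "ennreal (N\<^sup>2) * ennreal (1 / \<nu>) = ennreal (N\<^sup>2 / \<nu>)"
    using \<nu> by (simp flip: ennreal_mult')
  finally show ?thesis .
qed

lemma stopped_coefficient_moment:
  fixes H :: "real \<Rightarrow> 'h \<Rightarrow> 'h"
  assumes H: "\<And>s y. norm (H s y) \<le> A\<^sub>0 + M * norm y" and s: "t0 \<le> s"
  shows "(\<integral>\<^sup>+\<omega>. ennreal ((norm (H s (x s \<omega>)))\<^sup>2) * indicator {\<omega>. clock s \<omega> \<le> ennreal c} \<omega> \<partial>P) \<le>
    ennreal (2 * A\<^sub>0\<^sup>2) + ennreal (2 * M\<^sup>2) * stopped_moment c s"
proof -
  let ?I = "\<lambda>\<omega>. indicator {\<omega>. clock s \<omega> \<le> ennreal c} \<omega> :: ennreal"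
  note [measurable] = clock_measurable_at[OF s] solution_measurable_at[OF s]
  have sq: "(norm (H s y))\<^sup>2 \<le> 2 * A\<^sub>0\<^sup>2 + 2 * M\<^sup>2 * (norm y)\<^sup>2" for y
  proof -
    have "(norm (H s y))\<^sup>2 \<le> (A\<^sub>0 + M * norm y)\<^sup>2" by (rule power_mono[OF H]) simp
    also have "\<dots> \<le> 2 * A\<^sub>0\<^sup>2 + 2 * M\<^sup>2 * (norm y)\<^sup>2"
      using sum_squares_bound[of A\<^sub>0 "M * norm y"] by (simp add: power2_sum power_mult_distrib)
    finally show ?thesis .
  qed
  have "(\<integral>\<^sup>+\<omega>. ennreal ((norm (H s (x s \<omega>)))\<^sup>2) * ?I \<omega> \<partial>P) \<le>
      (\<integral>\<^sup>+\<omega>. ennreal (2 * A\<^sub>0\<^sup>2) + ennreal (2 * M\<^sup>2) * (ennreal ((norm (x s \<omega>))\<^sup>2) * ?I \<omega>) \<partial>P)"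
  proof (rule nn_integral_mono)
    fix \<omega>
    have "ennreal ((norm (H s (x s \<omega>)))\<^sup>2) \<le> ennreal (2 * A\<^sub>0\<^sup>2) + ennreal (2 * M\<^sup>2) * ennreal ((norm (x s \<omega>))\<^sup>2)"
      using ennreal_leI[OF sq[of "x s \<omega>"]] by (simp add: ennreal_mult')
    then show "ennreal ((norm (H s (x s \<omega>)))\<^sup>2) * ?I \<omega> \<le>
        ennreal (2 * A\<^sub>0\<^sup>2) + ennreal (2 * M\<^sup>2) * (ennreal ((norm (x s \<omega>))\<^sup>2) * ?I \<omega>)"
      by (simp add: indicator_def)
  qed
  also have "\<dots> = (\<integral>\<^sup>+\<omega>. ennreal (2 * A\<^sub>0\<^sup>2) \<partial>P) + ennreal (2 * M\<^sup>2) * stopped_moment c s"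
    unfolding stopped_moment_def by (subst nn_integral_add; (subst nn_integral_cmult)?; measurable)
  finally show ?thesis by (simp add: emeasure_space_1)
qed

text \<open>The indicator is taken at the integration time \<open>s\<close>, not at
  \<open>t\<close>, so that exchanging the integrals produces
  \<open>stopped_moment c s\<close>.\<close>

definition stopped_energy :: "(real \<Rightarrow> 'h \<Rightarrow> 'h) \<Rightarrow> real \<Rightarrow> real \<Rightarrow> 'w \<Rightarrow> ennreal" where
  "stopped_energy H c t \<omega> = (\<integral>\<^sup>+s. ennreal (exp (- \<nu> * (t - s))) *
     (ennreal ((norm (H s (x s \<omega>)))\<^sup>2) * indicator {\<omega>. clock s \<omega> \<le> ennreal c} \<omega>) \<partial>restrict_space lborel {t0..t})"

lemma stopped_energy_moment:
  fixes H :: "real \<Rightarrow> 'h \<Rightarrow> 'h"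
  assumes H_cont: "continuous_on UNIV (\<lambda>(s, y). H s y)"
    and H: "\<And>s y. norm (H s y) \<le> A\<^sub>0 + M * norm y"
  shows "stopped_energy H c t \<in> borel_measurable P"
    and "(\<integral>\<^sup>+\<omega>. stopped_energy H c t \<omega> \<partial>P) \<le>
    (\<integral>\<^sup>+s. ennreal (exp (- \<nu> * (t - s))) * (ennreal (2 * A\<^sub>0\<^sup>2) + ennreal (2 * M\<^sup>2) * stopped_moment c s)
       \<partial>restrict_space lborel {t0..t})"
proof -
  let ?L = "restrict_space lborel {t0..t}"
  interpret L: finite_measure ?L by (rule finite_measure_lborel_Icc)
  interpret LP: pair_sigma_finite ?L P ..
  have e: "(\<lambda>s. exp (- \<nu> * (t - s))) \<in> borel_measurable ?L"
    by (intro borel_measurable_lborel_Icc continuous_intros)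
  note [measurable] = coefficient_measurable(1)[OF H_cont, of t] clock_measurable[of t, unfolded split_beta']
    measurable_compose[OF measurable_fst e]
  have "(\<lambda>p. ennreal (exp (- \<nu> * (t - fst p))) * (ennreal ((norm (H (fst p) (x (fst p) (snd p))))\<^sup>2) *
      (if clock (fst p) (snd p) \<le> ennreal c then 1 else 0))) \<in> borel_measurable (?L \<Otimes>\<^sub>M P)"
    by measurable
  then have meas: "(\<lambda>(s, \<omega>). ennreal (exp (- \<nu> * (t - s))) * (ennreal ((norm (H s (x s \<omega>)))\<^sup>2) *
      indicator {\<omega>. clock s \<omega> \<le> ennreal c} \<omega>)) \<in> borel_measurable (?L \<Otimes>\<^sub>M P)"
    by (simp add: split_beta' indicator_def of_bool_def)
  from measurable_pair_swap[OF meas]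
  show "stopped_energy H c t \<in> borel_measurable P"
    unfolding stopped_energy_def[abs_def] by (intro L.borel_measurable_nn_integral) simp
  have "(\<integral>\<^sup>+\<omega>. stopped_energy H c t \<omega> \<partial>P) =
      (\<integral>\<^sup>+s. (\<integral>\<^sup>+\<omega>. ennreal (exp (- \<nu> * (t - s))) * (ennreal ((norm (H s (x s \<omega>)))\<^sup>2) *
        indicator {\<omega>. clock s \<omega> \<le> ennreal c} \<omega>) \<partial>P) \<partial>?L)"
    unfolding stopped_energy_def by (rule LP.Fubini'[OF meas])
  also have "\<dots> \<le> (\<integral>\<^sup>+s. ennreal (exp (- \<nu> * (t - s))) * (ennreal (2 * A\<^sub>0\<^sup>2) + ennreal (2 * M\<^sup>2) * stopped_moment c s) \<partial>?L)"
  proof (rule nn_integral_mono)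
    fix s assume "s \<in> space ?L"
    then have s: "t0 \<le> s" by (simp add: space_restrict_space)
    note [measurable] = clock_measurable_at[OF s]
    have [measurable]: "(\<lambda>\<omega>. H s (x s \<omega>)) \<in> borel_measurable P"
      by (rule measurable_from_subalg[OF subalgebra_BM_filtration[OF BM] coefficient_measurable(2)[OF H_cont s order_refl]])
    have "(\<integral>\<^sup>+\<omega>. ennreal (exp (- \<nu> * (t - s))) * (ennreal ((norm (H s (x s \<omega>)))\<^sup>2) *
        indicator {\<omega>. clock s \<omega> \<le> ennreal c} \<omega>) \<partial>P) =
      ennreal (exp (- \<nu> * (t - s))) * (\<integral>\<^sup>+\<omega>. ennreal ((norm (H s (x s \<omega>)))\<^sup>2) *
        indicator {\<omega>. clock s \<omega> \<le> ennreal c} \<omega> \<partial>P)"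
      by (rule nn_integral_cmult) measurable
    also have "\<dots> \<le> ennreal (exp (- \<nu> * (t - s))) * (ennreal (2 * A\<^sub>0\<^sup>2) + ennreal (2 * M\<^sup>2) * stopped_moment c s)"
      by (intro mult_left_mono stopped_coefficient_moment H s) simp
    finally show "(\<integral>\<^sup>+\<omega>. ennreal (exp (- \<nu> * (t - s))) * (ennreal ((norm (H s (x s \<omega>)))\<^sup>2) *
        indicator {\<omega>. clock s \<omega> \<le> ennreal c} \<omega>) \<partial>P) \<le>
      ennreal (exp (- \<nu> * (t - s))) * (ennreal (2 * A\<^sub>0\<^sup>2) + ennreal (2 * M\<^sup>2) * stopped_moment c s)" .
  qed
  finally show "(\<integral>\<^sup>+\<omega>. stopped_energy H c t \<omega> \<partial>P) \<le>
    (\<integral>\<^sup>+s. ennreal (exp (- \<nu> * (t - s))) * (ennreal (2 * A\<^sub>0\<^sup>2) + ennreal (2 * M\<^sup>2) * stopped_moment c s) \<partial>?L)" .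
qed

lemma solution_decomposition:
  assumes t: "t0 \<le> t"
  shows "\<exists>Y V. has_Ito_integral P (BM_filtration P W) W (\<lambda>s \<omega>. U (t - s) (G s (x s \<omega>))) t0 t Y \<and>
    V \<in> borel_measurable P \<and> (AE \<omega> in P. V \<omega> = drift t \<omega>) \<and>
    (\<forall>c. stopped_moment c t \<le> ennreal 3 * (\<integral>\<^sup>+\<omega>. ennreal ((norm (U (t - t0) (x0 \<omega>)))\<^sup>2) \<partial>P) +
      ennreal 3 * (\<integral>\<^sup>+\<omega>. ennreal ((norm (V \<omega>))\<^sup>2) * indicator {\<omega>. clock t \<omega> \<le> ennreal c} \<omega> \<partial>P) +
      ennreal 3 * (\<integral>\<^sup>+\<omega>. ennreal ((norm (Y \<omega>))\<^sup>2) * indicator {\<omega>. clock t \<omega> \<le> ennreal c} \<omega> \<partial>P))"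
proof -
  obtain Y where I: "has_Ito_integral P (BM_filtration P W) W (\<lambda>s \<omega>. U (t - s) (G s (x s \<omega>))) t0 t Y"
    and eq: "AE \<omega> in P. x t \<omega> = U (t - t0) (x0 \<omega>) + drift t \<omega> + Y \<omega>"
    using sol t unfolding mild_solution_def by blast
  have [measurable]: "Y \<in> borel_measurable P" using I unfolding has_Ito_integral_def by blast
  have "x0 \<in> borel_measurable (BM_filtration P W t0)" using sol unfolding mild_solution_def by blast
  then have "x0 \<in> borel_measurable P" by (rule measurable_from_subalg[OF subalgebra_BM_filtration[OF BM]])
  moreover have "blinfun_apply (U (t - t0)) \<in> borel_measurable borel"
    by (intro borel_measurable_continuous_onI linear_continuous_on blinfun.bounded_linear_right)
  ultimately have Ux0 [measurable]: "(\<lambda>\<omega>. U (t - t0) (x0 \<omega>)) \<in> borel_measurable P" by (rule measurable_compose)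
  note [measurable] = clock_measurable_at[OF t] solution_measurable_at[OF t]
  \<comment> \<open>Measurability of the drift in \<open>\<omega>\<close> is not at hand. As the
    remainder of the equation, \<open>V\<close> is measurable, equals the drift almost surely, and
    makes the decomposition of \<open>x t\<close> hold at every \<open>\<omega>\<close>.\<close>
  define V where "V \<omega> = x t \<omega> - U (t - t0) (x0 \<omega>) - Y \<omega>" for \<omega>
  have [measurable]: "V \<in> borel_measurable P" unfolding V_def[abs_def] by measurable
  have V: "AE \<omega> in P. V \<omega> = drift t \<omega>" using eq by eventually_elim (simp add: V_def)
  have "stopped_moment c t \<le> ennreal 3 * (\<integral>\<^sup>+\<omega>. ennreal ((norm (U (t - t0) (x0 \<omega>)))\<^sup>2) \<partial>P) +
      ennreal 3 * (\<integral>\<^sup>+\<omega>. ennreal ((norm (V \<omega>))\<^sup>2) * indicator {\<omega>. clock t \<omega> \<le> ennreal c} \<omega> \<partial>P) +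
      ennreal 3 * (\<integral>\<^sup>+\<omega>. ennreal ((norm (Y \<omega>))\<^sup>2) * indicator {\<omega>. clock t \<omega> \<le> ennreal c} \<omega> \<partial>P)" for c
  proof -
    let ?I = "\<lambda>\<omega>. indicator {\<omega>. clock t \<omega> \<le> ennreal c} \<omega> :: ennreal"
    have "stopped_moment c t \<le> (\<integral>\<^sup>+\<omega>. ennreal 3 * ennreal ((norm (U (t - t0) (x0 \<omega>)))\<^sup>2) +
        ennreal 3 * (ennreal ((norm (V \<omega>))\<^sup>2) * ?I \<omega>) + ennreal 3 * (ennreal ((norm (Y \<omega>))\<^sup>2) * ?I \<omega>) \<partial>P)"
      unfolding stopped_moment_def
    proof (rule nn_integral_mono)
      fix \<omega>
      have "x t \<omega> = U (t - t0) (x0 \<omega>) + V \<omega> + Y \<omega>" by (simp add: V_def)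
      then have "ennreal ((norm (x t \<omega>))\<^sup>2) \<le> ennreal (3 * (norm (U (t - t0) (x0 \<omega>)))\<^sup>2 + 3 * (norm (V \<omega>))\<^sup>2 + 3 * (norm (Y \<omega>))\<^sup>2)"
        by (intro ennreal_leI) (simp only: norm_add3_sq_le)
      also have "\<dots> = ennreal 3 * ennreal ((norm (U (t - t0) (x0 \<omega>)))\<^sup>2) +
        ennreal 3 * ennreal ((norm (V \<omega>))\<^sup>2) + ennreal 3 * ennreal ((norm (Y \<omega>))\<^sup>2)"
        by (simp add: ennreal_mult')
      finally show "ennreal ((norm (x t \<omega>))\<^sup>2) * ?I \<omega> \<le> ennreal 3 * ennreal ((norm (U (t - t0) (x0 \<omega>)))\<^sup>2) +
        ennreal 3 * (ennreal ((norm (V \<omega>))\<^sup>2) * ?I \<omega>) + ennreal 3 * (ennreal ((norm (Y \<omega>))\<^sup>2) * ?I \<omega>)"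
        by (simp add: indicator_def)
    qed
    also have "\<dots> = ennreal 3 * (\<integral>\<^sup>+\<omega>. ennreal ((norm (U (t - t0) (x0 \<omega>)))\<^sup>2) \<partial>P) +
        ennreal 3 * (\<integral>\<^sup>+\<omega>. ennreal ((norm (V \<omega>))\<^sup>2) * ?I \<omega> \<partial>P) +
        ennreal 3 * (\<integral>\<^sup>+\<omega>. ennreal ((norm (Y \<omega>))\<^sup>2) * ?I \<omega> \<partial>P)"
      by (subst nn_integral_add, measurable, subst nn_integral_add, measurable,
          subst nn_integral_cmult, measurable, subst nn_integral_cmult, measurable,
          subst nn_integral_cmult, measurable)
    finally show ?thesis .
  qed
  then show ?thesis using I V by (intro exI[of _ Y] exI[of _ V]) simp
qed

text \<open>The first bound is uniform in \<open>t\<close> and only secures finiteness; the second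
  enters the recursion. The constant \<open>N^2 * c\<close> comes from |U G|^2 \<le> N^2 |G|^2 and
  \<integral> |G|^2 \<le> clock t \<le> c, and the added 1 is the slack of the stopping
  argument.\<close>

lemma stopped_diffusion_moment:
  assumes t: "t0 \<le> t" and c: "0 \<le> c"
    and I: "has_Ito_integral P (BM_filtration P W) W (\<lambda>s \<omega>. U (t - s) (G s (x s \<omega>))) t0 t Y"
  shows "(\<integral>\<^sup>+\<omega>. ennreal ((norm (Y \<omega>))\<^sup>2) * indicator {\<omega>. clock t \<omega> \<le> ennreal c} \<omega> \<partial>P) \<le> ennreal (N\<^sup>2 * c + 1)"
    and "(\<integral>\<^sup>+\<omega>. ennreal ((norm (Y \<omega>))\<^sup>2) * indicator {\<omega>. clock t \<omega> \<le> ennreal c} \<omega> \<partial>P) \<le>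
      (\<integral>\<^sup>+\<omega>. ennreal (N\<^sup>2) * stopped_energy G c t \<omega> \<partial>P)"
proof -
  let ?L = "restrict_space lborel {t0..t}"
  have K0: "0 \<le> N\<^sup>2 * c" using c by simp
  have K: "AE \<omega> in P. clock t \<omega> \<le> ennreal c \<longrightarrow>
      (\<integral>\<^sup>+s\<in>{t0..t}. ennreal ((norm (U (t - s) (G s (x s \<omega>))))\<^sup>2) \<partial>lborel) \<le> ennreal (N\<^sup>2 * c)"
  proof (rule AE_I2, rule impI)
    fix \<omega> assume \<omega>: "\<omega> \<in> space P" "clock t \<omega> \<le> ennreal c"
    have "(\<integral>\<^sup>+s. ennreal ((norm (U (t - s) (G s (x s \<omega>))))\<^sup>2) \<partial>?L) \<le> (\<integral>\<^sup>+s. ennreal (N\<^sup>2) * load s \<omega> \<partial>?L)"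
    proof (rule nn_integral_mono)
      fix s assume "s \<in> space ?L"
      then have s: "0 \<le> t - s" by (simp add: space_restrict_space)
      have "(norm (U (t - s) (G s (x s \<omega>))))\<^sup>2 \<le> N\<^sup>2 * exp (- \<nu> * (t - s)) * (norm (G s (x s \<omega>)))\<^sup>2"
        by (rule semigroup_sq_le[OF s])
      also have "\<dots> \<le> N\<^sup>2 * 1 * (norm (G s (x s \<omega>)))\<^sup>2"
        using s \<nu> by (intro mult_right_mono mult_left_mono) auto
      finally have "ennreal ((norm (U (t - s) (G s (x s \<omega>))))\<^sup>2) \<le> ennreal (N\<^sup>2) * ennreal ((norm (G s (x s \<omega>)))\<^sup>2)"
        by (simp add: ennreal_leI flip: ennreal_mult')
      also have "\<dots> \<le> ennreal (N\<^sup>2) * load s \<omega>"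
        unfolding load_def by (intro mult_left_mono) auto
      finally show "ennreal ((norm (U (t - s) (G s (x s \<omega>))))\<^sup>2) \<le> ennreal (N\<^sup>2) * load s \<omega>" .
    qed
    also have "\<dots> = ennreal (N\<^sup>2) * clock t \<omega>"
      unfolding clock_def set_nn_integral_restrict by (rule nn_integral_cmult[OF load_section[OF \<omega>(1)]])
    also have "\<dots> \<le> ennreal (N\<^sup>2) * ennreal c" by (rule mult_left_mono[OF \<omega>(2)]) simp
    also have "\<dots> = ennreal (N\<^sup>2 * c)" using c by (simp add: ennreal_mult)
    finally show "(\<integral>\<^sup>+s\<in>{t0..t}. ennreal ((norm (U (t - s) (G s (x s \<omega>))))\<^sup>2) \<partial>lborel) \<le> ennreal (N\<^sup>2 * c)"
      unfolding set_nn_integral_restrict .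
  qed
  note stopped = Ito_stopped_second_moment[OF BM I t clock_adapted clock_mono clock_left clock_measurable K0 K]
  show "(\<integral>\<^sup>+\<omega>. ennreal ((norm (Y \<omega>))\<^sup>2) * indicator {\<omega>. clock t \<omega> \<le> ennreal c} \<omega> \<partial>P) \<le> ennreal (N\<^sup>2 * c + 1)"
    by (rule stopped(2))
  have "(\<integral>\<^sup>+\<omega>. ennreal ((norm (Y \<omega>))\<^sup>2) * indicator {\<omega>. clock t \<omega> \<le> ennreal c} \<omega> \<partial>P) \<le>
      (\<integral>\<^sup>+\<omega>. (\<integral>\<^sup>+s. ennreal ((norm (U (t - s) (G s (x s \<omega>))))\<^sup>2) * indicator {s. clock s \<omega> \<le> ennreal c} s \<partial>?L) \<partial>P)"
    by (rule stopped(1))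
  also have "\<dots> \<le> (\<integral>\<^sup>+\<omega>. ennreal (N\<^sup>2) * stopped_energy G c t \<omega> \<partial>P)"
  proof (rule nn_integral_mono)
    fix \<omega> assume \<omega>: "\<omega> \<in> space P"
    have e: "(\<lambda>s. exp (- \<nu> * (t - s))) \<in> borel_measurable ?L"
      by (intro borel_measurable_lborel_Icc continuous_intros)
    have clock_sect: "(\<lambda>s. clock s \<omega>) \<in> borel_measurable ?L"
      using measurable_compose[OF measurable_Pair2'[OF \<omega>] clock_measurable] by simp
    have "(\<integral>\<^sup>+s. ennreal ((norm (U (t - s) (G s (x s \<omega>))))\<^sup>2) * indicator {s. clock s \<omega> \<le> ennreal c} s \<partial>?L) \<le>
      (\<integral>\<^sup>+s. ennreal (N\<^sup>2) * (ennreal (exp (- \<nu> * (t - s))) *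
        (ennreal ((norm (G s (x s \<omega>)))\<^sup>2) * (if clock s \<omega> \<le> ennreal c then 1 else 0))) \<partial>?L)"
    proof (rule nn_integral_mono)
      fix s assume "s \<in> space ?L"
      then have s: "0 \<le> t - s" by (simp add: space_restrict_space)
      show "ennreal ((norm (U (t - s) (G s (x s \<omega>))))\<^sup>2) * indicator {s. clock s \<omega> \<le> ennreal c} s \<le>
        ennreal (N\<^sup>2) * (ennreal (exp (- \<nu> * (t - s))) *
        (ennreal ((norm (G s (x s \<omega>)))\<^sup>2) * (if clock s \<omega> \<le> ennreal c then 1 else 0)))"
        using ennreal_leI[OF semigroup_sq_le[OF s, of "G s (x s \<omega>)"]]
        by (simp add: indicator_def ennreal_mult' mult.assoc)
    qed
    also have "\<dots> = ennreal (N\<^sup>2) * (\<integral>\<^sup>+s. ennreal (exp (- \<nu> * (t - s))) *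
        (ennreal ((norm (G s (x s \<omega>)))\<^sup>2) * (if clock s \<omega> \<le> ennreal c then 1 else 0)) \<partial>?L)"
      by (rule nn_integral_cmult) (use e clock_sect coefficient_section[OF G_cont \<omega>, of t] in measurable)
    also have "\<dots> = ennreal (N\<^sup>2) * stopped_energy G c t \<omega>"
      unfolding stopped_energy_def by (simp add: indicator_def of_bool_def)
    finally show "(\<integral>\<^sup>+s. ennreal ((norm (U (t - s) (G s (x s \<omega>))))\<^sup>2) * indicator {s. clock s \<omega> \<le> ennreal c} s \<partial>?L) \<le>
      ennreal (N\<^sup>2) * stopped_energy G c t \<omega>" .
  qed
  finally show "(\<integral>\<^sup>+\<omega>. ennreal ((norm (Y \<omega>))\<^sup>2) * indicator {\<omega>. clock t \<omega> \<le> ennreal c} \<omega> \<partial>P) \<le>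
      (\<integral>\<^sup>+\<omega>. ennreal (N\<^sup>2) * stopped_energy G c t \<omega> \<partial>P)" .
qed

text \<open>As the clock increases, the event at time \<open>t\<close> is contained in the event at
  each earlier \<open>s\<close>, so the indicator can be moved under the integral.\<close>

lemma stopped_drift_sq_le:
  assumes \<omega>: "\<omega> \<in> space P"
  shows "ennreal ((norm (drift t \<omega>))\<^sup>2) * indicator {\<omega>. clock t \<omega> \<le> ennreal c} \<omega> \<le>
    ennreal (N\<^sup>2 / \<nu>) * stopped_energy F c t \<omega>"
proof (cases "clock t \<omega> \<le> ennreal c")
  case True
  then have "clock s \<omega> \<le> ennreal c" if "s \<in> space (restrict_space lborel {t0..t})" for s
    using that order_trans[OF clock_mono[of s t \<omega>]] by (simp add: space_restrict_space)
  then have "stopped_energy F c t \<omega> = (\<integral>\<^sup>+s. ennreal (exp (- \<nu> * (t - s))) *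
      ennreal ((norm (F s (x s \<omega>)))\<^sup>2) \<partial>restrict_space lborel {t0..t})"
    unfolding stopped_energy_def by (intro nn_integral_cong) (simp add: indicator_def)
  then show ?thesis using drift_sq_le[OF \<omega>, of t] True by (simp add: indicator_def)
qed simp

abbreviation (input) initial_energy :: real where
  "initial_energy \<equiv> expectation (\<lambda>\<omega>. (norm (x0 \<omega>))\<^sup>2)"

text \<open>Only finiteness and uniformity in \<open>t\<close> matter: the contraction will multiply
  this bound by powers of a number below 1.\<close>

lemma stopped_moment_bounded:
  assumes t: "t0 \<le> t" and c: "0 \<le> c"
  shows "stopped_moment c t \<le> ennreal (3 * N\<^sup>2 * initial_energy + 3 * (N * c)\<^sup>2 + 3 * (N\<^sup>2 * c + 1))"
proof -
  obtain Y V where I: "has_Ito_integral P (BM_filtration P W) W (\<lambda>s \<omega>. U (t - s) (G s (x s \<omega>))) t0 t Y"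
    and V: "AE \<omega> in P. V \<omega> = drift t \<omega>"
    and le: "stopped_moment c t \<le> ennreal 3 * (\<integral>\<^sup>+\<omega>. ennreal ((norm (U (t - t0) (x0 \<omega>)))\<^sup>2) \<partial>P) +
      ennreal 3 * (\<integral>\<^sup>+\<omega>. ennreal ((norm (V \<omega>))\<^sup>2) * indicator {\<omega>. clock t \<omega> \<le> ennreal c} \<omega> \<partial>P) +
      ennreal 3 * (\<integral>\<^sup>+\<omega>. ennreal ((norm (Y \<omega>))\<^sup>2) * indicator {\<omega>. clock t \<omega> \<le> ennreal c} \<omega> \<partial>P)"
    using solution_decomposition[OF t] by blast
  have "(\<integral>\<^sup>+\<omega>. ennreal ((norm (V \<omega>))\<^sup>2) * indicator {\<omega>. clock t \<omega> \<le> ennreal c} \<omega> \<partial>P) \<le>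
      (\<integral>\<^sup>+\<omega>. ennreal ((N * c)\<^sup>2) \<partial>P)"
  proof (rule nn_integral_mono_AE)
    show "AE \<omega> in P. ennreal ((norm (V \<omega>))\<^sup>2) * indicator {\<omega>. clock t \<omega> \<le> ennreal c} \<omega> \<le> ennreal ((N * c)\<^sup>2)"
      using V AE_space
    proof eventually_elim
      case (elim \<omega>)
      then show ?case using drift_bounded[OF elim(2) _ c, of t] by (auto simp: indicator_def intro!: ennreal_leI)
    qed
  qed
  then have V_le: "(\<integral>\<^sup>+\<omega>. ennreal ((norm (V \<omega>))\<^sup>2) * indicator {\<omega>. clock t \<omega> \<le> ennreal c} \<omega> \<partial>P) \<le> ennreal ((N * c)\<^sup>2)"
    by (simp add: emeasure_space_1)
  have E0: "0 \<le> initial_energy" by (rule Bochner_Integration.integral_nonneg) simp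
  have "N\<^sup>2 * exp (- \<nu> * (t - t0)) * initial_energy \<le> N\<^sup>2 * 1 * initial_energy"
    using t \<nu> E0 by (intro mult_right_mono mult_left_mono) auto
  then have U_le: "(\<integral>\<^sup>+\<omega>. ennreal ((norm (U (t - t0) (x0 \<omega>)))\<^sup>2) \<partial>P) \<le> ennreal (N\<^sup>2 * initial_energy)"
    using order_trans[OF initial_moment_le[OF t] ennreal_leI] by simp
  have "stopped_moment c t \<le> ennreal 3 * ennreal (N\<^sup>2 * initial_energy) + ennreal 3 * ennreal ((N * c)\<^sup>2) +
      ennreal 3 * ennreal (N\<^sup>2 * c + 1)"
    by (intro order_trans[OF le] add_mono mult_left_mono U_le V_le stopped_diffusion_moment(1)[OF t c I]) auto
  also have "\<dots> = ennreal (3 * (N\<^sup>2 * initial_energy)) + ennreal (3 * (N * c)\<^sup>2) + ennreal (3 * (N\<^sup>2 * c + 1))"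
    by (simp only: ennreal_mult'[symmetric])
  also have "\<dots> = ennreal (3 * (N\<^sup>2 * initial_energy) + 3 * (N * c)\<^sup>2 + 3 * (N\<^sup>2 * c + 1))"
    using E0 c by (subst ennreal_plus[symmetric]; (subst ennreal_plus[symmetric])?; simp)
  finally show ?thesis by (simp add: mult.assoc)
qed

lemma stopped_moment_recursive:
  assumes t: "t0 \<le> t" and c: "0 \<le> c"
  shows "stopped_moment c t \<le> ennreal (3 * N\<^sup>2 * exp (- \<nu> * (t - t0)) * initial_energy) +
    ennreal (3 * N\<^sup>2 * (1 + 1 / \<nu>)) *
    (\<integral>\<^sup>+s. ennreal (exp (- \<nu> * (t - s))) * (ennreal (2 * A\<^sub>0\<^sup>2) + ennreal (2 * M\<^sup>2) * stopped_moment c s)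
       \<partial>restrict_space lborel {t0..t})" (is "_ \<le> _ + _ * ?Wt")
proof -
  obtain Y V where I: "has_Ito_integral P (BM_filtration P W) W (\<lambda>s \<omega>. U (t - s) (G s (x s \<omega>))) t0 t Y"
    and V: "AE \<omega> in P. V \<omega> = drift t \<omega>"
    and le: "stopped_moment c t \<le> ennreal 3 * (\<integral>\<^sup>+\<omega>. ennreal ((norm (U (t - t0) (x0 \<omega>)))\<^sup>2) \<partial>P) +
      ennreal 3 * (\<integral>\<^sup>+\<omega>. ennreal ((norm (V \<omega>))\<^sup>2) * indicator {\<omega>. clock t \<omega> \<le> ennreal c} \<omega> \<partial>P) +
      ennreal 3 * (\<integral>\<^sup>+\<omega>. ennreal ((norm (Y \<omega>))\<^sup>2) * indicator {\<omega>. clock t \<omega> \<le> ennreal c} \<omega> \<partial>P)"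
    using solution_decomposition[OF t] by blast
  have energy: "(\<integral>\<^sup>+\<omega>. ennreal k * stopped_energy H c t \<omega> \<partial>P) \<le> ennreal k * ?Wt"
    if "continuous_on UNIV (\<lambda>(s, y). H s y)" "\<And>s y. norm (H s y) \<le> A\<^sub>0 + M * norm y"
    for k and H :: "real \<Rightarrow> 'h \<Rightarrow> 'h"
    unfolding nn_integral_cmult[OF stopped_energy_moment(1)[OF that]]
    by (intro mult_left_mono stopped_energy_moment(2)[OF that]) simp
  have "(\<integral>\<^sup>+\<omega>. ennreal ((norm (V \<omega>))\<^sup>2) * indicator {\<omega>. clock t \<omega> \<le> ennreal c} \<omega> \<partial>P) \<le>
      (\<integral>\<^sup>+\<omega>. ennreal (N\<^sup>2 / \<nu>) * stopped_energy F c t \<omega> \<partial>P)"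
  proof (rule nn_integral_mono_AE)
    show "AE \<omega> in P. ennreal ((norm (V \<omega>))\<^sup>2) * indicator {\<omega>. clock t \<omega> \<le> ennreal c} \<omega> \<le>
        ennreal (N\<^sup>2 / \<nu>) * stopped_energy F c t \<omega>"
      using V AE_space by eventually_elim (simp only: stopped_drift_sq_le)
  qed
  also have "\<dots> \<le> ennreal (N\<^sup>2 / \<nu>) * ?Wt" by (rule energy[OF F_cont F_le])
  finally have V_le: "(\<integral>\<^sup>+\<omega>. ennreal ((norm (V \<omega>))\<^sup>2) * indicator {\<omega>. clock t \<omega> \<le> ennreal c} \<omega> \<partial>P) \<le> ennreal (N\<^sup>2 / \<nu>) * ?Wt" .
  have Y_le: "(\<integral>\<^sup>+\<omega>. ennreal ((norm (Y \<omega>))\<^sup>2) * indicator {\<omega>. clock t \<omega> \<le> ennreal c} \<omega> \<partial>P) \<le> ennreal (N\<^sup>2) * ?Wt"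
    by (rule order_trans[OF stopped_diffusion_moment(2)[OF t c I] energy[OF G_cont G_le]])
  have "stopped_moment c t \<le> ennreal 3 * ennreal (N\<^sup>2 * exp (- \<nu> * (t - t0)) * initial_energy) +
      ennreal 3 * (ennreal (N\<^sup>2 / \<nu>) * ?Wt) + ennreal 3 * (ennreal (N\<^sup>2) * ?Wt)"
    by (intro order_trans[OF le] add_mono mult_left_mono initial_moment_le[OF t] V_le Y_le) auto
  also have "\<dots> = ennreal (3 * (N\<^sup>2 * exp (- \<nu> * (t - t0)) * initial_energy)) +
      (ennreal (3 * (N\<^sup>2 / \<nu>)) + ennreal (3 * N\<^sup>2)) * ?Wt"
  proof -
    have "ennreal 3 * ennreal u + ennreal 3 * (ennreal v * Z) + ennreal 3 * (ennreal w * Z) =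
      ennreal (3 * u) + (ennreal (3 * v) + ennreal (3 * w)) * Z" for u v w Z
      by (simp add: ennreal_mult' distrib_right mult.assoc add.assoc)
    then show ?thesis .
  qed
  also have "ennreal (3 * (N\<^sup>2 / \<nu>)) + ennreal (3 * N\<^sup>2) = ennreal (3 * N\<^sup>2 * (1 + 1 / \<nu>))"
    using \<nu> by (subst ennreal_plus[symmetric]) (auto simp: algebra_simps)
  finally show ?thesis by (simp add: mult.assoc)
qed

section \<open>Comparison with the explicit solution of the integral equation\<close>

context
  fixes \<beta> C :: real and p :: "real \<Rightarrow> real"
  defines "\<beta> \<equiv> 6 * N\<^sup>2 * M\<^sup>2 * (1 + 1 / \<nu>)"
    and "C \<equiv> 6 * N\<^sup>2 * (1 + 1 / \<nu>) * A\<^sub>0\<^sup>2 / (\<nu> - \<beta>)"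
    and "p \<equiv> \<lambda>s. (3 * N\<^sup>2 * initial_energy - C) * exp (- (\<nu> - \<beta>) * (s - t0)) + C"
  assumes \<beta>: "\<beta> < \<nu>"
begin

text \<open>\<open>p s\<close> is a convex combination of the nonnegative numbers
  \<open>3 * N^2 * initial_energy\<close> and \<open>C\<close>, with the exponential as the weight
  of the first. Thus \<open>C\<close> is the limit of \<open>p s\<close> as \<open>s\<close>
  grows.\<close>

lemma bound_nonneg:
  assumes "t0 \<le> s"
  shows "0 \<le> p s"
proof -
  have "0 \<le> initial_energy" by (rule Bochner_Integration.integral_nonneg) simp
  moreover have "0 \<le> C" unfolding C_def using \<beta> \<nu> by (intro divide_nonneg_pos mult_nonneg_nonneg) auto
  moreover have "exp (- (\<nu> - \<beta>) * (s - t0)) \<le> 1" using \<beta> assms by (simp add: mult_nonpos_nonneg)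
  ultimately have "0 \<le> 3 * N\<^sup>2 * initial_energy * exp (- (\<nu> - \<beta>) * (s - t0)) + C * (1 - exp (- (\<nu> - \<beta>) * (s - t0)))"
    by (intro add_nonneg_nonneg mult_nonneg_nonneg) auto
  also have "\<dots> = p s" unfolding p_def by (simp add: algebra_simps)
  finally show ?thesis .
qed

text \<open>\<open>p\<close> solves the integral equation corresponding to the recursive inequality, whose integral
  operator contracts constants by the factor \<open>\<beta> / \<nu>\<close>.\<close>

lemma stopped_moment_improve:
  assumes D: "0 \<le> D" and le: "\<And>s. t0 \<le> s \<Longrightarrow> stopped_moment c s \<le> ennreal (p s + D)"
    and t: "t0 \<le> t" and c: "0 \<le> c"
  shows "stopped_moment c t \<le> ennreal (p t + \<beta> / \<nu> * D)"
proof -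
  define \<kappa> where "\<kappa> = 3 * N\<^sup>2 * (1 + 1 / \<nu>)"
  have \<kappa>: "0 < \<kappa>" unfolding \<kappa>_def using N \<nu> by (intro mult_pos_pos add_pos_pos) auto
  have \<beta>\<kappa>: "\<beta> = 2 * \<kappa> * M\<^sup>2" and C: "C * (\<nu> - \<beta>) = 2 * \<kappa> * A\<^sub>0\<^sup>2"
    using \<beta> by (simp_all add: \<beta>_def C_def \<kappa>_def)
  have \<beta>0: "0 \<le> \<beta>" unfolding \<beta>\<kappa> using \<kappa> by simp
  have E0: "0 \<le> initial_energy" by (rule Bochner_Integration.integral_nonneg) simp
  define f where "f s = exp (- \<nu> * (t - s)) * (2 * A\<^sub>0\<^sup>2 + 2 * M\<^sup>2 * (p s + D))" for s
  \<comment> \<open>An antiderivative of \<open>f\<close>. From p' = - (\<nu> - \<beta>) (p - C),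
    the derivative of exp (- \<nu> (t - s)) (p s + \<beta> D / \<nu>) is the exponential times
    \<beta> (p s + D) + (\<nu> - \<beta>) C. This factor is \<kappa> times the bracket in
    \<open>f\<close>, because \<open>\<beta> = 2 * \<kappa> * M^2\<close> and
    \<open>C * (\<nu> - \<beta>) = 2 * \<kappa> * A\<^sub>0^2\<close>.\<close>
  define \<Phi> where "\<Phi> s = exp (- \<nu> * (t - s)) * (p s + \<beta> * D / \<nu>) / \<kappa>" for s
  have p_cont: "continuous_on UNIV p" unfolding p_def by (intro continuous_intros)
  have p_deriv: "(p has_real_derivative - (\<nu> - \<beta>) * (p s - C)) (at s)" for s
    unfolding p_def by (auto intro!: derivative_eq_intros)
  have "(\<integral>\<^sup>+s. ennreal (exp (- \<nu> * (t - s))) * (ennreal (2 * A\<^sub>0\<^sup>2) + ennreal (2 * M\<^sup>2) * stopped_moment c s)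
       \<partial>restrict_space lborel {t0..t}) \<le> (\<integral>\<^sup>+s. ennreal (f s) \<partial>restrict_space lborel {t0..t})"
  proof (rule nn_integral_mono)
    fix s assume "s \<in> space (restrict_space lborel {t0..t})"
    then have s: "t0 \<le> s" by (simp add: space_restrict_space)
    have "ennreal (exp (- \<nu> * (t - s))) * (ennreal (2 * A\<^sub>0\<^sup>2) + ennreal (2 * M\<^sup>2) * stopped_moment c s) \<le>
      ennreal (exp (- \<nu> * (t - s))) * (ennreal (2 * A\<^sub>0\<^sup>2) + ennreal (2 * M\<^sup>2) * ennreal (p s + D))"
      by (intro mult_left_mono add_left_mono le s) auto
    also have "\<dots> = ennreal (f s)"
      using D bound_nonneg[OF s] unfolding f_def
      by (subst ennreal_mult'[symmetric], simp, subst ennreal_plus[symmetric], simp, simp, subst ennreal_mult', simp, simp)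
    finally show "ennreal (exp (- \<nu> * (t - s))) * (ennreal (2 * A\<^sub>0\<^sup>2) + ennreal (2 * M\<^sup>2) * stopped_moment c s) \<le> ennreal (f s)" .
  qed
  also have "\<dots> = ennreal (\<Phi> t - \<Phi> t0)"
    unfolding set_nn_integral_restrict[symmetric]
  proof (rule nn_integral_FTC_Icc)
    show "f \<in> borel_measurable borel" unfolding f_def
      by (intro borel_measurable_continuous_onI continuous_intros p_cont)
    show "0 \<le> f s" if "s \<in> {t0..t}" for s
      unfolding f_def using D bound_nonneg[of s] that by simp
    show "(\<Phi> has_real_derivative f s) (at s)" if "s \<in> {t0..t}" for s
    proof -
      let ?e = "exp (- \<nu> * (t - s))"
      have e: "((\<lambda>s. exp (- \<nu> * (t - s))) has_real_derivative \<nu> * ?e) (at s)"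
        by (auto intro!: derivative_eq_intros)
      have "(\<Phi> has_real_derivative
          (\<nu> * ?e * (p s + \<beta> * D / \<nu>) + (- (\<nu> - \<beta>) * (p s - C) + 0) * ?e) / \<kappa>) (at s)"
        unfolding \<Phi>_def by (rule DERIV_cdivide[OF DERIV_mult[OF e DERIV_add[OF p_deriv DERIV_const]]])
      also have "\<nu> * ?e * (p s + \<beta> * D / \<nu>) + (- (\<nu> - \<beta>) * (p s - C) + 0) * ?e =
          ?e * (\<beta> * (p s + D) + C * (\<nu> - \<beta>))"
        using \<nu> by (simp add: algebra_simps)
      also have "\<beta> * (p s + D) + C * (\<nu> - \<beta>) = \<kappa> * (2 * A\<^sub>0\<^sup>2 + 2 * M\<^sup>2 * (p s + D))"
        unfolding C by (simp add: \<beta>\<kappa> algebra_simps)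
      also have "?e * (\<kappa> * (2 * A\<^sub>0\<^sup>2 + 2 * M\<^sup>2 * (p s + D))) / \<kappa> = f s"
        unfolding f_def using \<kappa> by simp
      finally show ?thesis .
    qed
  qed (rule t)
  finally have integral_le: "(\<integral>\<^sup>+s. ennreal (exp (- \<nu> * (t - s))) * (ennreal (2 * A\<^sub>0\<^sup>2) + ennreal (2 * M\<^sup>2) * stopped_moment c s)
       \<partial>restrict_space lborel {t0..t}) \<le> ennreal (\<Phi> t - \<Phi> t0)" .
  have "stopped_moment c t \<le> ennreal (3 * N\<^sup>2 * exp (- \<nu> * (t - t0)) * initial_energy) + ennreal \<kappa> * ennreal (\<Phi> t - \<Phi> t0)"
    by (rule order_trans[OF stopped_moment_recursive[OF t c, folded \<kappa>_def] add_left_mono[OF mult_left_mono[OF integral_le]]]) simp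
  also have "\<dots> = ennreal (3 * N\<^sup>2 * exp (- \<nu> * (t - t0)) * initial_energy) + ennreal (\<kappa> * (\<Phi> t - \<Phi> t0))"
    using \<kappa> by (simp add: ennreal_mult')
  \<comment> \<open>Because \<open>p t0 = 3 * N^2 * initial_energy\<close>, the lower limit cancels
    the initial term of the recursion; the negative multiple of \<open>D\<close> left over is
    discarded below.\<close>
  also have "\<kappa> * (\<Phi> t - \<Phi> t0) = p t + \<beta> / \<nu> * D - exp (- \<nu> * (t - t0)) * (3 * N\<^sup>2 * initial_energy + \<beta> / \<nu> * D)"
    using \<kappa> by (simp add: \<Phi>_def p_def right_diff_distrib)
  also have "ennreal (3 * N\<^sup>2 * exp (- \<nu> * (t - t0)) * initial_energy) + ennreal \<dots> \<le> ennreal (p t + \<beta> / \<nu> * D)"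
  proof -
    \<comment> \<open>In \<open>ennreal\<close> the two terms add up like reals only if the second
      is nonnegative. It is: \<open>?e \<le> ?e1\<close> gives
      \<open>3 * N^2 * initial_energy * ?e \<le> p t\<close>, and the term with \<open>D\<close> is
      scaled by \<open>?e \<le> 1\<close>.\<close>
    let ?e = "exp (- \<nu> * (t - t0))" and ?e1 = "exp (- (\<nu> - \<beta>) * (t - t0))"
    have "0 \<le> \<beta> * (t - t0)" "0 \<le> (\<nu> - \<beta>) * (t - t0)" "0 \<le> \<nu> * (t - t0)"
      using \<beta> \<beta>0 \<nu> t by simp_all
    then have e1: "?e \<le> ?e1" "?e1 \<le> 1" "?e \<le> 1"
      unfolding exp_le_cancel_iff exp_le_one_iff by (simp_all add: algebra_simps)
    have "0 \<le> C" unfolding C_def using \<beta> \<nu> by (intro divide_nonneg_pos mult_nonneg_nonneg) auto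
    then have "0 \<le> C * (1 - ?e1)" using e1 by simp
    moreover have "3 * N\<^sup>2 * initial_energy * ?e \<le> 3 * N\<^sup>2 * initial_energy * ?e1"
      using E0 e1 by (intro mult_left_mono) auto
    ultimately have "3 * N\<^sup>2 * initial_energy * ?e \<le> p t" unfolding p_def by (simp add: algebra_simps)
    moreover have D': "0 \<le> \<beta> / \<nu> * D" using \<beta>0 \<nu> D by simp
    then have "?e * (\<beta> / \<nu> * D) \<le> 1 * (\<beta> / \<nu> * D)" using e1 by (intro mult_right_mono)
    ultimately have pos: "0 \<le> p t + \<beta> / \<nu> * D - ?e * (3 * N\<^sup>2 * initial_energy + \<beta> / \<nu> * D)"
      by (simp add: distrib_left mult.commute)
    have "0 \<le> ?e * (\<beta> / \<nu> * D)" by (rule mult_nonneg_nonneg[OF exp_ge_zero D'])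
    then have sum_le: "3 * N\<^sup>2 * ?e * initial_energy + (p t + \<beta> / \<nu> * D - ?e * (3 * N\<^sup>2 * initial_energy + \<beta> / \<nu> * D)) \<le>
        p t + \<beta> / \<nu> * D"
      by (simp add: distrib_left mult.commute mult.left_commute)
    have "0 \<le> 3 * N\<^sup>2 * ?e * initial_energy" using E0 by simp
    from ennreal_plus[OF this pos] show ?thesis using ennreal_leI[OF sum_le] by simp
  qed
  finally show ?thesis .
qed

text \<open>Each use of \<open>stopped_moment_improve\<close> shrinks the excess over
  \<open>p\<close> by the factor \<beta> / \<nu> < 1, simultaneously at all times from
  \<open>t0\<close> on. Starting from the crude uniform bound, the excess tends to 0.\<close>

lemma stopped_moment_le:
  assumes t: "t0 \<le> t" and c: "0 \<le> c"
  shows "stopped_moment c t \<le> ennreal (p t)"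
proof -
  define D where "D = 3 * N\<^sup>2 * initial_energy + 3 * (N * c)\<^sup>2 + 3 * (N\<^sup>2 * c + 1)"
  have "0 \<le> initial_energy" by (rule Bochner_Integration.integral_nonneg) simp
  then have D: "0 \<le> D" unfolding D_def using c by (intro add_nonneg_nonneg mult_nonneg_nonneg) auto
  have q: "0 \<le> \<beta> / \<nu>" "\<beta> / \<nu> < 1" using \<beta> \<nu> by (auto simp: \<beta>_def)
  have "\<forall>s\<ge>t0. stopped_moment c s \<le> ennreal (p s + (\<beta> / \<nu>) ^ k * D)" for k
  proof (induction k)
    case 0
    show ?case
    proof (intro allI impI)
      fix s assume s: "t0 \<le> s"
      have "stopped_moment c s \<le> ennreal D" unfolding D_def by (rule stopped_moment_bounded[OF s c])
      also have "\<dots> \<le> ennreal (p s + (\<beta> / \<nu>) ^ 0 * D)" using bound_nonneg[OF s] by (intro ennreal_leI) simp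
      finally show "stopped_moment c s \<le> ennreal (p s + (\<beta> / \<nu>) ^ 0 * D)" .
    qed
  next
    case (Suc k)
    have "0 \<le> (\<beta> / \<nu>) ^ k * D" using q D by simp
    from stopped_moment_improve[OF this _ _ c] Suc show ?case by (simp add: mult.assoc)
  qed
  then have le: "stopped_moment c t \<le> ennreal (p t + (\<beta> / \<nu>) ^ k * D)" for k using t by blast
  have "(\<lambda>k. ennreal (p t + (\<beta> / \<nu>) ^ k * D)) \<longlonglongrightarrow> ennreal (p t + 0 * D)"
    using q by (intro tendsto_intros LIMSEQ_power_zero) auto
  from LIMSEQ_le_const[OF this] le show ?thesis by auto
qed

text \<open>The bound \<open>p t\<close> does not involve \<open>c\<close>, so monotone convergence
  along \<open>c = k\<close> carries it over to the full second moment, whose finiteness is thereby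
  part of the conclusion.\<close>

lemma solution_second_moment:
  assumes t: "t0 \<le> t"
  shows "integrable P (\<lambda>\<omega>. (norm (x t \<omega>))\<^sup>2)" and "expectation (\<lambda>\<omega>. (norm (x t \<omega>))\<^sup>2) \<le>
    (3 * N\<^sup>2 * initial_energy - C) * exp (- (\<nu> - \<beta>) * (t - t0)) + C"
proof -
  note [measurable] = clock_measurable_at[OF t] solution_measurable_at[OF t]
  define g where "g k \<omega> = ennreal ((norm (x t \<omega>))\<^sup>2) * indicator {\<omega>. clock t \<omega> \<le> ennreal (real k)} \<omega>" for k :: nat and \<omega>
  have "(\<integral>\<^sup>+\<omega>. ennreal ((norm (x t \<omega>))\<^sup>2) \<partial>P) \<le> (\<integral>\<^sup>+\<omega>. (SUP k. g k \<omega>) \<partial>P)"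
  proof (rule nn_integral_mono_AE)
    show "AE \<omega> in P. ennreal ((norm (x t \<omega>))\<^sup>2) \<le> (SUP k. g k \<omega>)"
      using clock_finite[OF t]
    proof eventually_elim
      case (elim \<omega>)
      then obtain k :: nat where "clock t \<omega> \<le> of_nat k"
        using ennreal_Ex_less_of_nat[of "clock t \<omega>"] less_imp_le by auto
      then have "ennreal ((norm (x t \<omega>))\<^sup>2) \<le> g k \<omega>"
        by (simp add: g_def indicator_def ennreal_of_nat_eq_real_of_nat)
      then show ?case by (rule order_trans) (rule SUP_upper, simp)
    qed
  qed
  also have "\<dots> = (SUP k. \<integral>\<^sup>+\<omega>. g k \<omega> \<partial>P)"
  proof (rule nn_integral_monotone_convergence_SUP)
    show "incseq g"
      unfolding incseq_def le_fun_def g_def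
      by (auto simp: indicator_def intro: order_trans ennreal_leI)
    show "g k \<in> borel_measurable P" for k unfolding g_def[abs_def] by measurable
  qed
  also have "\<dots> \<le> ennreal (p t)"
    using stopped_moment_le[OF t] unfolding g_def stopped_moment_def by (intro SUP_least) simp
  finally have le: "(\<integral>\<^sup>+\<omega>. ennreal ((norm (x t \<omega>))\<^sup>2) \<partial>P) \<le> ennreal (p t)" .
  show int: "integrable P (\<lambda>\<omega>. (norm (x t \<omega>))\<^sup>2)"
    by (rule integrableI_bounded) (use le_less_trans[OF le ennreal_less_top] in auto)
  have "ennreal (expectation (\<lambda>\<omega>. (norm (x t \<omega>))\<^sup>2)) \<le> ennreal (p t)"
    using le int by (subst nn_integral_eq_integral[symmetric]) auto
  then show "expectation (\<lambda>\<omega>. (norm (x t \<omega>))\<^sup>2) \<le> (3 * N\<^sup>2 * initial_energy - C) * exp (- (\<nu> - \<beta>) * (t - t0)) + C"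
    using bound_nonneg[OF t] unfolding p_def by simp
qed

end
end

theorem theorem5p2:
  fixes P :: "'w measure" and W :: "real \<Rightarrow> 'w \<Rightarrow> real"
    and U :: "real \<Rightarrow> 'h::{real_inner, banach, second_countable_topology} \<Rightarrow>\<^sub>L 'h"
    and D :: "'h set" and A :: "'h \<Rightarrow> 'h"
    and F G :: "real \<Rightarrow> 'h \<Rightarrow> 'h"
    and N \<nu> A\<^sub>0 M t0 t :: real
    and x0 :: "'w \<Rightarrow> 'h" and x :: "real \<Rightarrow> 'w \<Rightarrow> 'h"
  assumes "prob_space P" and "two_sided_BM P W"
    and "C0_semigroup U" and "infinitesimal_generator U D A"
    and "N > 0" and "\<nu> > 0" and "\<forall>s\<ge>0. norm (U s) \<le> N * exp (- \<nu> * s)"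
    and "continuous_on UNIV (\<lambda>(s, y). F s y)" and "continuous_on UNIV (\<lambda>(s, y). G s y)"
    and "local_lipschitz UNIV UNIV F" and "local_lipschitz UNIV UNIV G"
    and "A\<^sub>0 > 0" and "M > 0"
    and "\<forall>s y. norm (F s y) \<le> A\<^sub>0 + M * norm y" and "\<forall>s y. norm (G s y) \<le> A\<^sub>0 + M * norm y"
    and "M < \<nu> / (N * sqrt (6 * (\<nu> + 1)))"
    and "mild_solution P W U F G t0 x0 x"
    and "integrable P (\<lambda>\<omega>. (norm (x0 \<omega>))\<^sup>2)"
    and "t \<ge> t0"
  shows "integrable P (\<lambda>\<omega>. (norm (x t \<omega>))\<^sup>2) \<and>
    prob_space.expectation P (\<lambda>\<omega>. (norm (x t \<omega>))\<^sup>2) \<le>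
      3 * N\<^sup>2 * (prob_space.expectation P (\<lambda>\<omega>. (norm (x0 \<omega>))\<^sup>2)
                 - 2 * A\<^sub>0\<^sup>2 * (\<nu> + 1) / (\<nu>\<^sup>2 - 6 * N\<^sup>2 * M\<^sup>2 * (\<nu> + 1)))
        * exp (- (\<nu> - 6 * N\<^sup>2 * M\<^sup>2 * (1 + 1 / \<nu>)) * (t - t0))
      + 6 * N\<^sup>2 * A\<^sub>0\<^sup>2 * (\<nu> + 1) / (\<nu>\<^sup>2 - 6 * N\<^sup>2 * M\<^sup>2 * (\<nu> + 1))"
proof -
  let ?\<beta> = "6 * N\<^sup>2 * M\<^sup>2 * (1 + 1 / \<nu>)" and ?d = "\<nu>\<^sup>2 - 6 * N\<^sup>2 * M\<^sup>2 * (\<nu> + 1)"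
  note N = \<open>N > 0\<close> and \<nu> = \<open>\<nu> > 0\<close>
  have "0 < N * sqrt (6 * (\<nu> + 1))" using N \<nu> by simp
  then have "M * (N * sqrt (6 * (\<nu> + 1))) < \<nu>"
    using \<open>M < \<nu> / (N * sqrt (6 * (\<nu> + 1)))\<close> by (simp add: pos_less_divide_eq)
  \<comment> \<open>Squaring removes the root: the smallness condition on \<open>M\<close> says that
    the denominator \<open>?d\<close> of the claim is positive.\<close>
  then have "(M * (N * sqrt (6 * (\<nu> + 1))))\<^sup>2 < \<nu>\<^sup>2"
    using N \<nu> \<open>M > 0\<close> by (intro power_strict_mono) auto
  moreover have "(M * (N * sqrt (6 * (\<nu> + 1))))\<^sup>2 = 6 * N\<^sup>2 * M\<^sup>2 * (\<nu> + 1)"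
    using \<nu> by (simp add: power_mult_distrib)
  ultimately have d: "0 < ?d" by simp
  \<comment> \<open>Since 1 + 1/\<nu> = (\<nu> + 1)/\<nu>, the decay rate is
    \<open>?d / \<nu>\<close>. This yields \<open>?\<beta> < \<nu>\<close> and, after cancelling
    \<nu>, brings the constant \<open>C\<close> into the form of the claim.\<close>
  have \<beta>: "\<nu> - ?\<beta> = ?d / \<nu>" using \<nu> by (simp add: field_simps power2_eq_square)
  then have "?\<beta> < \<nu>" using d \<nu> divide_pos_pos[of ?d \<nu>] by linarith
  note bound = solution_second_moment[OF assms(2) N \<nu> _ assms(8,9) \<open>A\<^sub>0 > 0\<close> \<open>M > 0\<close> _ _ assms(17,18) this \<open>t \<ge> t0\<close>]
  have C: "6 * N\<^sup>2 * (1 + 1 / \<nu>) * A\<^sub>0\<^sup>2 / (\<nu> - ?\<beta>) = 6 * N\<^sup>2 * A\<^sub>0\<^sup>2 * (\<nu> + 1) / ?d"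
  proof -
    have "6 * N\<^sup>2 * (1 + 1 / \<nu>) * A\<^sub>0\<^sup>2 = 6 * N\<^sup>2 * A\<^sub>0\<^sup>2 * (\<nu> + 1) / \<nu>" using \<nu> by (simp add: field_simps)
    then show ?thesis unfolding \<beta> using \<nu> by simp
  qed
  have "integrable P (\<lambda>\<omega>. (norm (x t \<omega>))\<^sup>2)" by (rule bound(1)) (use assms(7,14,15) in auto)
  moreover have "prob_space.expectation P (\<lambda>\<omega>. (norm (x t \<omega>))\<^sup>2) \<le>
      (3 * N\<^sup>2 * prob_space.expectation P (\<lambda>\<omega>. (norm (x0 \<omega>))\<^sup>2) - 6 * N\<^sup>2 * A\<^sub>0\<^sup>2 * (\<nu> + 1) / ?d) *
      exp (- (\<nu> - ?\<beta>) * (t - t0)) + 6 * N\<^sup>2 * A\<^sub>0\<^sup>2 * (\<nu> + 1) / ?d"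
    unfolding C[symmetric] by (rule bound(2)) (use assms(7,14,15) in auto)
  ultimately show ?thesis by (simp add: right_diff_distrib mult.assoc)
qed

end
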